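(* Let $\Xi$ be a simple stationary Poisson cylinder process in $\mathbb{R}^d$ with $k$-dimensional direction spaces, intensity $\lambda$, shape distribution $\theta$, directional distribution $\alpha$ on $G(k,d)$ and base kernel $\beta(\cdot,\xi)$, $\xi\in G(k,d)$, and let $U_\Xi=\bigcup_{Z\in\Xi}Z$. Suppose that for all $\xi\in G(k,d)$ the measure $\beta(\cdot,\xi)$ is concentrated on convex bodies and is isotropic (invariant under rotations of $\xi^\perp$). Let $\eta\in\mathbb{R}^d$ be a unit vector. Then the linear contact distribution function $H_\eta(r)=\mathbf{P}\bigl(U_\Xi\cap\{t\eta:0\le t\le r\}\neq\emptyset\mid\mathbf{o}\notin U_\Xi\bigr)$, $r>0$, is given by $$H_\eta(r)=1-e^{-\lambda r C_o(\eta)},\qquad C_o(\eta)=c_{d,k}\int_{G(k,d)}\int_{\mathcal{K}\cap\xi^\perp}S(K)\,\beta(\mathrm{d}K,\xi)\,[\xi,\eta]\,\alpha(\mathrm{d}\xi),$$ where $c_{d,k}=\dfrac{\omega_{d-k+1}}{2\pi\,\omega_{d-k}}$ and $\mathcal{K}\cap\xi^\perp$ denotes the family of all convex bodies contained in $\xi^\perp$.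
   Context: Let $0\le k\le d-1$ and let $G(k,d)$ be the Grassmannian of $k$-dimensional linear subspaces of $\mathbb{R}^d$. Let $\mathcal{K}$ be the family of non-empty compact convex sets (convex bodies) in $\mathbb{R}^d$ and $\mathcal{R}$ the convex ring, i.e. the family of finite unions of elements of $\mathcal{K}$ (Borel $\sigma$-algebra of the Hausdorff metric). A cylinder is a set $Z=K\oplus\xi$ (Minkowski sum) with direction space $\xi\in G(k,d)$ and base (cross-section) $K\in\mathcal{R}$, $K\subset\xi^\perp$; write $L(Z)=\xi$, $K(Z)=K$. $\mathcal{Z}_k$ is the set of all such cylinders, and $\mathcal{Z}_k^o\subset\mathcal{Z}_k$ is the set of those for which the midpoint of the circumsphere of $K(Z)$ is the origin $\mathbf{o}$. $\nu_{d-k}^{\xi}$ is $(d-k)$-dimensional Lebesgue measure on $\xi^\perp$. $\omega_n$ is the surface area of the unit ball in $\mathbb{R}^n$ (so $\omega_1=2$). For a convex body $K\subset\xi^\perp$, $S(K)$ is its surface area in the $(d-k)$-dimensional space $\xi^\perp$, i.e. the total mass of its surface area measure $S_{d-k-1}(K,\cdot)$ (equal to twice the intrinsic volume of order $d-k-1$; in particular $S(K)=2$ if $d-k=1$). $[\xi,\eta]$ is the volume of the parallelepiped spanned by the union of an orthonormal basis of $\xi$ and the unit vector $\eta$, i.e. the length of the orthogonal projection of $\eta$ onto $\xi^\perp$. A measure on $\mathcal{Z}_k$ is locally finite if for every compact $C\subset\mathbb{R}^d$ the set of cylinders hitting $C$ has finite measure. A Poisson cylinder process $\Xi$ is a Poisson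 point process on $\mathcal{Z}_k$ with locally finite intensity measure $\Lambda$; it is simple if it has no multiple points (equivalently $\Lambda$ is diffuse). It is stationary if its distribution is invariant under translations of $\mathbb{R}^d$. In that case there are $\lambda\ge 0$ (the intensity) and a probability measure $\theta$ on $\mathcal{Z}_k^o$ (the shape distribution) such that, for every measurable $f\ge 0$, $$\int_{\mathcal{Z}_k}f\,\mathrm{d}\Lambda=\lambda\int_{\mathcal{Z}_k^o}\int_{L(Z)^\perp}f(\mathbf{x}+Z)\,\nu_{d-k}^{L(Z)}(\mathrm{d}\mathbf{x})\,\theta(\mathrm{d}Z).$$ Moreover $\theta$ decomposes: there are a probability measure $\alpha$ on $G(k,d)$ (directional distribution) and a probability kernel $\beta$, with $\beta(\cdot,\xi)$ a probability measure on $\mathcal{R}$ concentrated on subsets of $\xi^\perp$, such that for all measurable $R\subset\mathcal{R}$ and $G\subset G(k,d)$ $$\theta(\{K\oplus\xi:K\in R,\ \xi\in G\})=\int_G\beta(R,\xi)\,\alpha(\mathrm{d}\xi),$$ i.e. $\theta$ is the law of $K\oplus\xi$ when $\xi\sim\alpha$ and, given $\xi$, $K\sim\beta(\cdot,\xi)$. Here $Z\in\Xi$ means that $Z$ lies in the support of $\Xi$; $U_\Xi$ is a random closed set. Standing assumption: the volume fraction $p=\mathbf{P}(\mathbf{o}\in U_\Xi)$ is positive (then $p\in(0,1)$). *)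

theory Defs
  imports "HOL-Probability.Probability" "HOL-Library.Set_Algebras"
begin

text \<open>
  \<open>\<real>\<^sup>d\<close> is \<^typ>\<open>real ^ 'n\<close> with \<open>d = CARD('n)\<close>; Minkowski sums are sums of sets
  (\<^theory>\<open>HOL-Library.Set_Algebras\<close>), and \<open>\<xi>\<^sup>\<bottom>\<close> is \<^const>\<open>orthogonal_comp\<close>.
\<close>


section \<open>Convex bodies, the convex ring and the Grassmannian\<close>

definition convex_bodies :: "(real ^ 'n) set set" where
  "convex_bodies = {K. K \<noteq> {} \<and> compact K \<and> convex K}"

text \<open>Only non-empty unions are admitted: the Hausdorff metric and the circumsphere of a base
  make sense for non-empty sets only.\<close>

definition convex_ring :: "(real ^ 'n) set set" where
  "convex_ring = {\<Union>F | F. finite F \<and> F \<noteq> {} \<and> F \<subseteq> convex_bodies}"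

definition grassmannian :: "nat \<Rightarrow> (real ^ 'n) set set" where
  "grassmannian k = {\<xi>. subspace \<xi> \<and> dim \<xi> = k}"

text \<open>The guard only serves to make the distance non-negative on all pairs of sets, as
  \<^locale>\<open>Metric_space\<close> demands.\<close>

definition hausdorff_dist :: "'a::metric_space set \<Rightarrow> 'a set \<Rightarrow> real" where
  "hausdorff_dist A B =
     (if A \<noteq> {} \<and> bounded A \<and> B \<noteq> {} \<and> bounded B
      then max (SUP a\<in>A. infdist a B) (SUP b\<in>B. infdist b A) else 0)"

text \<open>The gap metric; it equals the operator norm of the difference of the two orthogonal
  projections and induces the usual topology of the Grassmannian.\<close>

definition gap_dist :: "(real ^ 'n) set \<Rightarrow> (real ^ 'n) set \<Rightarrow> real" where
  "gap_dist \<xi> \<zeta> = hausdorff_dist (\<xi> \<inter> cball 0 1) (\<zeta> \<inter> cball 0 1)"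

definition borel_of :: "'a topology \<Rightarrow> 'a measure" where
  "borel_of X = sigma (topspace X) {U. openin X U}"

definition convex_ring_borel :: "(real ^ 'n) set measure" where
  "convex_ring_borel = borel_of (Metric_space.mtopology convex_ring hausdorff_dist)"

definition grassmannian_borel :: "nat \<Rightarrow> (real ^ 'n) set measure" where
  "grassmannian_borel k = borel_of (Metric_space.mtopology (grassmannian k) gap_dist)"

lemma bdd_above_infdist:
  fixes A :: "'a::heine_borel set"
  assumes "bounded A"
  shows "bdd_above ((\<lambda>a. infdist a B) ` A)"
proof -
  have "bounded ((\<lambda>a. infdist a B) ` closure A)"
    by (intro compact_imp_bounded compact_continuous_image continuous_intros)
      (simp add: assms compact_closure)
  then show ?thesis
    by (rule bounded_imp_bdd_above[OF bounded_subset]) (rule image_mono[OF closure_subset])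
qed

lemma infdist_le_hausdorff_dist:
  fixes A :: "'a::heine_borel set"
  assumes "bounded A" "bounded B" "B \<noteq> {}" "a \<in> A"
  shows "infdist a B \<le> hausdorff_dist A B"
  using cSUP_upper[OF assms(4) bdd_above_infdist[OF assms(1), of B]] assms
  by (auto simp: hausdorff_dist_def)

lemma hausdorff_dist_commute: "hausdorff_dist A B = hausdorff_dist B A"
  by (auto simp: hausdorff_dist_def max.commute)

lemma hausdorff_dist_nonneg: "0 \<le> hausdorff_dist A (B :: 'a::heine_borel set)"
proof (cases "A \<noteq> {} \<and> bounded A \<and> B \<noteq> {} \<and> bounded B")
  case True
  then obtain a where "a \<in> A" by blast
  then show ?thesis
    using infdist_le_hausdorff_dist[of A B a] infdist_nonneg[of a B] True by linarith
qed (auto simp: hausdorff_dist_def)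

lemma hausdorff_dist_le:
  fixes A B :: "'a::metric_space set"
  assumes "A \<noteq> {}" "B \<noteq> {}" "0 \<le> c"
    and "\<And>a. a \<in> A \<Longrightarrow> infdist a B \<le> c" "\<And>b. b \<in> B \<Longrightarrow> infdist b A \<le> c"
  shows "hausdorff_dist A B \<le> c"
  unfolding hausdorff_dist_def using assms by (auto intro!: cSUP_least)

lemma Metric_space_hausdorff_dist:
  "Metric_space {A. A \<noteq> {} \<and> compact A} (hausdorff_dist :: 'a::heine_borel set \<Rightarrow> 'a set \<Rightarrow> real)"
proof
  have sub: "A \<subseteq> B" if "compact A" "compact B" "B \<noteq> {}" "hausdorff_dist A B = 0"
    for A B :: "'a set"
  proof
    fix a assume "a \<in> A"
    then have "infdist a B \<le> hausdorff_dist A B"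
      by (intro infdist_le_hausdorff_dist compact_imp_bounded that(1,2,3))
    then have "infdist a B = 0" using infdist_nonneg[of a B] that(4) by linarith
    then show "a \<in> B"
      using in_closed_iff_infdist_zero[of B a] compact_imp_closed that by blast
  qed
  have step: "infdist a C \<le> hausdorff_dist A B + hausdorff_dist B C"
    if *: "compact A" "compact B" "compact C" "B \<noteq> {}" "C \<noteq> {}" "a \<in> A" for a and A B C :: "'a set"
  proof -
    obtain b where b: "b \<in> B" "infdist a B = dist a b"
      using infdist_attains_inf[OF compact_imp_closed[OF *(2)] *(4)] by blast
    have "infdist a C \<le> infdist b C + dist a b" by (rule infdist_triangle)
    also have "\<dots> \<le> hausdorff_dist B C + hausdorff_dist A B"
    proof (rule add_mono)
      show "infdist b C \<le> hausdorff_dist B C"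
        by (intro infdist_le_hausdorff_dist compact_imp_bounded * b(1))
      show "dist a b \<le> hausdorff_dist A B"
        unfolding b(2)[symmetric] by (intro infdist_le_hausdorff_dist compact_imp_bounded *)
    qed
    finally show ?thesis by simp
  qed
  fix A B C :: "'a set"
  show "hausdorff_dist A B = hausdorff_dist B A" by (rule hausdorff_dist_commute)
  show "0 \<le> hausdorff_dist A B" by (rule hausdorff_dist_nonneg)
  assume A: "A \<in> {A. A \<noteq> {} \<and> compact A}" and B: "B \<in> {A. A \<noteq> {} \<and> compact A}"
  show "hausdorff_dist A B = 0 \<longleftrightarrow> A = B"
  proof
    assume "hausdorff_dist A B = 0"
    then show "A = B"
      using sub[of A B] sub[of B A] A B hausdorff_dist_commute[of A B] by (intro equalityI) simp_all
  next
    assume "A = B"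
    then show "hausdorff_dist A B = 0" using A by (simp add: hausdorff_dist_def)
  qed
  assume C: "C \<in> {A. A \<noteq> {} \<and> compact A}"
  show "hausdorff_dist A C \<le> hausdorff_dist A B + hausdorff_dist B C"
  proof (rule hausdorff_dist_le)
    show "infdist a C \<le> hausdorff_dist A B + hausdorff_dist B C" if "a \<in> A" for a
      by (rule step) (use A B C that in auto)
    show "infdist c A \<le> hausdorff_dist A B + hausdorff_dist B C" if "c \<in> C" for c
    proof -
      have "infdist c A \<le> hausdorff_dist C B + hausdorff_dist B A"
        by (rule step) (use A B C that in auto)
      then show ?thesis
        by (simp add: hausdorff_dist_commute[of C] hausdorff_dist_commute[of B A])
    qed
  qed (use A C hausdorff_dist_nonneg[of A B] hausdorff_dist_nonneg[of B C] in auto)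
qed

lemma Metric_space_convex_ring: "Metric_space (convex_ring :: (real ^ 'n) set set) hausdorff_dist"
proof (rule Metric_space.subspace[OF Metric_space_hausdorff_dist])
  show "convex_ring \<subseteq> {A :: (real ^ 'n) set. A \<noteq> {} \<and> compact A}"
  proof
    fix K :: "(real ^ 'n) set" assume "K \<in> convex_ring"
    then obtain F where F: "K = \<Union>F" "finite F" "F \<noteq> {}" "F \<subseteq> convex_bodies"
      by (auto simp: convex_ring_def)
    then have "K \<noteq> {}" by (force simp: convex_bodies_def)
    moreover have "compact K" using F by (auto simp: convex_bodies_def intro!: compact_Union)
    ultimately show "K \<in> {A. A \<noteq> {} \<and> compact A}" by simp
  qed
qed

lemma Metric_space_grassmannian:
  "Metric_space (grassmannian k :: (real ^ 'n) set set) gap_dist"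
proof -
  interpret H: Metric_space "{A :: (real ^ 'n) set. A \<noteq> {} \<and> compact A}" hausdorff_dist
    by (rule Metric_space_hausdorff_dist)
  have mem: "\<xi> \<inter> cball 0 1 \<in> {A. A \<noteq> {} \<and> compact A}" if "\<xi> \<in> grassmannian k"
    for \<xi> :: "(real ^ 'n) set"
  proof -
    have "0 \<in> \<xi>" "closed \<xi>"
      using that by (auto simp: grassmannian_def subspace_0 closed_subspace)
    then have "0 \<in> \<xi> \<inter> cball 0 1" "compact (\<xi> \<inter> cball 0 1)"
      using closed_Int_compact[OF _ compact_cball] by simp_all
    then show ?thesis by blast
  qed
  have sub: "\<xi> \<subseteq> \<zeta>"
    if "\<xi> \<in> grassmannian k" "\<zeta> \<in> grassmannian k" "\<xi> \<inter> cball 0 1 = \<zeta> \<inter> cball 0 1"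
    for \<xi> \<zeta> :: "(real ^ 'n) set"
  proof
    fix x assume x: "x \<in> \<xi>"
    have s: "subspace \<xi>" "subspace \<zeta>" using that by (auto simp: grassmannian_def)
    have "inverse (norm x) *\<^sub>R x \<in> \<xi> \<inter> cball 0 1"
      using subspace_scale[OF s(1) x] by (cases "x = 0") simp_all
    then have "inverse (norm x) *\<^sub>R x \<in> \<zeta>" unfolding that(3) by blast
    then have "norm x *\<^sub>R (inverse (norm x) *\<^sub>R x) \<in> \<zeta>" by (rule subspace_scale[OF s(2)])
    then show "x \<in> \<zeta>" using subspace_0[OF s(2)] by (cases "x = 0") simp_all
  qed
  show ?thesis
  proof
    fix \<xi> \<zeta> \<upsilon> :: "(real ^ 'n) set"
    show "0 \<le> gap_dist \<xi> \<zeta>" by (simp add: gap_dist_def)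
    show "gap_dist \<xi> \<zeta> = gap_dist \<zeta> \<xi>" by (simp add: gap_dist_def hausdorff_dist_commute)
    assume a: "\<xi> \<in> grassmannian k" "\<zeta> \<in> grassmannian k"
    show "gap_dist \<xi> \<zeta> = 0 \<longleftrightarrow> \<xi> = \<zeta>"
      unfolding gap_dist_def H.zero[OF mem[OF a(1)] mem[OF a(2)]]
      using sub[OF a] sub[OF a(2,1)] by blast
    assume b: "\<upsilon> \<in> grassmannian k"
    show "gap_dist \<xi> \<upsilon> \<le> gap_dist \<xi> \<zeta> + gap_dist \<zeta> \<upsilon>"
      using H.triangle[OF mem[OF a(1)] mem[OF a(2)] mem[OF b]] by (simp add: gap_dist_def)
  qed
qed


section \<open>Cylinders\<close>

definition cylinders :: "nat \<Rightarrow> (real ^ 'n) set set" where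
  "cylinders k = {K + \<xi> | K \<xi>. \<xi> \<in> grassmannian k \<and> K \<in> convex_ring \<and> K \<subseteq> \<xi>\<^sup>\<bottom>}"

text \<open>Direction space and base are recovered from the cylinder as a set; see
  \<open>cylinder_direction_eq\<close> and \<open>cylinder_base_eq\<close> below.\<close>

definition cylinder_direction :: "(real ^ 'n) set \<Rightarrow> (real ^ 'n) set" where
  "cylinder_direction Z = {v. \<forall>z\<in>Z. \<forall>t. z + t *\<^sub>R v \<in> Z}"

definition cylinder_base :: "(real ^ 'n) set \<Rightarrow> (real ^ 'n) set" where
  "cylinder_base Z = Z \<inter> (cylinder_direction Z)\<^sup>\<bottom>"

lemma subspace_Int_orthogonal_comp_zero:
  assumes "x \<in> \<xi>" "x \<in> \<xi>\<^sup>\<bottom>" shows "x = 0"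
  using assms by (auto simp: orthogonal_comp_def orthogonal_self)

lemma cylinder_direction_eq:
  fixes \<xi> K :: "(real ^ 'n) set"
  assumes \<xi>: "subspace \<xi>" and K: "K \<in> convex_ring" "K \<subseteq> \<xi>\<^sup>\<bottom>"
  shows "cylinder_direction (K + \<xi>) = \<xi>"
proof
  show "\<xi> \<subseteq> cylinder_direction (K + \<xi>)"
  proof
    fix v assume v: "v \<in> \<xi>"
    have "z + t *\<^sub>R v \<in> K + \<xi>" if "z \<in> K + \<xi>" for z t
    proof -
      from that obtain y w where yw: "y \<in> K" "w \<in> \<xi>" "z = y + w" by (rule set_plus_elim)
      then have "w + t *\<^sub>R v \<in> \<xi>" using \<xi> v by (intro subspace_add subspace_scale)
      then have "y + (w + t *\<^sub>R v) \<in> K + \<xi>" using yw(1) by (intro set_plus_intro)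
      then show ?thesis using yw(3) by (simp add: add.assoc)
    qed
    then show "v \<in> cylinder_direction (K + \<xi>)" by (simp add: cylinder_direction_def)
  qed
next
  obtain F where F: "K = \<Union>F" "finite F" "F \<noteq> {}" "F \<subseteq> convex_bodies"
    using K by (auto simp: convex_ring_def)
  then have ne: "K \<noteq> {}" by (force simp: convex_bodies_def)
  have "compact K" using F by (auto simp: convex_bodies_def intro!: compact_Union)
  then have "bounded K" by (rule compact_imp_bounded)
  then obtain b where b: "\<And>x. x \<in> K \<Longrightarrow> norm x \<le> b"
    unfolding bounded_iff by blast
  show "cylinder_direction (K + \<xi>) \<subseteq> \<xi>"
  proof
    fix v assume v: "v \<in> cylinder_direction (K + \<xi>)"
    have "v \<in> \<xi> + \<xi>\<^sup>\<bottom>" using subspace_sum_orthogonal_comp[OF \<xi>] by simp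
    then obtain p q where pq: "p \<in> \<xi>" "q \<in> \<xi>\<^sup>\<bottom>" "v = p + q" by (rule set_plus_elim)
    obtain z where z: "z \<in> K" using ne by blast
    have mem: "z + t *\<^sub>R q \<in> K" for t
    proof -
      have "z + 0 \<in> K + \<xi>" using z subspace_0[OF \<xi>] by (rule set_plus_intro)
      then have "z \<in> K + \<xi>" by simp
      then have "z + t *\<^sub>R v \<in> K + \<xi>" using v by (auto simp: cylinder_direction_def)
      then obtain y w where yw: "y \<in> K" "w \<in> \<xi>" "z + t *\<^sub>R v = y + w" by (rule set_plus_elim)
      have "z + t *\<^sub>R q - y = w - t *\<^sub>R p"
        using yw(3) by (simp add: pq(3) algebra_simps)
      moreover have "z + t *\<^sub>R q - y \<in> \<xi>\<^sup>\<bottom>"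
        using z yw K pq subspace_orthogonal_comp[of \<xi>]
        by (intro subspace_diff subspace_add subspace_scale) auto
      moreover have "w - t *\<^sub>R p \<in> \<xi>" using yw pq \<xi> by (intro subspace_diff subspace_scale) auto
      ultimately have "z + t *\<^sub>R q - y = 0" using subspace_Int_orthogonal_comp_zero by metis
      then show ?thesis using yw by simp
    qed
    have "q = 0"
    proof (rule ccontr)
      assume q: "q \<noteq> 0"
      define t where "t = (2 * b + 1) / norm q"
      have b0: "0 \<le> b" using b[OF z] norm_ge_zero order_trans by blast
      have "norm (t *\<^sub>R q) \<le> norm (z + t *\<^sub>R q) + norm z"
        by (metis add_diff_cancel_left' norm_triangle_ineq4)
      also have "\<dots> \<le> 2 * b" using b[OF mem[of t]] b[OF z] by simp
      finally show False using q b0 by (simp add: t_def)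
    qed
    then show "v \<in> \<xi>" using pq by simp
  qed
qed

lemma cylinder_base_eq:
  fixes \<xi> K :: "(real ^ 'n) set"
  assumes \<xi>: "subspace \<xi>" and K: "K \<in> convex_ring" "K \<subseteq> \<xi>\<^sup>\<bottom>"
  shows "cylinder_base (K + \<xi>) = K"
proof -
  have "(K + \<xi>) \<inter> \<xi>\<^sup>\<bottom> = K"
  proof
    show "K \<subseteq> (K + \<xi>) \<inter> \<xi>\<^sup>\<bottom>"
    proof
      fix x assume x: "x \<in> K"
      have "x + 0 \<in> K + \<xi>" using x subspace_0[OF \<xi>] by (rule set_plus_intro)
      then show "x \<in> (K + \<xi>) \<inter> \<xi>\<^sup>\<bottom>" using x K(2) by auto
    qed
    show "(K + \<xi>) \<inter> \<xi>\<^sup>\<bottom> \<subseteq> K"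
    proof
      fix x assume x: "x \<in> (K + \<xi>) \<inter> \<xi>\<^sup>\<bottom>"
      then have "x \<in> K + \<xi>" "x \<in> \<xi>\<^sup>\<bottom>" by simp_all
      from this(1) obtain y w where yw: "y \<in> K" "w \<in> \<xi>" "x = y + w" by (rule set_plus_elim)
      have "x - y \<in> \<xi>\<^sup>\<bottom>"
        using \<open>x \<in> \<xi>\<^sup>\<bottom>\<close> yw(1) K(2) by (intro subspace_diff subspace_orthogonal_comp) auto
      then have "w \<in> \<xi>\<^sup>\<bottom>" using yw(3) by simp
      then show "x \<in> K" using yw subspace_Int_orthogonal_comp_zero[of w \<xi>] by simp
    qed
  qed
  then show ?thesis by (simp add: cylinder_base_def cylinder_direction_eq[OF assms])
qed

text \<open>Cylinders are identified with the pairs of their direction space and their base.\<close>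

definition cylinder_borel :: "nat \<Rightarrow> (real ^ 'n) set measure" where
  "cylinder_borel k =
     vimage_algebra (cylinders k) (\<lambda>Z. (cylinder_direction Z, cylinder_base Z))
       (grassmannian_borel k \<Otimes>\<^sub>M convex_ring_borel)"

definition is_circumcenter :: "(real ^ 'n) set \<Rightarrow> real ^ 'n \<Rightarrow> bool" where
  "is_circumcenter K c \<longleftrightarrow> (\<exists>r. K \<subseteq> cball c r \<and> (\<forall>c' r'. K \<subseteq> cball c' r' \<longrightarrow> r \<le> r'))"

definition centred_cylinders :: "nat \<Rightarrow> (real ^ 'n) set set" where
  "centred_cylinders k = {Z \<in> cylinders k. is_circumcenter (cylinder_base Z) 0}"

definition centred_cylinder_borel :: "nat \<Rightarrow> (real ^ 'n) set measure" where
  "centred_cylinder_borel k = restrict_space (cylinder_borel k) (centred_cylinders k)"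

definition hitting_cylinders :: "nat \<Rightarrow> (real ^ 'n) set \<Rightarrow> (real ^ 'n) set set" where
  "hitting_cylinders k C = {Z \<in> cylinders k. Z \<inter> C \<noteq> {}}"


section \<open>Lebesgue measure on a subspace, surface area, projections, rotations\<close>

definition onb_of :: "(real ^ 'n) set \<Rightarrow> (real ^ 'n) set" where
  "onb_of V = (SOME B. pairwise orthogonal B \<and> (\<forall>b\<in>B. norm b = 1) \<and> span B = V)"

text \<open>Lebesgue measure on the linear subspace \<open>V\<close>, regarded as a Borel measure on the whole
  space that is concentrated on \<open>V\<close>. The formula is the one that defines \<^const>\<open>lborel\<close>, with
  an orthonormal basis of \<open>V\<close> in place of \<^const>\<open>Basis\<close>; the result does not depend on the basis.\<close>

definition subspace_lborel :: "(real ^ 'n) set \<Rightarrow> (real ^ 'n) measure" where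
  "subspace_lborel V =
     distr (\<Pi>\<^sub>M b\<in>onb_of V. (lborel :: real measure)) borel (\<lambda>f. \<Sum>b\<in>onb_of V. f b *\<^sub>R b)"

text \<open>The surface area measure (of order \<open>dim V - 1\<close>) of a convex body \<open>K\<close> in the space \<open>V\<close>, for a
  set \<open>A\<close> of unit vectors of \<open>V\<close>: by the local Steiner formula, the volume of the local parallel
  set at distance \<open>\<rho>\<close> is \<open>\<rho> * S(K, A) + O(\<rho>\<^sup>2)\<close>.\<close>

definition local_parallel_set ::
  "(real ^ 'n) set \<Rightarrow> (real ^ 'n) set \<Rightarrow> (real ^ 'n) set \<Rightarrow> real \<Rightarrow> (real ^ 'n) set" where
  "local_parallel_set V K A \<rho> =
     {x \<in> V. 0 < infdist x K \<and> infdist x K \<le> \<rho> \<and>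
             (x - closest_point K x) /\<^sub>R infdist x K \<in> A}"

definition surface_area_measure ::
  "(real ^ 'n) set \<Rightarrow> (real ^ 'n) set \<Rightarrow> (real ^ 'n) set \<Rightarrow> ennreal" where
  "surface_area_measure V K A =
     Lim (at_right 0) (\<lambda>\<rho>. emeasure (subspace_lborel V) (local_parallel_set V K A \<rho>) / ennreal \<rho>)"

definition surface_area :: "(real ^ 'n) set \<Rightarrow> (real ^ 'n) set \<Rightarrow> ennreal" where
  "surface_area V K = surface_area_measure V K (V \<inter> sphere 0 1)"

text \<open>\<open>[\<xi>, \<eta>]\<close>; for a subspace, \<^const>\<open>closest_point\<close> is the orthogonal projection.\<close>

definition bracket :: "(real ^ 'n) set \<Rightarrow> real ^ 'n \<Rightarrow> real" where
  "bracket \<xi> \<eta> = norm (closest_point (\<xi>\<^sup>\<bottom>) \<eta>)"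

text \<open>Surface area of the unit ball in dimension \<open>n\<close>.\<close>

definition omega :: "nat \<Rightarrow> real" where
  "omega n = real n * unit_ball_vol (real n)"

text \<open>Rotations of \<open>\<xi>\<^sup>\<bottom>\<close>, extended by the identity on \<open>\<xi>\<close>.\<close>

definition rotations_of_comp :: "(real ^ 'n) set \<Rightarrow> (real ^ 'n ^ 'n) set" where
  "rotations_of_comp \<xi> = {Q. rotation_matrix Q \<and> (\<forall>x\<in>\<xi>. Q *v x = x)}"

definition isotropic_on_comp :: "(real ^ 'n) set \<Rightarrow> (real ^ 'n) set measure \<Rightarrow> bool" where
  "isotropic_on_comp \<xi> \<mu> \<longleftrightarrow>
     (\<forall>Q\<in>rotations_of_comp \<xi>. distr \<mu> convex_ring_borel (image ((*v) Q)) = \<mu>)"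


section \<open>Poisson cylinder processes\<close>

definition locally_finite_on_cylinders :: "nat \<Rightarrow> (real ^ 'n) set measure \<Rightarrow> bool" where
  "locally_finite_on_cylinders k \<mu> \<longleftrightarrow>
     sets \<mu> = sets (cylinder_borel k) \<and>
     (\<forall>C. compact C \<longrightarrow> emeasure \<mu> (hitting_cylinders k C) < \<infinity>)"

text \<open>Locally finite counting measures on the space of cylinders, with the \<open>\<sigma>\<close>-algebra generated by
  the evaluation maps.\<close>

definition counting_measures :: "nat \<Rightarrow> (real ^ 'n) set measure set" where
  "counting_measures k =
     {\<mu>. locally_finite_on_cylinders k \<mu> \<and>
         (\<forall>A\<in>sets (cylinder_borel k). emeasure \<mu> A \<in> range ennreal_of_enat)}"

definition counting_measure_space :: "nat \<Rightarrow> (real ^ 'n) set measure measure" where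
  "counting_measure_space k =
     (SUP A \<in> sets (cylinder_borel k).
        vimage_algebra (counting_measures k) (\<lambda>\<mu>. emeasure \<mu> A) borel)"

definition poisson_cylinder_process ::
  "nat \<Rightarrow> 'w measure \<Rightarrow> (real ^ 'n) set measure \<Rightarrow> ('w \<Rightarrow> (real ^ 'n) set measure) \<Rightarrow> bool" where
  "poisson_cylinder_process k M \<Lambda> \<Xi> \<longleftrightarrow>
     prob_space M \<and>
     \<Xi> \<in> M \<rightarrow>\<^sub>M counting_measure_space k \<and>
     locally_finite_on_cylinders k \<Lambda> \<and>
     (\<forall>A\<in>sets \<Lambda>. emeasure \<Lambda> A < \<infinity> \<longrightarrow>
        (\<forall>n. \<P>(\<omega> in M. emeasure (\<Xi> \<omega>) A = of_nat n) =
              measure \<Lambda> A ^ n / fact n * exp (- measure \<Lambda> A))) \<and>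
     (\<forall>A\<in>sets \<Lambda>. emeasure \<Lambda> A = \<infinity> \<longrightarrow> (AE \<omega> in M. emeasure (\<Xi> \<omega>) A = \<infinity>)) \<and>
     (\<forall>\<A>. finite \<A> \<and> \<A> \<subseteq> sets \<Lambda> \<and> disjoint \<A> \<longrightarrow>
        prob_space.indep_vars M (\<lambda>_. borel) (\<lambda>A \<omega>. emeasure (\<Xi> \<omega>) A) \<A>)"

definition simple_process :: "'w measure \<Rightarrow> ('w \<Rightarrow> (real ^ 'n) set measure) \<Rightarrow> bool" where
  "simple_process M \<Xi> \<longleftrightarrow> (AE \<omega> in M. \<forall>Z. emeasure (\<Xi> \<omega>) {Z} \<le> 1)"

definition stationary_process ::
  "nat \<Rightarrow> 'w measure \<Rightarrow> ('w \<Rightarrow> (real ^ 'n) set measure) \<Rightarrow> bool" where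
  "stationary_process k M \<Xi> \<longleftrightarrow>
     (\<forall>x. distr M (counting_measure_space k) (\<lambda>\<omega>. distr (\<Xi> \<omega>) (cylinder_borel k) (image ((+) x))) =
          distr M (counting_measure_space k) \<Xi>)"

text \<open>The support of a locally finite counting measure is the set of its atoms.\<close>

definition union_set :: "(real ^ 'n) set measure \<Rightarrow> (real ^ 'n) set" where
  "union_set \<mu> = \<Union>{Z. emeasure \<mu> {Z} > 0}"

definition linear_contact_distribution ::
  "'w measure \<Rightarrow> ('w \<Rightarrow> (real ^ 'n) set measure) \<Rightarrow> real ^ 'n \<Rightarrow> real \<Rightarrow> real" where
  "linear_contact_distribution M \<Xi> \<eta> r =
     \<P>(\<omega> in M. union_set (\<Xi> \<omega>) \<inter> {t *\<^sub>R \<eta> | t. 0 \<le> t \<and> t \<le> r} \<noteq> {} \<bar> 0 \<notin> union_set (\<Xi> \<omega>))"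

end

theory Submission
  imports Defs
begin

text \<open>
  The union set misses a compact set \<open>C\<close> exactly when the Poisson process has no point in the set of
  cylinders that hit \<open>C\<close>, so the void probability is \<open>exp (- \<Lambda> (hit C))\<close>. Applied to \<open>{0}\<close> and to the
  segment \<open>[0, r \<eta>]\<close>, this gives \<open>H (r) = 1 - exp (- (\<Lambda> (hit [0, r \<eta>]) - \<Lambda> (hit {0})))\<close>, and it remains to
  compute the increment. By the decomposition of \<open>\<Lambda>\<close>, a cylinder with direction \<open>\<xi>\<close> and base \<open>K\<close>
  contributes to \<open>\<Lambda> (hit C)\<close> the volume in \<open>\<xi>\<^sup>\<bottom>\<close> of \<open>P C - K\<close>, where \<open>P\<close> is the orthogonal projection
  onto \<open>\<xi>\<^sup>\<bottom>\<close>. For the segment this is the volume of \<open>K\<close> plus the volume that \<open>K\<close> sweeps out when it is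
  moved along \<open>r P \<eta>\<close>. For convex \<open>K\<close> the swept volume \<open>W (K, u)\<close> is positively homogeneous in \<open>u\<close> and
  even (\<open>sweep_scaleR\<close>, \<open>sweep_uminus\<close>), and \<open>norm (P \<eta>)\<close> is \<open>[\<xi>, \<eta>]\<close>. So the theorem reduces to the
  mean value formula that the isotropic mean of \<open>W (K, u)\<close> over \<open>K\<close>, for a unit vector \<open>u\<close>, is
  \<open>c\<^sub>d\<^sub>k\<close> times the mean surface area (\<open>mean_surface_area_eq_mean_sweep\<close>).

  This is Cauchy's surface area formula, averaged. The idea of the proof is to replace the unit ball
  \<open>B\<close> in the definition of the surface area, \<open>S (K) = lim (vol (K + \<rho> B) - vol K) / \<rho>\<close>, by a zonotope
  \<open>Z = [-u\<^sub>1, u\<^sub>1] + ... + [-u\<^sub>n, u\<^sub>n]\<close> with \<open>B \<subseteq> Z \<subseteq> (1 + \<epsilon>) B\<close>. Adding one segment at a time shows that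
  \<open>vol (K + \<rho> Z)\<close> has the right derivative \<open>2 (W (K, u\<^sub>1) + ... + W (K, u\<^sub>n))\<close> at \<open>\<rho> = 0\<close>
  (\<open>zonotope_expansion_derivative\<close>). Sandwiching \<open>B\<close> gives both the existence of the limit and the
  value of \<open>S (K)\<close> up to the factor \<open>1 + \<epsilon>\<close> (\<open>outer_quotient_tendsto\<close>). By isotropy the mean of \<open>W (K, u)\<close>
  depends on the length of \<open>u\<close> only, so the mean of \<open>S (K)\<close> is, up to \<open>1 + \<epsilon>\<close>, the sum of the
  \<open>2 norm u\<^sub>i\<close> times the mean of \<open>W (K, u)\<close> for a unit vector \<open>u\<close>. That sum is found by
  testing the same inequalities on \<open>K = B\<close>, whose surface area and swept volumes are elementary
  (\<open>ball_zonotope_mean_width\<close>). The zonotopes come from discretising the integral of \<open>\<bar>v \<bullet> x\<bar>\<close> over \<open>x\<close>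
  in the ball, which is a multiple of \<open>norm v\<close> by rotation invariance
  (\<open>zonotope_approximates_ball\<close>).

  The remaining work is measurability. All of it is derived from one principle: closed-set-valued
  maps are handled through the events that the set hits an open set, and these events are stable
  under Minkowski sums (\<open>hit_measurable_plus\<close>). It makes the cylinders that hit \<open>C\<close> a measurable
  set, provides a countable family of measurable sets that separates cylinders, which is what forces
  an integer-valued measure to have atoms (\<open>integer_valued_measure_atom\<close>), and shows that the
  volumes above are jointly measurable in \<open>(\<xi>, K)\<close>.
\<close>

section \<open>Translation-invariant measures on a subspace\<close>

text \<open>
  A multiple (possibly zero) of Haar measure of the group \<open>V\<close>, as a measure on the ambient space;
  this avoids a type for \<open>V\<close>.
\<close>

definition haar_on :: "'a::euclidean_space set \<Rightarrow> 'a measure \<Rightarrow> bool" where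
  "haar_on V \<mu> \<longleftrightarrow> sets \<mu> = sets borel \<and> (\<forall>v\<in>V. distr \<mu> borel ((+) v) = \<mu>) \<and>
     (AE x in \<mu>. x \<in> V) \<and> (\<forall>r. emeasure \<mu> (cball 0 r) < \<infinity>)"

lemma haar_on_sets: "haar_on V \<mu> \<Longrightarrow> sets \<mu> = sets borel"
  by (simp add: haar_on_def)

lemma haar_on_space: "haar_on V \<mu> \<Longrightarrow> space \<mu> = UNIV"
  by (metis haar_on_sets sets_eq_imp_space_eq space_borel)

lemma haar_on_sigma_finite:
  assumes "haar_on V \<mu>" shows "sigma_finite_measure \<mu>"
proof
  show "\<exists>A. countable A \<and> A \<subseteq> sets \<mu> \<and> \<Union>A = space \<mu> \<and> (\<forall>a\<in>A. emeasure \<mu> a \<noteq> \<infinity>)"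
  proof (intro exI conjI)
    show "countable (range (\<lambda>n::nat. cball (0::'a) (real n)))" by simp
    show "\<Union>(range (\<lambda>n::nat. cball (0::'a) (real n))) = space \<mu>"
      using real_arch_simple by (auto simp: haar_on_space[OF assms])
  qed (use assms in \<open>auto simp: haar_on_def less_top[symmetric]\<close>)
qed

lemma haar_on_nn_integral_translate:
  assumes "haar_on V \<mu>" "v \<in> V" and [measurable]: "f \<in> borel_measurable borel"
  shows "(\<integral>\<^sup>+x. f (v + x) \<partial>\<mu>) = (\<integral>\<^sup>+x. f x \<partial>\<mu>)"
proof -
  note [measurable_cong] = haar_on_sets[OF assms(1)]
  have "(\<integral>\<^sup>+x. f x \<partial>distr \<mu> borel ((+) v)) = (\<integral>\<^sup>+x. f (v + x) \<partial>\<mu>)"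
    by (rule nn_integral_distr) auto
  then show ?thesis using assms by (simp add: haar_on_def)
qed

lemma haar_on_emeasure_translate:
  assumes "haar_on V \<mu>" "v \<in> V" "A \<in> sets borel"
  shows "emeasure \<mu> ((+) v ` A) = emeasure \<mu> A"
proof -
  note [measurable_cong] = haar_on_sets[OF assms(1)]
  have A: "(+) v ` A \<in> sets borel"
  proof -
    have "(+) v ` A = (\<lambda>x. x - v) -` A \<inter> space borel" by (auto simp: image_iff intro!: bexI[of _ "_ - v"])
    also have "\<dots> \<in> sets borel" by (rule measurable_sets[OF _ assms(3)]) simp
    finally show ?thesis .
  qed
  have "emeasure \<mu> ((+) v ` A) = emeasure (distr \<mu> borel ((+) v)) ((+) v ` A)"
    using assms by (simp add: haar_on_def)
  also have "\<dots> = emeasure \<mu> A"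
    using A by (subst emeasure_distr) (auto simp: haar_on_space[OF assms(1)] intro!: arg_cong[where f="emeasure \<mu>"])
  finally show ?thesis .
qed

lemma haar_on_bounded_finite:
  assumes "haar_on V \<mu>" "bounded A"
  shows "emeasure \<mu> A < \<infinity>"
proof -
  obtain r where "A \<subseteq> cball 0 r" using assms(2)
    by (metis bounded_iff mem_cball_0 subsetI)
  then have "emeasure \<mu> A \<le> emeasure \<mu> (cball 0 r)"
    by (intro emeasure_mono) (auto simp: haar_on_sets[OF assms(1)])
  also have "\<dots> < \<infinity>" using assms by (simp add: haar_on_def)
  finally show ?thesis .
qed

text \<open>
  Uniqueness of Haar measure, cross-multiplied so as to hold for any normalisation. Both sides are
  the double integral of \<open>indicator A (x + y) * indicator B x\<close>: shifting \<open>y\<close> by \<open>x\<close> gives the left side,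
  shifting \<open>x\<close> by \<open>y\<close> gives \<open>\<mu> A\<close> times \<open>\<nu> (x - B)\<close>, and reflection turns this into \<open>\<nu> B\<close>.
\<close>

lemma haar_on_unique:
  fixes \<mu> \<nu> :: "'a::euclidean_space measure"
  assumes \<mu>: "haar_on V \<mu>" and \<nu>: "haar_on V \<nu>"
    and sym: "distr \<nu> borel uminus = \<nu>"
    and [measurable]: "A \<in> sets borel" "B \<in> sets borel"
  shows "emeasure \<nu> A * emeasure \<mu> B = emeasure \<mu> A * emeasure \<nu> B"
proof -
  interpret M: sigma_finite_measure \<mu> by (rule haar_on_sigma_finite[OF \<mu>])
  interpret N: sigma_finite_measure \<nu> by (rule haar_on_sigma_finite[OF \<nu>])
  interpret P: pair_sigma_finite \<mu> \<nu> by standard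
  note [measurable_cong] = haar_on_sets[OF \<mu>] haar_on_sets[OF \<nu>]
  have MV: "AE x in \<mu>. x \<in> V" and NV: "AE x in \<nu>. x \<in> V" using \<mu> \<nu> by (auto simp: haar_on_def)
  have neg: "(\<integral>\<^sup>+y. f (- y) \<partial>\<nu>) = (\<integral>\<^sup>+y. f y \<partial>\<nu>)" if [measurable]: "f \<in> borel_measurable borel" for f
  proof -
    have "(\<integral>\<^sup>+y. f y \<partial>distr \<nu> borel uminus) = (\<integral>\<^sup>+y. f (- y) \<partial>\<nu>)"
      by (rule nn_integral_distr) auto
    then show ?thesis unfolding sym by simp
  qed
  have "emeasure \<nu> A * emeasure \<mu> B = (\<integral>\<^sup>+x. indicator B x * (\<integral>\<^sup>+y. indicator A y \<partial>\<nu>) \<partial>\<mu>)"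
    by (subst nn_integral_multc) (simp_all add: mult.commute)
  also have "\<dots> = (\<integral>\<^sup>+x. indicator B x * (\<integral>\<^sup>+y. indicator A (x + y) \<partial>\<nu>) \<partial>\<mu>)"
    using MV by (intro nn_integral_cong_AE) (auto simp: haar_on_nn_integral_translate[OF \<nu>])
  also have "\<dots> = (\<integral>\<^sup>+x. (\<integral>\<^sup>+y. indicator B x * indicator A (x + y) \<partial>\<nu>) \<partial>\<mu>)"
    by (intro nn_integral_cong nn_integral_cmult[symmetric]) simp
  also have "\<dots> = (\<integral>\<^sup>+y. (\<integral>\<^sup>+x. indicator B x * indicator A (x + y) \<partial>\<mu>) \<partial>\<nu>)"
    by (rule P.Fubini'[symmetric]) measurable
  also have "\<dots> = (\<integral>\<^sup>+y. (\<integral>\<^sup>+x. indicator B (x - y) * indicator A x \<partial>\<mu>) \<partial>\<nu>)"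
  proof (intro nn_integral_cong_AE, use NV in eventually_elim)
    fix y assume y: "y \<in> V"
    have "(\<integral>\<^sup>+x. indicator B (y + x - y) * indicator A (y + x) \<partial>\<mu>) =
        (\<integral>\<^sup>+x. indicator B (x - y) * indicator A x \<partial>\<mu>)"
      by (rule haar_on_nn_integral_translate[OF \<mu> y, where f="\<lambda>x. indicator B (x - y) * indicator A x"]) measurable
    then show "(\<integral>\<^sup>+x. indicator B x * indicator A (x + y) \<partial>\<mu>) =
        (\<integral>\<^sup>+x. indicator B (x - y) * indicator A x \<partial>\<mu>)" by (simp add: add.commute)
  qed
  also have "\<dots> = (\<integral>\<^sup>+x. (\<integral>\<^sup>+y. indicator B (x - y) * indicator A x \<partial>\<nu>) \<partial>\<mu>)"
    by (rule P.Fubini') measurable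
  also have "\<dots> = (\<integral>\<^sup>+x. (\<integral>\<^sup>+y. indicator B (x - y) \<partial>\<nu>) * indicator A x \<partial>\<mu>)"
    by (intro nn_integral_cong nn_integral_multc) simp
  also have "\<dots> = (\<integral>\<^sup>+x. (\<integral>\<^sup>+y. indicator B (x + y) \<partial>\<nu>) * indicator A x \<partial>\<mu>)"
    using neg[of "\<lambda>y. indicator B (x + y)" for x] by simp
  also have "\<dots> = (\<integral>\<^sup>+x. (\<integral>\<^sup>+y. indicator B y \<partial>\<nu>) * indicator A x \<partial>\<mu>)"
    using MV by (intro nn_integral_cong_AE) (auto simp: haar_on_nn_integral_translate[OF \<nu>])
  also have "\<dots> = emeasure \<mu> A * emeasure \<nu> B"
    by (subst nn_integral_cmult) (simp_all add: mult.commute)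
  finally show ?thesis .
qed

lemma haar_on_eqI:
  assumes \<mu>: "haar_on V \<mu>" and \<nu>: "haar_on V \<nu>"
    and sym: "distr \<nu> borel uminus = \<nu>"
    and ball: "emeasure \<mu> (cball 0 1) = emeasure \<nu> (cball 0 1)" "emeasure \<nu> (cball 0 1) \<noteq> 0"
  shows "\<mu> = \<nu>"
proof (rule measure_eqI)
  show "sets \<mu> = sets \<nu>" by (simp add: haar_on_sets[OF \<mu>] haar_on_sets[OF \<nu>])
  fix A assume "A \<in> sets \<mu>"
  then have A: "A \<in> sets borel" by (simp add: haar_on_sets[OF \<mu>])
  have fin: "emeasure \<nu> (cball 0 1) \<noteq> \<infinity>" using \<nu> by (auto simp: haar_on_def less_top)
  have "emeasure \<nu> A * emeasure \<nu> (cball 0 1) = emeasure \<mu> A * emeasure \<nu> (cball 0 1)"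
    using haar_on_unique[OF \<mu> \<nu> sym A, of "cball 0 1"] ball(1) by simp
  then show "emeasure \<mu> A = emeasure \<nu> A"
    using ball(2) fin by (auto simp: mult.commute[of _ "emeasure \<nu> (cball 0 1)"] ennreal_mult_cancel_left)
qed

lemma haar_on_distr_orthogonal:
  fixes \<mu> :: "'a::euclidean_space measure"
  assumes V: "subspace V" and \<mu>: "haar_on V \<mu>" and T: "orthogonal_transformation T" and TV: "T ` V = V"
  shows "haar_on V (distr \<mu> borel T)"
proof -
  note [measurable_cong] = haar_on_sets[OF \<mu>]
  have lin: "linear T" using T by (rule orthogonal_transformation_linear)
  have [measurable]: "T \<in> borel_measurable borel"
    by (intro borel_measurable_continuous_onI linear_continuous_on linear_conv_bounded_linear[THEN iffD1] lin)
  show ?thesis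
    unfolding haar_on_def
  proof (intro conjI ballI allI)
    fix v assume "v \<in> V"
    then obtain w where w: "w \<in> V" "v = T w" using TV by auto
    have "distr (distr \<mu> borel T) borel ((+) v) = distr \<mu> borel ((+) v \<circ> T)"
      by (rule distr_distr) auto
    also have "(+) v \<circ> T = T \<circ> (+) w" by (auto simp: w linear_add[OF lin])
    also have "distr \<mu> borel (T \<circ> (+) w) = distr (distr \<mu> borel ((+) w)) borel T"
      by (rule distr_distr[symmetric]) auto
    also have "distr \<mu> borel ((+) w) = \<mu>" using \<mu> w by (simp add: haar_on_def)
    finally show "distr (distr \<mu> borel T) borel ((+) v) = distr \<mu> borel T" .
  next
    have "AE x in \<mu>. T x \<in> V" using \<mu> TV by (auto simp: haar_on_def elim!: AE_mp)
    then show "AE x in distr \<mu> borel T. x \<in> V" by (subst AE_distr_iff) (use borel_closed[OF closed_subspace[OF V]] in auto)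
  next
    fix r
    have "emeasure (distr \<mu> borel T) (cball 0 r) = emeasure \<mu> (T -` cball 0 r \<inter> space \<mu>)"
      by (rule emeasure_distr) auto
    also have "T -` cball 0 r \<inter> space \<mu> = cball 0 r"
      using orthogonal_transformation_norm[OF T] by (auto simp: haar_on_space[OF \<mu>])
    also have "emeasure \<mu> (cball 0 r) < \<infinity>" using \<mu> by (simp add: haar_on_def)
    finally show "emeasure (distr \<mu> borel T) (cball 0 r) < \<infinity>" .
  qed simp
qed

text \<open>
  Rotation invariance for free: the image measure is again translation-invariant on \<open>V\<close>, and it agrees
  with \<open>\<mu>\<close> on the unit ball.
\<close>

lemma haar_on_orthogonal_invariant:
  fixes \<mu> :: "'a::euclidean_space measure"
  assumes V: "subspace V" and \<mu>: "haar_on V \<mu>" "distr \<mu> borel uminus = \<mu>" "emeasure \<mu> (cball 0 1) \<noteq> 0"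
    and T: "orthogonal_transformation T" and TV: "T ` V = V"
  shows "distr \<mu> borel T = \<mu>"
proof (rule haar_on_eqI[OF haar_on_distr_orthogonal[OF V \<mu>(1) T TV] \<mu>(1,2) _ \<mu>(3)])
  note [measurable_cong] = haar_on_sets[OF \<mu>(1)]
  have lin: "linear T" using T by (rule orthogonal_transformation_linear)
  have [measurable]: "T \<in> borel_measurable borel"
    by (intro borel_measurable_continuous_onI linear_continuous_on linear_conv_bounded_linear[THEN iffD1] lin)
  have "emeasure (distr \<mu> borel T) (cball 0 1) = emeasure \<mu> (T -` cball 0 1 \<inter> space \<mu>)"
    by (rule emeasure_distr) auto
  also have "T -` cball 0 1 \<inter> space \<mu> = cball 0 1"
    using orthogonal_transformation_norm[OF T] by (auto simp: haar_on_space[OF \<mu>(1)])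
  finally show "emeasure (distr \<mu> borel T) (cball 0 1) = emeasure \<mu> (cball 0 1)" .
qed

lemma lborel_distr_uminus_euclidean: "distr lborel borel uminus = (lborel :: 'a::euclidean_space measure)"
  by (subst lborel_affine[of "-1" 0]) (simp_all add: density_1 one_ennreal_def[symmetric] distr_distr[unfolded comp_def] cong: distr_cong)

lemma haar_on_lborel: "haar_on UNIV (lborel :: 'a::euclidean_space measure)"
  by (auto simp: haar_on_def lborel_distr_plus emeasure_lborel_cball_finite[unfolded infinity_ennreal_def])

lemma lborel_orthogonal_invariant:
  fixes T :: "'a::euclidean_space \<Rightarrow> 'a"
  assumes "orthogonal_transformation T"
  shows "distr lborel borel T = lborel"
proof (rule haar_on_orthogonal_invariant[OF subspace_UNIV haar_on_lborel lborel_distr_uminus_euclidean _ assms])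
  have "emeasure lborel (cball 0 1 :: 'a set) = ennreal (unit_ball_vol (real DIM('a)))"
    using emeasure_cball[of 1 "0::'a"] by simp
  then show "emeasure lborel (cball 0 1 :: 'a set) \<noteq> 0"
    using unit_ball_vol_pos[OF of_nat_0_le_iff, of "DIM('a)"] ennreal_eq_0_iff
    by (metis not_le)
  show "range T = UNIV" using orthogonal_transformation_surj[OF assms] by simp
qed

section \<open>Lebesgue measure on a subspace\<close>

lemma PiM_lborel_distr_componentwise:
  fixes g :: "'i \<Rightarrow> real \<Rightarrow> real"
  assumes "finite B" and g: "\<And>b. b \<in> B \<Longrightarrow> g b \<in> borel_measurable borel"
    and inv: "\<And>b. b \<in> B \<Longrightarrow> distr lborel borel (g b) = lborel"
  shows "distr (\<Pi>\<^sub>M b\<in>B. lborel) (\<Pi>\<^sub>M b\<in>B. lborel) (\<lambda>f. \<lambda>b\<in>B. g b (f b)) = (\<Pi>\<^sub>M b\<in>B. (lborel :: real measure))"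
    (is "distr ?P ?P ?G = _")
proof -
  interpret product_sigma_finite "\<lambda>_::'i. lborel :: real measure" by standard
  have G: "?G \<in> ?P \<rightarrow>\<^sub>M ?P"
    by (rule measurable_restrict, rule measurable_compose[OF measurable_component_singleton]) (use g in simp_all)
  show ?thesis
  proof (rule PiM_eqI[OF assms(1)])
    show "sets (distr ?P ?P ?G) = sets ?P" by simp
    fix A assume A: "\<And>i. i \<in> B \<Longrightarrow> A i \<in> sets (lborel :: real measure)"
    have "emeasure (distr ?P ?P ?G) (Pi\<^sub>E B A) = emeasure ?P (?G -` Pi\<^sub>E B A \<inter> space ?P)"
      using A assms(1) by (intro emeasure_distr[OF G] sets_PiM_I_finite) auto
    also have "?G -` Pi\<^sub>E B A \<inter> space ?P = Pi\<^sub>E B (\<lambda>b. g b -` A b)"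
      by (auto simp: space_PiM PiE_iff extensional_def)
    also have "emeasure ?P (Pi\<^sub>E B (\<lambda>b. g b -` A b)) = (\<Prod>b\<in>B. emeasure lborel (g b -` A b))"
      using A g by (intro emeasure_PiM[OF assms(1)]) (auto intro: measurable_sets_borel)
    also have "\<dots> = (\<Prod>b\<in>B. emeasure lborel (A b))"
    proof (rule prod.cong[OF refl])
      fix b assume b: "b \<in> B"
      have "emeasure (distr lborel borel (g b)) (A b) = emeasure lborel (g b -` A b \<inter> space lborel)"
        using A[OF b] g[OF b] by (intro emeasure_distr) auto
      then show "emeasure lborel (g b -` A b) = emeasure lborel (A b)" by (simp add: inv[OF b])
    qed
    finally show "emeasure (distr ?P ?P ?G) (Pi\<^sub>E B A) = (\<Prod>b\<in>B. emeasure lborel (A b))" .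
  qed
qed

lemma measurable_onb_sum [measurable]:
  "(\<lambda>f. \<Sum>b\<in>(B :: 'a::euclidean_space set). f b *\<^sub>R b) \<in> (\<Pi>\<^sub>M b\<in>B. (lborel :: real measure)) \<rightarrow>\<^sub>M borel"
  by measurable

definition span_lborel :: "'a::euclidean_space set \<Rightarrow> 'a measure" where
  "span_lborel B = distr (\<Pi>\<^sub>M b\<in>B. (lborel :: real measure)) borel (\<lambda>f. \<Sum>b\<in>B. f b *\<^sub>R b)"

lemma sets_span_lborel: "sets (span_lborel B) = sets borel"
  by (simp add: span_lborel_def)

context
  fixes B :: "'a::euclidean_space set"
  assumes orth: "pairwise orthogonal B" and unit: "\<And>b. b \<in> B \<Longrightarrow> norm b = 1"
begin

lemma onb_finite: "finite B"
  using orth unit pairwise_orthogonal_imp_finite by blast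

lemma onb_independent: "independent B"
  using orth unit by (intro pairwise_orthogonal_independent) force+

lemma onb_card: "card B = dim (span B)"
  using onb_independent dim_span_eq_card_independent by metis

lemma onb_inner: "b \<in> B \<Longrightarrow> c \<in> B \<Longrightarrow> b \<bullet> c = (if b = c then 1 else 0)"
  using orth unit by (auto simp: pairwise_def orthogonal_def norm_eq_1)

lemma onb_norm_sum: "(norm (\<Sum>b\<in>B. f b *\<^sub>R b))\<^sup>2 = (\<Sum>b\<in>B. (f b)\<^sup>2)"
  unfolding power2_norm_eq_inner
  by (simp add: inner_sum_left inner_sum_right onb_inner onb_finite power2_eq_square if_distrib cong: if_cong)

text \<open>
  Maps that act on the coordinates separately are measure preserving if each coordinate map is. Both
  translations and the reflection at the origin are of this kind.
\<close>

lemma span_lborel_componentwise: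
  fixes g :: "'a \<Rightarrow> real \<Rightarrow> real"
  assumes g: "\<And>b. b \<in> B \<Longrightarrow> g b \<in> borel_measurable borel"
    and inv: "\<And>b. b \<in> B \<Longrightarrow> distr lborel borel (g b) = lborel"
    and T: "T \<in> borel_measurable borel" "\<And>f. T (\<Sum>b\<in>B. f b *\<^sub>R b) = (\<Sum>b\<in>B. g b (f b) *\<^sub>R b)"
  shows "distr (span_lborel B) borel T = span_lborel B"
proof -
  let ?P = "\<Pi>\<^sub>M b\<in>B. (lborel :: real measure)"
  have G: "(\<lambda>f. \<lambda>b\<in>B. g b (f b)) \<in> ?P \<rightarrow>\<^sub>M ?P"
    by (rule measurable_restrict, rule measurable_compose[OF measurable_component_singleton]) (use g in simp_all)
  have "distr (span_lborel B) borel T = distr ?P borel (T \<circ> (\<lambda>f. \<Sum>b\<in>B. f b *\<^sub>R b))"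
    unfolding span_lborel_def using T(1) by (intro distr_distr) auto
  also have "T \<circ> (\<lambda>f. \<Sum>b\<in>B. f b *\<^sub>R b) = (\<lambda>f. \<Sum>b\<in>B. f b *\<^sub>R b) \<circ> (\<lambda>f. \<lambda>b\<in>B. g b (f b))"
    by (auto simp: T(2))
  also have "distr ?P borel \<dots> = distr (distr ?P ?P (\<lambda>f. \<lambda>b\<in>B. g b (f b))) borel (\<lambda>f. \<Sum>b\<in>B. f b *\<^sub>R b)"
    using G by (intro distr_distr[symmetric]) auto
  finally show ?thesis
    by (simp add: PiM_lborel_distr_componentwise[OF onb_finite g inv] span_lborel_def)
qed

lemma span_lborel_uminus: "distr (span_lborel B) borel uminus = span_lborel B"
  by (rule span_lborel_componentwise[where g="\<lambda>_. uminus"]) (auto simp: lborel_distr_uminus sum_negf)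

lemma span_lborel_translate:
  assumes "v \<in> span B" shows "distr (span_lborel B) borel ((+) v) = span_lborel B"
proof -
  obtain c where c: "v = (\<Sum>b\<in>B. c b *\<^sub>R b)" using assms span_finite[OF onb_finite] by auto
  show ?thesis
    by (rule span_lborel_componentwise[where g="\<lambda>b. (+) (c b)"])
       (auto simp: c lborel_distr_plus sum.distrib scaleR_left_distrib)
qed

lemma emeasure_span_lborel_cball:
  assumes "r > 0"
  shows "emeasure (span_lborel B) (cball 0 r) = ennreal (unit_ball_vol (real (card B)) * r ^ card B)"
proof -
  let ?P = "\<Pi>\<^sub>M b\<in>B. (lborel :: real measure)"
  have "emeasure (span_lborel B) (cball 0 r) = emeasure ?P ((\<lambda>f. \<Sum>b\<in>B. f b *\<^sub>R b) -` cball 0 r \<inter> space ?P)"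
    unfolding span_lborel_def by (intro emeasure_distr) auto
  also have "(\<lambda>f. \<Sum>b\<in>B. f b *\<^sub>R b) -` cball 0 r = {f. sqrt (\<Sum>i\<in>B. (f i)\<^sup>2) \<le> r}"
    by (auto simp: onb_norm_sum[symmetric])
  finally show ?thesis by (simp add: emeasure_cball_aux[OF onb_finite assms])
qed

lemma haar_on_span_lborel: "haar_on (span B) (span_lborel B)"
  unfolding haar_on_def
proof (intro conjI ballI allI)
  show "AE x in span_lborel B. x \<in> span B"
    unfolding span_lborel_def
    by (subst AE_distr_iff)
       (auto intro!: borel_closed[OF closed_subspace] AE_I2 span_sum span_scale intro: span_base)
  fix r
  have "emeasure (span_lborel B) (cball 0 r) \<le> emeasure (span_lborel B) (cball 0 (max r 1))"
    by (intro emeasure_mono) (auto simp: span_lborel_def)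
  also have "\<dots> < \<infinity>" by (simp add: emeasure_span_lborel_cball)
  finally show "emeasure (span_lborel B) (cball 0 r) < \<infinity>" .
qed (simp_all add: span_lborel_translate sets_span_lborel)

end

context
  fixes V :: "(real ^ 'n) set"
  assumes V: "subspace V"
begin

lemma onb_of: "pairwise orthogonal (onb_of V)" "\<And>b. b \<in> onb_of V \<Longrightarrow> norm b = 1" "span (onb_of V) = V"
proof -
  obtain B where "pairwise orthogonal B" "\<And>x. x \<in> B \<Longrightarrow> norm x = 1" "span B = V"
    by (rule orthonormal_basis_subspace[OF V]) blast
  then have "\<exists>B. pairwise orthogonal B \<and> (\<forall>b\<in>B. norm b = 1) \<and> span B = V" by blast
  from someI_ex[OF this]
  show "pairwise orthogonal (onb_of V)" "\<And>b. b \<in> onb_of V \<Longrightarrow> norm b = 1" "span (onb_of V) = V"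
    unfolding onb_of_def by auto
qed

lemma subspace_lborel_eq: "subspace_lborel V = span_lborel (onb_of V)"
  by (simp add: subspace_lborel_def span_lborel_def)

lemma haar_on_subspace_lborel: "haar_on V (subspace_lborel V)"
  using haar_on_span_lborel[OF onb_of(1,2)] by (simp add: subspace_lborel_eq onb_of(3))

lemma subspace_lborel_uminus: "distr (subspace_lborel V) borel uminus = subspace_lborel V"
  using span_lborel_uminus[OF onb_of(1,2)] by (simp add: subspace_lborel_eq)

lemma emeasure_subspace_lborel_cball:
  "r > 0 \<Longrightarrow> emeasure (subspace_lborel V) (cball 0 r) = ennreal (unit_ball_vol (real (dim V)) * r ^ dim V)"
  using emeasure_span_lborel_cball[OF onb_of(1,2)] onb_card[OF onb_of(1,2)]
  by (simp add: subspace_lborel_eq onb_of(3))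

lemma emeasure_subspace_lborel_cball_pos: "emeasure (subspace_lborel V) (cball 0 1) \<noteq> 0"
  using emeasure_subspace_lborel_cball[of 1] unit_ball_vol_pos[OF of_nat_0_le_iff, of "dim V"] ennreal_eq_0_iff
  by (metis not_le power_one mult_1_right zero_less_one)

text \<open>
  The measure does not depend on the orthonormal basis, so that a basis can be adapted to a given
  unit vector.
\<close>

lemma subspace_lborel_onb:
  assumes "pairwise orthogonal B" "\<And>b. b \<in> B \<Longrightarrow> norm b = 1" "span B = V"
  shows "subspace_lborel V = span_lborel B"
proof (rule haar_on_eqI[OF haar_on_subspace_lborel])
  show "haar_on V (span_lborel B)" using haar_on_span_lborel[OF assms(1,2)] assms(3) by simp
  show "distr (span_lborel B) borel uminus = span_lborel B" by (rule span_lborel_uminus[OF assms(1,2)])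
  show "emeasure (subspace_lborel V) (cball 0 1) = emeasure (span_lborel B) (cball 0 1)"
    using emeasure_span_lborel_cball[OF assms(1,2)] onb_card[OF assms(1,2)] assms(3)
    by (simp add: emeasure_subspace_lborel_cball)
  then show "emeasure (span_lborel B) (cball 0 1) \<noteq> 0"
    using emeasure_subspace_lborel_cball_pos by simp
qed

lemma subspace_lborel_orthogonal:
  assumes "orthogonal_transformation T" "T ` V = V"
  shows "distr (subspace_lborel V) borel T = subspace_lborel V"
  by (rule haar_on_orthogonal_invariant[OF V haar_on_subspace_lborel subspace_lborel_uminus
      emeasure_subspace_lborel_cball_pos assms])

end

section \<open>The volume swept out by a body moving along a segment\<close>

text \<open>
  Cauchy's functional equation: additivity and monotonicity force \<open>real n * \<bar>f s - s * f 1\<bar> \<le> f 1\<close> for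
  every \<open>n\<close>.
\<close>

lemma additive_nonneg_imp_linear:
  fixes f :: "real \<Rightarrow> real"
  assumes add: "\<And>s t. 0 \<le> s \<Longrightarrow> 0 \<le> t \<Longrightarrow> f (s + t) = f s + f t"
    and nonneg: "\<And>s. 0 \<le> s \<Longrightarrow> 0 \<le> f s" and s: "0 \<le> s"
  shows "f s = s * f 1"
proof -
  have mono: "f a \<le> f b" if "0 \<le> a" "a \<le> b" for a b
    using add[of a "b - a"] nonneg[of "b - a"] that by simp
  have mult: "f (real n * a) = real n * f a" if "0 \<le> a" for n a
  proof (induction n)
    case 0
    then show ?case using add[of 0 0] by simp
  next
    case (Suc n)
    then show ?case using add[of a "real n * a"] that by (simp add: algebra_simps)
  qed
  have bound: "real n * \<bar>f s - s * f 1\<bar> \<le> f 1" for n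
  proof -
    define j where "j = nat \<lfloor>real n * s\<rfloor>"
    have j: "real j \<le> real n * s" "real n * s \<le> real j + 1"
      unfolding j_def using s by (auto simp: of_nat_nat)
    have "real j * f 1 \<le> real n * f s"
      using mono[OF _ j(1)] mult[of 1 j] mult[OF s, of n] by simp
    moreover have "real n * f s \<le> (real j + 1) * f 1"
      using mono[OF _ j(2)] mult[of 1 "Suc j"] mult[OF s, of n] s by (simp add: add.commute)
    moreover have "real j * f 1 \<le> real n * s * f 1" "real n * s * f 1 \<le> (real j + 1) * f 1"
      using j nonneg[of 1] by (auto intro!: mult_right_mono)
    ultimately have "\<bar>real n * f s - real n * s * f 1\<bar> \<le> f 1" by (simp add: algebra_simps abs_le_iff)
    moreover have "real n * f s - real n * s * f 1 = real n * (f s - s * f 1)" by (simp add: algebra_simps)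
    ultimately show ?thesis by (simp add: abs_mult)
  qed
  have "\<bar>f s - s * f 1\<bar> = 0"
  proof (rule ccontr)
    assume "\<bar>f s - s * f 1\<bar> \<noteq> 0"
    then obtain n where "f 1 < real n * \<bar>f s - s * f 1\<bar>"
      using reals_Archimedean3[of "\<bar>f s - s * f 1\<bar>"] by auto
    then show False using bound[of n] by simp
  qed
  then show ?thesis by simp
qed

lemma closed_segment_0_scaleR:
  assumes "0 \<le> s"
  shows "closed_segment 0 (s *\<^sub>R u) = (\<lambda>t. t *\<^sub>R u) ` {0..s}"
proof -
  have "{0..s} = (\<lambda>w. w * s) ` {0..1}"
  proof (cases "s = 0")
    case True
    then show ?thesis by (simp add: image_constant_conv)
  next
    case False
    then show ?thesis using image_mult_atLeastAtMost[of s 0 1] assms by (simp add: mult.commute[of _ s])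
  qed
  then show ?thesis by (simp add: closed_segment_image_interval image_image)
qed

lemma compact_set_plus: "compact A \<Longrightarrow> compact B \<Longrightarrow> compact (A + B :: 'a::real_normed_vector set)"
  unfolding set_plus_image
  by (rule compact_continuous_image[OF _ compact_Times]) (auto intro!: continuous_intros simp: split_beta)

lemma set_plus_closed_segment_0:
  assumes "0 \<le> s"
  shows "x \<in> K + closed_segment 0 (s *\<^sub>R u) \<longleftrightarrow> (\<exists>y\<in>K. \<exists>t\<in>{0..s}. x = y + t *\<^sub>R u)"
  unfolding closed_segment_0_scaleR[OF assms] by (auto simp: set_plus_def)

text \<open>
  Moving a convex body by a further \<open>t u\<close> after it was moved by \<open>s u\<close> adds a translate of what the move
  by \<open>t u\<close> alone adds. Convexity excludes that the body leaves a point and returns to it later.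
\<close>

lemma sweep_difference:
  fixes K :: "'a::real_normed_vector set"
  assumes K: "convex K" and s: "0 \<le> s" "0 \<le> t"
  shows "(K + closed_segment 0 ((s + t) *\<^sub>R u)) - (K + closed_segment 0 (s *\<^sub>R u)) =
         (+) (s *\<^sub>R u) ` ((K + closed_segment 0 (t *\<^sub>R u)) - K)" (is "?L = ?R")
proof
  show "?L \<subseteq> ?R"
  proof
    fix x assume x: "x \<in> ?L"
    then have "x \<in> K + closed_segment 0 ((s + t) *\<^sub>R u)" by simp
    then obtain y r where yr: "y \<in> K" "0 \<le> r" "r \<le> s + t" "x = y + r *\<^sub>R u"
      using set_plus_closed_segment_0[of "s + t" x K u] s by auto
    have "\<not> r \<le> s"
    proof
      assume "r \<le> s"
      then have "x \<in> K + closed_segment 0 (s *\<^sub>R u)"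
        unfolding set_plus_closed_segment_0[OF s(1)] using yr
        by (intro bexI[of _ y] bexI[of _ r]) auto
      then show False using x by simp
    qed
    then have "x - s *\<^sub>R u \<in> K + closed_segment 0 (t *\<^sub>R u)"
      unfolding set_plus_closed_segment_0[OF s(2)]
      using yr s by (intro bexI[of _ y] bexI[of _ "r - s"]) (auto simp: algebra_simps)
    moreover have "x - s *\<^sub>R u \<notin> K"
    proof
      assume "x - s *\<^sub>R u \<in> K"
      then have "x \<in> K + closed_segment 0 (s *\<^sub>R u)"
        unfolding set_plus_closed_segment_0[OF s(1)]
        using s by (intro bexI[of _ "x - s *\<^sub>R u"] bexI[of _ s]) auto
      then show False using x by simp
    qed
    ultimately show "x \<in> ?R" by (intro image_eqI[of _ _ "x - s *\<^sub>R u"]) auto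
  qed
  show "?R \<subseteq> ?L"
  proof
    fix x assume "x \<in> ?R"
    then obtain z where z: "x = s *\<^sub>R u + z" "z \<in> K + closed_segment 0 (t *\<^sub>R u)" "z \<notin> K" by auto
    then obtain y r where yr: "y \<in> K" "0 \<le> r" "r \<le> t" "z = y + r *\<^sub>R u"
      using set_plus_closed_segment_0[OF s(2), of z K u] by auto
    have "x \<in> K + closed_segment 0 ((s + t) *\<^sub>R u)"
      unfolding set_plus_closed_segment_0[OF add_nonneg_nonneg[OF s]]
      using yr z s by (intro bexI[of _ y] bexI[of _ "s + r"]) (auto simp: algebra_simps)
    moreover have "x \<notin> K + closed_segment 0 (s *\<^sub>R u)"
    proof
      assume "x \<in> K + closed_segment 0 (s *\<^sub>R u)"
      then obtain y' r' where y': "y' \<in> K" "0 \<le> r'" "r' \<le> s" "x = y' + r' *\<^sub>R u"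
        using set_plus_closed_segment_0[OF s(1), of x K u] by auto
      have eq: "y' = y + (r + (s - r')) *\<^sub>R u" using y'(4) z(1) yr(4) by (simp add: algebra_simps)
      show False
      proof (cases "r = 0")
        case True then show False using z yr by simp
      next
        case False
        \<comment> \<open>z lies between y and y' on a line in direction u, in the ratio w\<close>
        define w where "w = r / (r + (s - r'))"
        have pos: "0 < r + (s - r')" using False yr y' by simp
        have w: "0 \<le> w" "w \<le> 1" using pos yr y' by (auto simp: w_def)
        define D where "D = r + (s - r')"
        have "w * D = r" using pos by (simp add: w_def D_def)
        then have "z = y + (w * D) *\<^sub>R u" using yr(4) by simp
        also have "\<dots> = (1 - w) *\<^sub>R y + w *\<^sub>R y'"
          unfolding eq D_def[symmetric] by (simp add: algebra_simps)
        also have "\<dots> \<in> K" using convexD_alt[OF K yr(1) y'(1) w] .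
        finally show False using z by simp
      qed
    qed
    ultimately show "x \<in> ?L" by simp
  qed
qed

lemma subset_set_plus_segment: "K \<subseteq> K + closed_segment 0 (u :: 'a::real_normed_vector)"
  using set_zero_plus2[of "closed_segment 0 u" K] by (simp add: add.commute)

lemma translate_set_plus: "(+) v ` (A + B) = A + (+) v ` (B :: 'a::ab_group_add set)"
  by (force simp: set_plus_def image_iff ac_simps)

text \<open>
  For convex \<open>K\<close> this is the length of \<open>u\<close> times the volume of the projection of \<open>K\<close> along \<open>u\<close>.
\<close>

definition sweep :: "'a::euclidean_space measure \<Rightarrow> 'a set \<Rightarrow> 'a \<Rightarrow> real" where
  "sweep \<nu> K u = measure \<nu> (K + closed_segment 0 u) - measure \<nu> K"

context
  fixes V :: "'a::euclidean_space set" and \<nu> :: "'a measure"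
  assumes \<nu>: "haar_on V \<nu>"
begin

lemma haar_fmeasurable: "compact A \<Longrightarrow> A \<in> fmeasurable \<nu>"
  using haar_on_bounded_finite[OF \<nu> compact_imp_bounded]
  by (intro fmeasurableI) (auto simp: haar_on_sets[OF \<nu>] borel_closed compact_imp_closed)

lemma haar_emeasure_eq: "compact A \<Longrightarrow> emeasure \<nu> A = ennreal (measure \<nu> A)"
  using haar_fmeasurable by (intro emeasure_eq_measure2) auto

lemma haar_measure_mono: "compact A \<Longrightarrow> compact B \<Longrightarrow> A \<subseteq> B \<Longrightarrow> measure \<nu> A \<le> measure \<nu> B"
  using haar_fmeasurable by (intro measure_mono_fmeasurable) auto

lemma haar_measure_translate:
  "v \<in> V \<Longrightarrow> A \<in> sets borel \<Longrightarrow> measure \<nu> ((+) v ` A) = measure \<nu> A"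
  using haar_on_emeasure_translate[OF \<nu>] by (simp add: measure_def)

lemma sweep_nonneg: "compact K \<Longrightarrow> 0 \<le> sweep \<nu> K u"
  by (auto simp: sweep_def intro!: haar_measure_mono compact_set_plus subset_set_plus_segment)

lemma sweep_eq_Diff:
  assumes "compact K" shows "sweep \<nu> K u = measure \<nu> ((K + closed_segment 0 u) - K)"
  unfolding sweep_def using assms
  by (intro measurable_measure_Diff[symmetric] haar_fmeasurable compact_set_plus subset_set_plus_segment)
     (auto simp: haar_on_sets[OF \<nu>] borel_closed compact_imp_closed)

lemma sweep_scaleR:
  assumes V: "subspace V" and K: "compact K" "convex K" and u: "u \<in> V" and s: "0 \<le> s"
  shows "sweep \<nu> K (s *\<^sub>R u) = s * sweep \<nu> K u"
proof -
  have "sweep \<nu> K (s *\<^sub>R u) = s * sweep \<nu> K (1 *\<^sub>R u)"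
  proof (rule additive_nonneg_imp_linear[OF _ _ s])
    fix s t :: real assume st: "0 \<le> s" "0 \<le> t"
    let ?S = "\<lambda>s. K + closed_segment 0 (s *\<^sub>R u)"
    have sub: "?S s \<subseteq> ?S (s + t)" using st by (fastforce simp: set_plus_closed_segment_0)
    have borel: "?S s \<in> sets borel" for s
      using K by (intro borel_closed compact_imp_closed compact_set_plus) auto
    have "measure \<nu> (?S (s + t)) - measure \<nu> (?S s) = measure \<nu> (?S (s + t) - ?S s)"
      using K sub borel
      by (intro measurable_measure_Diff[symmetric] haar_fmeasurable compact_set_plus)
         (auto simp: haar_on_sets[OF \<nu>])
    also have "\<dots> = measure \<nu> (?S t - K)"
      unfolding sweep_difference[OF K(2) st] using u V K borel
      by (intro haar_measure_translate) (auto intro: subspace_scale sets.Diff borel_closed compact_imp_closed)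
    also have "\<dots> = sweep \<nu> K (t *\<^sub>R u)" by (simp add: sweep_eq_Diff K)
    finally show "sweep \<nu> K ((s + t) *\<^sub>R u) = sweep \<nu> K (s *\<^sub>R u) + sweep \<nu> K (t *\<^sub>R u)"
      by (simp add: sweep_def)
  qed (simp add: sweep_nonneg K)
  then show ?thesis by simp
qed

lemma measure_plus_symmetric_segment:
  assumes V: "subspace V" and K: "compact K" "convex K" and u: "u \<in> V"
  shows "measure \<nu> (K + closed_segment (- u) u) = measure \<nu> K + 2 * sweep \<nu> K u"
proof -
  have "closed_segment (- u) u = (+) (- u) ` closed_segment 0 (2 *\<^sub>R u)"
    using closed_segment_translation[of "- u" 0 "2 *\<^sub>R u"] by (simp add: scaleR_2)
  then have "K + closed_segment (- u) u = (+) (- u) ` (K + closed_segment 0 (2 *\<^sub>R u))"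
    by (simp only: translate_set_plus)
  also have "measure \<nu> \<dots> = measure \<nu> (K + closed_segment 0 (2 *\<^sub>R u))"
    using u V K by (intro haar_measure_translate borel_closed compact_imp_closed compact_set_plus)
      (auto intro: subspace_neg)
  also have "\<dots> = measure \<nu> K + 2 * sweep \<nu> K u"
    using sweep_scaleR[OF V K u, of 2] by (simp add: sweep_def)
  finally show ?thesis .
qed

lemma sweep_uminus:
  assumes V: "subspace V" and K: "compact K" and u: "u \<in> V"
  shows "sweep \<nu> K (- u) = sweep \<nu> K u"
proof -
  have "closed_segment 0 (- u) = (+) (- u) ` closed_segment 0 u"
    using closed_segment_translation[of "- u" u 0] by (simp add: closed_segment_commute)
  then have "K + closed_segment 0 (- u) = (+) (- u) ` (K + closed_segment 0 u)"
    by (simp only: translate_set_plus)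
  also have "measure \<nu> \<dots> = measure \<nu> (K + closed_segment 0 u)"
    using u V K by (intro haar_measure_translate borel_closed compact_imp_closed compact_set_plus)
      (auto intro: subspace_neg)
  finally show ?thesis by (simp add: sweep_def)
qed

text \<open>
  The parallel sets decrease to \<open>A\<close>, so this is continuity of the measure from above.
\<close>

lemma haar_parallel_tendsto:
  assumes A: "compact A"
  shows "((\<lambda>\<delta>. measure \<nu> (A + cball 0 \<delta>)) \<longlongrightarrow> measure \<nu> A) (at_right 0)"
proof -
  let ?F = "\<lambda>\<delta>. measure \<nu> (A + cball 0 \<delta>)"
  have A': "compact (A + cball 0 \<delta>)" for \<delta> using A by (intro compact_set_plus) auto
  have "(\<lambda>n. measure \<nu> (A + cball 0 (inverse (real (Suc n))))) \<longlonglongrightarrow> measure \<nu> (\<Inter>n. A + cball 0 (inverse (real (Suc n))))"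
  proof (rule Lim_measure_decseq)
    show "range (\<lambda>n. A + cball 0 (inverse (real (Suc n)))) \<subseteq> sets \<nu>"
      using A' by (auto simp: haar_on_sets[OF \<nu>] borel_closed compact_imp_closed)
    show "decseq (\<lambda>n. A + cball 0 (inverse (real (Suc n))))"
      by (intro decseq_SucI set_plus_mono2 subset_refl subset_cball) (simp add: field_simps)
    show "emeasure \<nu> (A + cball 0 (inverse (real (Suc i)))) \<noteq> \<infinity>" for i
      using haar_emeasure_eq[OF A'] by simp
  qed
  moreover have "(\<Inter>n. A + cball 0 (inverse (real (Suc n)))) = A"
  proof
    show "(\<Inter>n. A + cball 0 (inverse (real (Suc n)))) \<subseteq> A"
    proof
      fix x assume x: "x \<in> (\<Inter>n. A + cball 0 (inverse (real (Suc n))))"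
      have "\<exists>y\<in>A. dist y x < e" if e: "e > 0" for e
      proof -
        obtain n where n: "inverse (real (Suc n)) < e" using reals_Archimedean[OF e] by blast
        have "x \<in> A + cball 0 (inverse (real (Suc n)))" using x by blast
        then obtain y z where "y \<in> A" "norm z \<le> inverse (real (Suc n))" "x = y + z"
          by (auto simp: set_plus_def)
        then show ?thesis using n by (intro bexI[of _ y]) (auto simp: dist_norm)
      qed
      then have "x \<in> closure A" by (simp add: closure_approachable)
      then show "x \<in> A" using A compact_imp_closed closure_closed by blast
    qed
    show "A \<subseteq> (\<Inter>n. A + cball 0 (inverse (real (Suc n))))"
    proof (rule INT_greatest)
      show "A \<subseteq> A + cball 0 (inverse (real (Suc n)))" for n
        using set_zero_plus2[of "cball 0 (inverse (real (Suc n)))" A] by (simp add: add.commute)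
    qed
  qed
  ultimately have lim: "(\<lambda>n. ?F (inverse (real (Suc n)))) \<longlonglongrightarrow> measure \<nu> A" by simp
  show ?thesis
  proof (rule order_tendstoI)
    fix a assume "a < measure \<nu> A"
    moreover have "measure \<nu> A \<le> ?F \<delta>" if "\<delta> > 0" for \<delta>
      using that A A' set_zero_plus2[of "cball 0 \<delta>" A]
      by (intro haar_measure_mono) (auto simp: add.commute)
    ultimately have "a < ?F \<delta>" if "\<delta> > 0" for \<delta> using that by (meson less_le_trans)
    then show "eventually (\<lambda>\<delta>. a < ?F \<delta>) (at_right 0)"
      by (auto simp: eventually_at_right_field intro!: exI[of _ 1])
  next
    fix a assume "measure \<nu> A < a"
    then obtain n where n: "?F (inverse (real (Suc n))) < a"
      using order_tendstoD(2)[OF lim] by (auto simp: eventually_sequentially)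
    have "?F \<delta> < a" if "0 < \<delta>" "\<delta> < inverse (real (Suc n))" for \<delta>
    proof -
      have "?F \<delta> \<le> ?F (inverse (real (Suc n)))"
        using that A' by (intro haar_measure_mono set_plus_mono2 subset_refl subset_cball) auto
      then show ?thesis using n by simp
    qed
    then show "eventually (\<lambda>\<delta>. ?F \<delta> < a) (at_right 0)"
      unfolding eventually_at_right_field by (intro exI[of _ "inverse (real (Suc n))"]) auto
  qed
qed

lemma haar_shrinking_tendsto:
  assumes A: "compact A" "\<And>\<rho>. \<rho> > 0 \<Longrightarrow> compact (F \<rho>)"
    and F: "\<And>\<rho>. \<rho> > 0 \<Longrightarrow> A \<subseteq> F \<rho> \<and> F \<rho> \<subseteq> A + cball 0 (c * \<rho>)"
  shows "((\<lambda>\<rho>. measure \<nu> (F \<rho>)) \<longlongrightarrow> measure \<nu> A) (at_right 0)"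
proof -
  define c' where "c' = max c 1"
  have "filterlim (\<lambda>\<rho>. c' * \<rho>) (at_right 0) (at_right 0)"
    by (rule filterlim_times_pos[OF filterlim_ident]) (auto simp: c'_def)
  then have 1: "((\<lambda>\<rho>. measure \<nu> (A + cball 0 (c' * \<rho>))) \<longlongrightarrow> measure \<nu> A) (at_right 0)"
    by (rule filterlim_compose[OF haar_parallel_tendsto[OF A(1)]])
  have 2: "\<forall>\<^sub>F \<rho> in at_right 0. measure \<nu> A \<le> measure \<nu> (F \<rho>)"
    using eventually_at_right_less[of "0::real"]
    by eventually_elim (use A F in \<open>auto intro!: haar_measure_mono\<close>)
  have 3: "\<forall>\<^sub>F \<rho> in at_right 0. measure \<nu> (F \<rho>) \<le> measure \<nu> (A + cball 0 (c' * \<rho>))"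
    using eventually_at_right_less[of "0::real"]
  proof eventually_elim
    fix \<rho> :: real assume \<rho>: "0 < \<rho>"
    have "A + cball 0 (c * \<rho>) \<subseteq> A + cball 0 (c' * \<rho>)"
      using \<rho> by (intro set_plus_mono2 subset_cball subset_refl) (auto simp: c'_def)
    then show "measure \<nu> (F \<rho>) \<le> measure \<nu> (A + cball 0 (c' * \<rho>))"
      using F[OF \<rho>] A \<rho> by (intro haar_measure_mono compact_set_plus) auto
  qed
  show ?thesis by (rule tendsto_sandwich[OF 2 3 tendsto_const 1])
qed

end

section \<open>Zonotopes that approximate the ball\<close>

primrec zonotope :: "'a::real_normed_vector list \<Rightarrow> 'a set" where
  "zonotope [] = {0}"
| "zonotope (u # us) = zonotope us + closed_segment (- u) u"

lemma compact_zonotope: "compact (zonotope us)"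
  by (induction us) (auto intro: compact_set_plus)

lemma convex_zonotope: "convex (zonotope (us :: 'a::euclidean_space list))"
  by (induction us) (auto intro: convex_set_plus)

lemma zero_in_symmetric_segment: "0 \<in> closed_segment (- u) (u :: 'a::real_normed_vector)"
  by (auto simp: in_segment intro!: exI[of _ "1/2"] simp flip: scaleR_left_distrib)

lemma zero_in_zonotope: "0 \<in> zonotope us"
proof (induction us)
  case (Cons u us)
  then show ?case using set_plus_intro[OF Cons zero_in_symmetric_segment[of u]] by simp
qed simp

lemma linear_image_set_plus: "linear f \<Longrightarrow> f ` (A + B) = f ` A + f ` B"
  by (force simp: set_plus_def linear_add image_iff)

lemma zonotope_linear_image: "linear f \<Longrightarrow> zonotope (map f us) = f ` zonotope us"
  by (induction us)
     (simp_all add: linear_0 linear_image_set_plus closed_segment_linear_image[symmetric] linear_neg)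

text \<open>
  This and the next lemma say that \<open>v \<mapsto> (\<Sum>u\<leftarrow>us. \<bar>v \<bullet> u\<bar>)\<close> is the support function of the zonotope.
\<close>

lemma zonotope_inner_le: "z \<in> zonotope us \<Longrightarrow> v \<bullet> z \<le> (\<Sum>u\<leftarrow>us. \<bar>v \<bullet> u\<bar>)"
proof (induction us arbitrary: z)
  case (Cons u us)
  then obtain z' y where z: "z = z' + y" "z' \<in> zonotope us" "y \<in> closed_segment (- u) u"
    by (auto simp: set_plus_def)
  then obtain w where w: "0 \<le> w" "w \<le> 1" "y = (1 - w) *\<^sub>R (- u) + w *\<^sub>R u" by (auto simp: in_segment)
  have "v \<bullet> y = (2 * w - 1) * (v \<bullet> u)" unfolding w(3) by (simp add: inner_add_right algebra_simps)
  also have "\<dots> \<le> \<bar>2 * w - 1\<bar> * \<bar>v \<bullet> u\<bar>" using abs_ge_self[of "(2 * w - 1) * (v \<bullet> u)"] by (simp add: abs_mult)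
  also have "\<dots> \<le> \<bar>v \<bullet> u\<bar>" using w by (intro mult_left_le_one_le) (auto simp: abs_le_iff)
  finally show ?case using Cons.IH[OF z(2)] by (simp add: z(1) inner_add_right)
qed simp

lemma zonotope_inner_attained: "\<exists>z\<in>zonotope us. v \<bullet> z = (\<Sum>u\<leftarrow>us. \<bar>v \<bullet> u\<bar>)"
proof (induction us)
  case (Cons u us)
  then obtain z where z: "z \<in> zonotope us" "v \<bullet> z = (\<Sum>u\<leftarrow>us. \<bar>v \<bullet> u\<bar>)" by blast
  define y where "y = (if v \<bullet> u \<ge> 0 then u else - u)"
  have "y \<in> closed_segment (- u) u" by (simp add: y_def)
  then have "z + y \<in> zonotope (u # us)" using z by auto
  moreover have "v \<bullet> (z + y) = (\<Sum>u\<leftarrow>u # us. \<bar>v \<bullet> u\<bar>)"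
    using z by (auto simp: y_def inner_add_right)
  ultimately show ?case by blast
qed simp

lemma zonotope_subset_cball:
  fixes us :: "'a::euclidean_space list"
  assumes "\<And>v. (\<Sum>u\<leftarrow>us. \<bar>v \<bullet> u\<bar>) \<le> R * norm v"
  shows "zonotope us \<subseteq> cball 0 R"
proof
  have "0 \<le> (\<Sum>u\<leftarrow>us. \<bar>(SOME b. b \<in> Basis) \<bullet> u\<bar>)" by (rule sum_list_nonneg) auto
  then have R: "0 \<le> R" using assms[of "SOME b. b \<in> Basis"] by (simp add: norm_some_Basis)
  fix z assume "z \<in> zonotope us"
  then have "z \<bullet> z \<le> R * norm z" using zonotope_inner_le[of z us z] assms[of z] by linarith
  then have "norm z * norm z \<le> R * norm z" by (simp add: dot_square_norm power2_eq_square)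
  then show "z \<in> cball 0 R"
    using R by (cases "z = 0") auto
qed

text \<open>
  Inclusion of convex bodies is comparison of support functions: a point outside the zonotope is
  separated from it by a hyperplane.
\<close>

lemma cball_subset_zonotope:
  fixes us :: "'a::euclidean_space list"
  assumes "\<And>v. r * norm v \<le> (\<Sum>u\<leftarrow>us. \<bar>v \<bullet> u\<bar>)"
  shows "cball 0 r \<subseteq> zonotope us"
proof (rule ccontr)
  assume "\<not> cball 0 r \<subseteq> zonotope us"
  then obtain x where "x \<in> cball 0 r" "x \<notin> zonotope us" by blast
  then have x: "norm x \<le> r" "x \<notin> zonotope us" by simp_all
  obtain a b where ab: "a \<bullet> x < b" "\<And>z. z \<in> zonotope us \<Longrightarrow> b < a \<bullet> z"
    using separating_hyperplane_closed_point[OF convex_zonotope compact_imp_closed[OF compact_zonotope] x(2)]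
    by auto
  obtain z where z: "z \<in> zonotope us" "(- a) \<bullet> z = (\<Sum>u\<leftarrow>us. \<bar>(- a) \<bullet> u\<bar>)"
    using zonotope_inner_attained by blast
  have "r * norm (- a) \<le> (- a) \<bullet> z" using assms[of "- a"] z by simp
  also have "\<dots> < (- a) \<bullet> x" using ab z(1) by (smt (verit) inner_minus_left)
  also have "\<dots> \<le> norm (- a) * norm x" by (rule norm_cauchy_schwarz)
  also have "\<dots> \<le> r * norm (- a)" using mult_right_mono[OF x(1) norm_ge_zero, of a] by (simp add: mult.commute)
  finally show False by simp
qed

definition reflection :: "'a::real_inner \<Rightarrow> 'a \<Rightarrow> 'a" where
  "reflection w x = x - (2 * (x \<bullet> w) / (w \<bullet> w)) *\<^sub>R w"

lemma linear_reflection: "linear (reflection w)"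
  by (rule linearI) (auto simp: reflection_def inner_add_left algebra_simps add_divide_distrib)

lemma reflection_orthogonal: "x \<bullet> w = 0 \<Longrightarrow> reflection w x = x"
  by (simp add: reflection_def)

lemma reflection_self: "reflection w w = - w"
  by (cases "w = 0") (auto simp: reflection_def scaleR_2)

lemma orthogonal_transformation_reflection: "orthogonal_transformation (reflection w)"
  unfolding orthogonal_transformation_def
proof (intro conjI linear_reflection allI)
  fix x y
  define c where "c = 2 * (x \<bullet> w) / (w \<bullet> w)"
  define d where "d = 2 * (y \<bullet> w) / (w \<bullet> w)"
  have 1: "c * (w \<bullet> w) = 2 * (x \<bullet> w)" by (cases "w = 0") (auto simp: c_def)
  have 2: "d * (x \<bullet> w) = c * (y \<bullet> w)" by (simp add: c_def d_def)
  have "reflection w x \<bullet> reflection w y = (x - c *\<^sub>R w) \<bullet> (y - d *\<^sub>R w)"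
    by (simp add: reflection_def c_def d_def)
  also have "\<dots> = x \<bullet> y - d * (x \<bullet> w) - c * (y \<bullet> w) + d * (c * (w \<bullet> w))"
    by (simp add: inner_diff_left inner_diff_right inner_commute[of w y] algebra_simps)
  also have "\<dots> = x \<bullet> y" unfolding 1 using 2 by simp
  finally show "reflection w x \<bullet> reflection w y = x \<bullet> y" .
qed

lemma reflection_swap:
  assumes "norm u = norm v" shows "reflection (u - v) u = v"
proof (cases "u = v")
  case False
  have uv: "u \<bullet> u = v \<bullet> v" using assms by (simp add: norm_eq)
  have "(u - v) \<bullet> (u - v) = 2 * (u \<bullet> (u - v))"
    by (simp add: inner_diff_left inner_diff_right uv inner_commute)
  moreover have "(u - v) \<bullet> (u - v) \<noteq> 0" using False by simp
  ultimately have 1: "2 * (u \<bullet> (u - v)) / ((u - v) \<bullet> (u - v)) = 1" by (metis divide_self)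
  show ?thesis by (simp only: reflection_def 1) simp
qed (simp add: reflection_def)

text \<open>
  The support function of a zonoid that is a ball by symmetry; its discretisations are zonotopes.
\<close>

definition ball_abs_moment :: "'a::euclidean_space \<Rightarrow> real" where
  "ball_abs_moment v = (\<integral>x. indicator (cball 0 1) x * \<bar>v \<bullet> x\<bar> \<partial>lborel)"

lemma integrable_cball_continuous:
  fixes f :: "'a::euclidean_space \<Rightarrow> real"
  assumes "continuous_on UNIV f"
  shows "integrable lborel (\<lambda>x. indicator (cball 0 1) x * f x)"
  using borel_integrable_compact[OF compact_cball[of 0 1] continuous_on_subset[OF assms subset_UNIV]]
  by (simp add: indicator_scaleR_eq_if indicator_def if_distrib cong: if_cong)

text \<open>
  A reflection takes \<open>u\<close> to any \<open>v\<close> of the same length, hence the value depends on the length only. It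
  does not vanish, because \<open>e \<bullet> x \<ge> 1/4\<close> on a small ball around \<open>e / 2\<close>.
\<close>

lemma ball_abs_moment_norm:
  obtains a where "a > 0" "\<And>v :: 'a::euclidean_space. ball_abs_moment v = a * norm v"
proof -
  define e :: 'a where "e = (SOME b. b \<in> Basis)"
  have e: "norm e = 1" by (simp add: e_def norm_some_Basis)
  have inv: "ball_abs_moment u = ball_abs_moment v" if "norm u = norm v" for u v :: 'a
  proof -
    let ?T = "reflection (u - v)"
    have T: "orthogonal_transformation ?T" by (rule orthogonal_transformation_reflection)
    have meas: "?T \<in> lborel \<rightarrow>\<^sub>M borel"
      using borel_measurable_continuous_onI[OF linear_continuous_on[OF
        linear_conv_bounded_linear[THEN iffD1, OF linear_reflection]]] by simp
    have "ball_abs_moment v = (\<integral>x. indicator (cball 0 1) x * \<bar>v \<bullet> x\<bar> \<partial>distr lborel borel ?T)"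
      by (simp add: ball_abs_moment_def lborel_orthogonal_invariant[OF T])
    also have "\<dots> = (\<integral>x. indicator (cball 0 1) (?T x) * \<bar>v \<bullet> ?T x\<bar> \<partial>lborel)"
      by (intro integral_distr[OF meas] borel_measurable_times borel_measurable_indicator)
         (auto intro!: borel_closed borel_measurable_continuous_onI continuous_intros)
    also have "\<dots> = ball_abs_moment u"
      unfolding ball_abs_moment_def
    proof (rule Bochner_Integration.integral_cong[OF refl])
      fix x
      have "v \<bullet> ?T x = ?T u \<bullet> ?T x" by (simp add: reflection_swap[OF that])
      also have "\<dots> = u \<bullet> x" using T by (simp add: orthogonal_transformation_def)
      finally show "indicator (cball 0 1) (?T x) * \<bar>v \<bullet> ?T x\<bar> = indicator (cball 0 1) x * \<bar>u \<bullet> x\<bar>"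
        by (simp add: indicator_def orthogonal_transformation_norm[OF T])
    qed
    finally show ?thesis by simp
  qed
  show ?thesis
  proof
    let ?b = "ball (e /\<^sub>R 2) (1/4)"
    have ge: "1/4 * indicator ?b x \<le> indicator (cball 0 1) x * \<bar>e \<bullet> x\<bar>" for x
    proof (cases "x \<in> ?b")
      case True
      then have d: "norm (e /\<^sub>R 2 - x) < 1/4" by (simp add: dist_norm)
      then have "norm x \<le> 1" using norm_triangle_ineq2[of x "e /\<^sub>R 2"] e by (simp add: norm_minus_commute)
      moreover have "e \<bullet> (e /\<^sub>R 2 - x) \<le> 1/4"
        using norm_cauchy_schwarz[of e "e /\<^sub>R 2 - x"] d e by simp
      then have "e \<bullet> x \<ge> 1/4" using e by (simp add: inner_diff_right norm_eq_1)
      ultimately show ?thesis using True by simp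
    qed simp
    have "0 < 1/4 * measure lborel ?b" by (simp add: content_ball_pos)
    also have "\<dots> = (\<integral>x. 1/4 * indicator ?b x \<partial>lborel)"
      by simp
    also have "\<dots> \<le> ball_abs_moment e"
      unfolding ball_abs_moment_def
      by (intro integral_mono ge integrable_cball_continuous integrable_mult_right integrable_real_indicator continuous_intros)
         (simp_all add: emeasure_lborel_ball_finite[unfolded infinity_ennreal_def])
    finally show "0 < ball_abs_moment e" .
    show "ball_abs_moment v = ball_abs_moment e * norm v" for v :: 'a
    proof -
      have "ball_abs_moment v = ball_abs_moment (norm v *\<^sub>R e)" by (rule inv) (simp add: e)
      also have "\<dots> = (\<integral>x. norm v * (indicator (cball 0 1) x * \<bar>e \<bullet> x\<bar>) \<partial>lborel)"
        unfolding ball_abs_moment_def by (intro Bochner_Integration.integral_cong refl) (simp add: abs_mult)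
      also have "\<dots> = ball_abs_moment e * norm v" unfolding ball_abs_moment_def by simp
      finally show ?thesis .
    qed
  qed
qed

text \<open>
  The unit ball is cut into finitely many pieces of diameter of order \<open>d\<close>. Each piece contributes one
  vector, a point near the piece weighted with the volume of the piece; the error in the integrand is at
  most \<open>d * norm v\<close>.
\<close>

lemma ball_abs_moment_discretise:
  fixes \<delta> :: real
  assumes "\<delta> > 0"
  obtains us :: "'a::euclidean_space list"
  where "\<And>v. \<bar>(\<Sum>u\<leftarrow>us. \<bar>v \<bullet> u\<bar>) - ball_abs_moment v\<bar> \<le> \<delta> * norm v"
proof -
  let ?B = "cball (0::'a) 1"
  define \<kappa> where "\<kappa> = measure lborel ?B"
  have \<kappa>: "\<kappa> > 0" unfolding \<kappa>_def by (simp add: content_cball_pos)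
  define d where "d = \<delta> / \<kappa>"
  have d: "d > 0" using assms \<kappa> by (simp add: d_def)
  obtain C where C: "finite C" "?B \<subseteq> (\<Union>x\<in>C. ball x d)"
    using compact_cball[of "0::'a" 1] d unfolding compact_eq_totally_bounded by metis
  obtain cs where cs: "set cs = C" using finite_list[OF C(1)] by blast
  define n where "n = length cs"
  define A where "A i = disjointed (\<lambda>i. ball (cs ! i) d) i" for i
  have Asub: "A i \<subseteq> ball (cs ! i) d" for i
    unfolding A_def by (rule disjointed_subset)
  have [measurable]: "A i \<in> sets borel" for i
    unfolding A_def disjointed_def by auto
  have disj: "A i \<inter> A j = {}" if "i \<noteq> j" for i j
    unfolding A_def by (rule disjoint_family_onD[OF disjoint_family_disjointed UNIV_I UNIV_I that])
  have cover: "?B \<subseteq> (\<Union>i<n. A i)"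
  proof -
    have "(\<Union>x\<in>C. ball x d) = (\<Union>i<n. ball (cs ! i) d)"
      unfolding cs[symmetric] set_conv_nth n_def by auto
    also have "\<dots> = (\<Union>i<n. A i)"
      unfolding A_def using finite_UN_disjointed_eq[of "\<lambda>i. ball (cs ! i) d" n] by (simp add: atLeast0LessThan)
    finally show ?thesis using C(2) by simp
  qed
  define w where "w i = measure lborel (?B \<inter> A i)" for i
  have fin: "emeasure lborel (?B \<inter> A i) < \<infinity>" for i
    by (rule le_less_trans[OF emeasure_mono emeasure_lborel_cball_finite[of 0 1]]) auto
  show ?thesis
  proof
    fix v :: 'a
    define g where "g x = (\<Sum>i<n. \<bar>v \<bullet> (cs ! i)\<bar> * indicator (?B \<inter> A i) x)" for x
    have int_g: "integrable lborel g" unfolding g_def using fin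
      by (intro Bochner_Integration.integrable_sum integrable_mult_right integrable_real_indicator) auto
    have int_f: "integrable lborel (\<lambda>x. indicator ?B x * \<bar>v \<bullet> x\<bar>)"
      by (intro integrable_cball_continuous continuous_intros)
    have "(\<Sum>u\<leftarrow>map (\<lambda>i. w i *\<^sub>R (cs ! i)) [0..<n]. \<bar>v \<bullet> u\<bar>) = (\<Sum>i<n. \<bar>v \<bullet> (cs ! i)\<bar> * w i)"
      unfolding map_map comp_def interv_sum_list_conv_sum_set_nat set_upt atLeast0LessThan
      by (intro sum.cong refl) (simp add: abs_mult w_def)
    also have "\<dots> = (\<integral>x. g x \<partial>lborel)"
      unfolding g_def w_def using fin
      by (subst Bochner_Integration.integral_sum) (auto intro!: integrable_mult_right integrable_real_indicator)
    finally have eq: "(\<Sum>u\<leftarrow>map (\<lambda>i. w i *\<^sub>R (cs ! i)) [0..<n]. \<bar>v \<bullet> u\<bar>) - ball_abs_moment v =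
        (\<integral>x. g x - indicator ?B x * \<bar>v \<bullet> x\<bar> \<partial>lborel)"
      unfolding ball_abs_moment_def using int_g int_f by simp
    have pw: "\<bar>g x - indicator ?B x * \<bar>v \<bullet> x\<bar>\<bar> \<le> d * norm v * indicator ?B x" for x
    proof (cases "x \<in> ?B")
      case True
      then obtain i where i: "i < n" "x \<in> A i" using cover by auto
      have "g x = (\<Sum>j<n. if j = i then \<bar>v \<bullet> (cs ! j)\<bar> else 0)"
        unfolding g_def using True i disj by (intro sum.cong refl) (auto simp: indicator_def)
      then have g: "g x = \<bar>v \<bullet> (cs ! i)\<bar>" using i by simp
      have "\<bar>\<bar>v \<bullet> (cs ! i)\<bar> - \<bar>v \<bullet> x\<bar>\<bar> \<le> \<bar>v \<bullet> (cs ! i - x)\<bar>"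
        by (simp add: inner_diff_right)
      also have "\<dots> \<le> norm v * norm (cs ! i - x)" by (rule Cauchy_Schwarz_ineq2)
      also have "\<dots> \<le> norm v * d"
        using Asub[of i] i by (intro mult_left_mono) (auto simp: dist_norm)
      finally show ?thesis using True by (simp add: g mult.commute)
    next
      case False
      then show ?thesis by (simp add: g_def)
    qed
    have "\<bar>\<integral>x. g x - indicator ?B x * \<bar>v \<bullet> x\<bar> \<partial>lborel\<bar> \<le> (\<integral>x. \<bar>g x - indicator ?B x * \<bar>v \<bullet> x\<bar>\<bar> \<partial>lborel)"
      by (rule integral_abs_bound)
    also have "\<dots> \<le> (\<integral>x. d * norm v * indicator ?B x \<partial>lborel)"
      using int_g int_f pw
      by (intro integral_mono integrable_mult_right integrable_real_indicator)
         (simp_all add: emeasure_lborel_cball_finite[unfolded infinity_ennreal_def])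
    also have "\<dots> = \<delta> * norm v" using \<kappa> by (simp add: \<kappa>_def[symmetric] d_def)
    finally show "\<bar>(\<Sum>u\<leftarrow>map (\<lambda>i. w i *\<^sub>R (cs ! i)) [0..<n]. \<bar>v \<bullet> u\<bar>) - ball_abs_moment v\<bar> \<le> \<delta> * norm v"
      unfolding eq .
  qed
qed

lemma zonotope_approximates_ball:
  fixes \<epsilon> :: real
  assumes "\<epsilon> > 0"
  obtains us :: "'a::euclidean_space list"
  where "cball 0 1 \<subseteq> zonotope us" "zonotope us \<subseteq> cball 0 (1 + \<epsilon>)"
proof -
  obtain a where a: "a > 0" "\<And>v :: 'a. ball_abs_moment v = a * norm v"
    using ball_abs_moment_norm by metis
  \<comment> \<open>chosen such that (a + \<delta>) / (a - \<delta>) = 1 + \<epsilon>\<close>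
  define \<delta> where "\<delta> = a * \<epsilon> / (2 + \<epsilon>)"
  have \<delta>: "\<delta> > 0" "a - \<delta> > 0" "a + \<delta> = (1 + \<epsilon>) * (a - \<delta>)"
    using a assms by (auto simp: \<delta>_def field_simps)
  obtain us :: "'a list" where us: "\<And>v. \<bar>(\<Sum>u\<leftarrow>us. \<bar>v \<bullet> u\<bar>) - ball_abs_moment v\<bar> \<le> \<delta> * norm v"
    using ball_abs_moment_discretise[OF \<delta>(1)] by metis
  have bounds: "(a - \<delta>) * norm v \<le> (\<Sum>u\<leftarrow>us. \<bar>v \<bullet> u\<bar>)" "(\<Sum>u\<leftarrow>us. \<bar>v \<bullet> u\<bar>) \<le> (a + \<delta>) * norm v" for v
    using us[of v] by (auto simp: a(2) algebra_simps abs_le_iff)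
  let ?us = "map (\<lambda>u. u /\<^sub>R (a - \<delta>)) us"
  have scale: "(\<Sum>u\<leftarrow>?us. \<bar>v \<bullet> u\<bar>) = (\<Sum>u\<leftarrow>us. \<bar>v \<bullet> u\<bar>) / (a - \<delta>)" for v
    using \<delta>(2) by (induction us) (simp_all add: abs_mult divide_inverse_commute distrib_left)
  show ?thesis
  proof
    have "1 * norm v \<le> (\<Sum>u\<leftarrow>?us. \<bar>v \<bullet> u\<bar>)" for v
      unfolding scale using bounds(1)[of v] \<delta>(2) by (simp add: field_simps)
    then show "cball 0 1 \<subseteq> zonotope ?us" by (rule cball_subset_zonotope)
    have "(\<Sum>u\<leftarrow>?us. \<bar>v \<bullet> u\<bar>) \<le> (1 + \<epsilon>) * norm v" for v
      unfolding scale using bounds(2)[of v, unfolded \<delta>(3)] \<delta>(2) by (simp add: pos_divide_le_eq ac_simps)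
    then show "zonotope ?us \<subseteq> cball 0 (1 + \<epsilon>)" by (rule zonotope_subset_cball)
  qed
qed

section \<open>Orthogonal projections and outer Minkowski content\<close>

lemma closest_point_subspace_mem: "subspace V \<Longrightarrow> closest_point V x \<in> (V :: 'a::euclidean_space set)"
  using closest_point_in_set[OF closed_subspace] subspace_0 by blast

lemma closest_point_subspace_inner:
  fixes V :: "'a::euclidean_space set"
  assumes V: "subspace V" and v: "v \<in> V"
  shows "(x - closest_point V x) \<bullet> v = 0"
proof -
  let ?p = "closest_point V x"
  have p: "?p \<in> V" by (rule closest_point_subspace_mem[OF V])
  have dot: "(x - ?p) \<bullet> (y - ?p) \<le> 0" if "y \<in> V" for y
    using V that by (intro closest_point_dot subspace_imp_convex closed_subspace)
  show ?thesis
    using dot[OF subspace_add[OF V p v]] dot[OF subspace_diff[OF V p v]] by simp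
qed

lemma closest_point_subspace_unique:
  fixes V :: "'a::euclidean_space set"
  assumes V: "subspace V" and p: "p \<in> V" "\<And>v. v \<in> V \<Longrightarrow> (x - p) \<bullet> v = 0"
  shows "closest_point V x = p"
proof -
  let ?d = "closest_point V x - p"
  have d: "?d \<in> V" using V p closest_point_subspace_mem[OF V] by (intro subspace_diff) auto
  have "?d \<bullet> ?d = (x - p) \<bullet> ?d - (x - closest_point V x) \<bullet> ?d" by (simp add: inner_diff_left)
  also have "\<dots> = 0" using p(2)[OF d] closest_point_subspace_inner[OF V d] by simp
  finally show ?thesis by simp
qed

lemma linear_closest_point:
  fixes V :: "'a::euclidean_space set"
  assumes V: "subspace V"
  shows "linear (closest_point V)"
proof (rule linearI)
  note mem = closest_point_subspace_mem[OF V] and orth = closest_point_subspace_inner[OF V]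
  show "closest_point V (x + y) = closest_point V x + closest_point V y" for x y
    using orth[of _ x] orth[of _ y]
    by (intro closest_point_subspace_unique V subspace_add mem) (auto simp: inner_diff_left inner_add_left)
  show "closest_point V (c *\<^sub>R x) = c *\<^sub>R closest_point V x" for c x
    using orth[of _ x]
    by (intro closest_point_subspace_unique V subspace_scale mem) (auto simp: inner_diff_left)
qed

lemma closest_point_orthogonal_comp:
  fixes V :: "'a::euclidean_space set"
  assumes V: "subspace V"
  shows "closest_point (V\<^sup>\<bottom>) x = x - closest_point V x"
  using closest_point_subspace_inner[OF V, of _ x] closest_point_subspace_mem[OF V, of x]
  by (intro closest_point_subspace_unique subspace_orthogonal_comp)
     (auto simp: orthogonal_comp_def orthogonal_def inner_commute)

lemma norm_closest_point_subspace_le: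
  fixes V :: "'a::euclidean_space set"
  assumes V: "subspace V"
  shows "norm (closest_point V x) \<le> norm x"
proof -
  let ?p = "closest_point V x"
  have "?p \<bullet> ?p = x \<bullet> ?p"
    using closest_point_subspace_inner[OF V closest_point_subspace_mem[OF V], of x x] by (simp add: inner_diff_left)
  also have "\<dots> \<le> norm x * norm ?p" by (rule norm_cauchy_schwarz)
  finally have "norm ?p * norm ?p \<le> norm x * norm ?p" by (simp add: dot_square_norm power2_eq_square)
  then show ?thesis by (cases "?p = 0") auto
qed

definition ball_zonotope :: "'a::euclidean_space set \<Rightarrow> real \<Rightarrow> 'a list \<Rightarrow> bool" where
  "ball_zonotope V \<epsilon> us \<longleftrightarrow> set us \<subseteq> V \<and> V \<inter> cball 0 1 \<subseteq> zonotope us \<and> zonotope us \<subseteq> V \<inter> cball 0 (1 + \<epsilon>)"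

definition outer_quotient :: "'a::euclidean_space set \<Rightarrow> 'a measure \<Rightarrow> 'a set \<Rightarrow> real \<Rightarrow> real" where
  "outer_quotient V \<nu> K \<rho> = (measure \<nu> (K + (V \<inter> cball 0 \<rho>)) - measure \<nu> K) / \<rho>"

lemma ball_zonotope_exists:
  fixes V :: "'a::euclidean_space set"
  assumes V: "subspace V" and "\<epsilon> > 0"
  obtains us where "ball_zonotope V \<epsilon> us"
proof -
  obtain us :: "'a list" where us: "cball 0 1 \<subseteq> zonotope us" "zonotope us \<subseteq> cball 0 (1 + \<epsilon>)"
    by (rule zonotope_approximates_ball[OF assms(2)])
  let ?P = "closest_point V"
  have Z: "zonotope (map ?P us) = ?P ` zonotope us"
    by (rule zonotope_linear_image[OF linear_closest_point[OF V]])
  have "V \<inter> cball 0 1 \<subseteq> ?P ` zonotope us"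
  proof
    fix x assume x: "x \<in> V \<inter> cball 0 1"
    then have "?P x = x" by (intro closest_point_self) simp
    moreover have "x \<in> zonotope us" using us(1) x by blast
    ultimately show "x \<in> ?P ` zonotope us" by (metis imageI)
  qed
  moreover have "?P ` zonotope us \<subseteq> V \<inter> cball 0 (1 + \<epsilon>)"
    using us(2) closest_point_subspace_mem[OF V] order_trans[OF norm_closest_point_subspace_le[OF V]]
    by fastforce
  ultimately have "ball_zonotope V \<epsilon> (map ?P us)"
    using closest_point_subspace_mem[OF V] by (auto simp: ball_zonotope_def Z)
  then show ?thesis by (rule that)
qed

context
  fixes V :: "'a::euclidean_space set" and \<nu> :: "'a measure"
  assumes V: "subspace V" and \<nu>: "haar_on V \<nu>"
begin

lemma sweep_tendsto:
  assumes K: "compact K" and F: "\<And>\<rho>. \<rho> > 0 \<Longrightarrow> compact (F \<rho>)"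
    "\<And>\<rho>. \<rho> > 0 \<Longrightarrow> K \<subseteq> F \<rho> \<and> F \<rho> \<subseteq> K + cball 0 (c * \<rho>)"
  shows "((\<lambda>\<rho>. sweep \<nu> (F \<rho>) u) \<longlongrightarrow> sweep \<nu> K u) (at_right 0)"
  unfolding sweep_def
proof (intro tendsto_diff haar_shrinking_tendsto[OF \<nu>, where c=c])
  fix \<rho> :: real assume \<rho>: "\<rho> > 0"
  show "K \<subseteq> F \<rho> \<and> F \<rho> \<subseteq> K + cball 0 (c * \<rho>)" by (rule F(2)[OF \<rho>])
  have "F \<rho> + closed_segment 0 u \<subseteq> (K + cball 0 (c * \<rho>)) + closed_segment 0 u"
    using F(2)[OF \<rho>] by (intro set_plus_mono2) auto
  then show "K + closed_segment 0 u \<subseteq> F \<rho> + closed_segment 0 u \<and>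
      F \<rho> + closed_segment 0 u \<subseteq> K + closed_segment 0 u + cball 0 (c * \<rho>)"
    using F(2)[OF \<rho>] set_plus_mono2[of K "F \<rho>" "closed_segment 0 u" "closed_segment 0 u"]
    by (simp add: ac_simps)
qed (auto intro!: compact_set_plus K F)

text \<open>
  Adding the segments one after the other, the last one contributes \<open>2 \<rho> W (F \<rho>, u)\<close>, where \<open>F \<rho>\<close>
  is the body expanded by the previous segments. As \<open>F \<rho>\<close> shrinks to \<open>K\<close>, the factor \<open>W (F \<rho>, u)\<close>
  converges to \<open>W (K, u)\<close>.
\<close>

lemma zonotope_expansion_derivative:
  assumes K: "compact K" "convex K" and us: "set us \<subseteq> V"
  shows "((\<lambda>\<rho>. (measure \<nu> (K + zonotope (map ((*\<^sub>R) \<rho>) us)) - measure \<nu> K) / \<rho>)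
    \<longlongrightarrow> 2 * (\<Sum>u\<leftarrow>us. sweep \<nu> K u)) (at_right 0)"
  using us
proof (induction us)
  case Nil
  have "K + {0} = K" by (auto simp: set_plus_def)
  then show ?case by simp
next
  case (Cons u us)
  define F where "F \<rho> = K + zonotope (map ((*\<^sub>R) \<rho>) us)" for \<rho>
  have F: "compact (F \<rho>)" "convex (F \<rho>)" for \<rho>
    unfolding F_def using K by (auto intro!: compact_set_plus convex_set_plus compact_zonotope convex_zonotope)
  obtain c where c: "zonotope us \<subseteq> cball 0 c"
    using compact_imp_bounded[OF compact_zonotope] bounded_iff by (metis mem_cball_0 subsetI)
  have Fb: "K \<subseteq> F \<rho> \<and> F \<rho> \<subseteq> K + cball 0 (c * \<rho>)" if "\<rho> > 0" for \<rho>
  proof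
    show "K \<subseteq> F \<rho>" unfolding F_def using set_zero_plus2[OF zero_in_zonotope, of K] by (simp add: add.commute)
    have "zonotope (map ((*\<^sub>R) \<rho>) us) = (*\<^sub>R) \<rho> ` zonotope us"
      by (rule zonotope_linear_image) (rule linear_scale_self)
    also have "\<dots> \<subseteq> cball 0 (c * \<rho>)" using c that by (auto simp: mult.commute)
    finally show "F \<rho> \<subseteq> K + cball 0 (c * \<rho>)" unfolding F_def by (intro set_plus_mono2) auto
  qed
  have "((\<lambda>\<rho>. (measure \<nu> (F \<rho>) - measure \<nu> K) / \<rho> + 2 * sweep \<nu> (F \<rho>) u)
      \<longlongrightarrow> 2 * (\<Sum>u\<leftarrow>us. sweep \<nu> K u) + 2 * sweep \<nu> K u) (at_right 0)"
    using Cons F Fb unfolding F_def[symmetric]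
    by (intro tendsto_add tendsto_mult_left sweep_tendsto[where c=c] K) auto
  then show ?case
  proof (rule filterlim_cong[THEN iffD1, rotated -1])
    show "\<forall>\<^sub>F \<rho> in at_right 0. (measure \<nu> (F \<rho>) - measure \<nu> K) / \<rho> + 2 * sweep \<nu> (F \<rho>) u =
      (measure \<nu> (K + zonotope (map ((*\<^sub>R) \<rho>) (u # us))) - measure \<nu> K) / \<rho>"
      using eventually_at_right_less[of "0::real"]
    proof eventually_elim
      fix \<rho> :: real assume \<rho>: "0 < \<rho>"
      have u: "u \<in> V" "\<rho> *\<^sub>R u \<in> V" using Cons.prems V by (auto intro: subspace_scale)
      have "K + zonotope (map ((*\<^sub>R) \<rho>) (u # us)) = F \<rho> + closed_segment (- (\<rho> *\<^sub>R u)) (\<rho> *\<^sub>R u)"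
        by (simp add: F_def ac_simps)
      also have "measure \<nu> \<dots> = measure \<nu> (F \<rho>) + 2 * (\<rho> * sweep \<nu> (F \<rho>) u)"
        using measure_plus_symmetric_segment[OF \<nu> V F u(2)] sweep_scaleR[OF \<nu> V F u(1)] \<rho> by simp
      finally show "(measure \<nu> (F \<rho>) - measure \<nu> K) / \<rho> + 2 * sweep \<nu> (F \<rho>) u =
          (measure \<nu> (K + zonotope (map ((*\<^sub>R) \<rho>) (u # us))) - measure \<nu> K) / \<rho>"
        using \<rho> by (simp add: field_simps)
    qed
  qed (auto simp: algebra_simps)
qed

text \<open>
  From \<open>B \<subseteq> Z \<subseteq> (1 + \<epsilon>) B\<close> the difference quotient for the ball at \<open>\<rho>\<close> is at most the one for \<open>Z\<close> at \<open>\<rho>\<close>,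
  and at least \<open>1 / (1 + \<epsilon>)\<close> times the one for \<open>Z\<close> at \<open>\<rho> / (1 + \<epsilon>)\<close>.
\<close>

lemma outer_quotient_bounds:
  assumes K: "compact K" "convex K" and us: "ball_zonotope V \<epsilon> us" and "\<epsilon> > 0" "\<delta> > 0"
  shows "\<forall>\<^sub>F \<rho> in at_right 0. outer_quotient V \<nu> K \<rho> \<le> 2 * (\<Sum>u\<leftarrow>us. sweep \<nu> K u) + \<delta>" (is ?U)
    and "\<forall>\<^sub>F \<rho> in at_right 0. 2 * (\<Sum>u\<leftarrow>us. sweep \<nu> K u) / (1 + \<epsilon>) - \<delta> \<le> outer_quotient V \<nu> K \<rho>" (is ?L)
proof -
  define q where "q \<rho> = (measure \<nu> (K + zonotope (map ((*\<^sub>R) \<rho>) us)) - measure \<nu> K) / \<rho>" for \<rho>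
  define \<sigma> where "\<sigma> = 2 * (\<Sum>u\<leftarrow>us. sweep \<nu> K u)"
  have q: "(q \<longlongrightarrow> \<sigma>) (at_right 0)"
    unfolding q_def \<sigma>_def using us K by (intro zonotope_expansion_derivative) (auto simp: ball_zonotope_def)
  have ballV: "(*\<^sub>R) \<rho> ` (V \<inter> cball 0 r) = V \<inter> cball 0 (\<rho> * r)" if "\<rho> > 0" for \<rho> r
  proof
    show "(*\<^sub>R) \<rho> ` (V \<inter> cball 0 r) \<subseteq> V \<inter> cball 0 (\<rho> * r)"
      using that V by (auto intro: subspace_scale)
    show "V \<inter> cball 0 (\<rho> * r) \<subseteq> (*\<^sub>R) \<rho> ` (V \<inter> cball 0 r)"
    proof
      fix x assume "x \<in> V \<inter> cball 0 (\<rho> * r)"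
      then have "x /\<^sub>R \<rho> \<in> V \<inter> cball 0 r" "x = \<rho> *\<^sub>R (x /\<^sub>R \<rho>)"
        using that V by (auto intro: subspace_scale simp: divide_le_eq mult.commute field_simps)
      then show "x \<in> (*\<^sub>R) \<rho> ` (V \<inter> cball 0 r)" by blast
    qed
  qed
  have Z: "V \<inter> cball 0 \<rho> \<subseteq> zonotope (map ((*\<^sub>R) \<rho>) us)"
    "zonotope (map ((*\<^sub>R) \<rho>) us) \<subseteq> V \<inter> cball 0 (\<rho> * (1 + \<epsilon>))" if "\<rho> > 0" for \<rho>
  proof -
    have Z: "zonotope (map ((*\<^sub>R) \<rho>) us) = (*\<^sub>R) \<rho> ` zonotope us"
      by (rule zonotope_linear_image) (rule linear_scale_self)
    have "(*\<^sub>R) \<rho> ` (V \<inter> cball 0 1) \<subseteq> (*\<^sub>R) \<rho> ` zonotope us"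
      using us by (intro image_mono) (auto simp: ball_zonotope_def)
    then show "V \<inter> cball 0 \<rho> \<subseteq> zonotope (map ((*\<^sub>R) \<rho>) us)" using that by (simp add: ballV Z)
    have "(*\<^sub>R) \<rho> ` zonotope us \<subseteq> (*\<^sub>R) \<rho> ` (V \<inter> cball 0 (1 + \<epsilon>))"
      using us by (intro image_mono) (auto simp: ball_zonotope_def)
    then show "zonotope (map ((*\<^sub>R) \<rho>) us) \<subseteq> V \<inter> cball 0 (\<rho> * (1 + \<epsilon>))" using that by (simp add: ballV Z)
  qed
  have cVb: "compact (V \<inter> cball 0 r)" for r
    using closed_Int_compact[OF closed_subspace[OF V] compact_cball] by simp
  have le1: "outer_quotient V \<nu> K \<rho> \<le> q \<rho>" if "\<rho> > 0" for \<rho>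
    unfolding outer_quotient_def q_def using that Z K
    by (intro divide_right_mono diff_right_mono haar_measure_mono[OF \<nu>] compact_set_plus set_plus_mono2
        cVb compact_zonotope) auto
  have le2: "q (\<rho> / (1 + \<epsilon>)) / (1 + \<epsilon>) \<le> outer_quotient V \<nu> K \<rho>" if "\<rho> > 0" for \<rho>
  proof -
    have p: "\<rho> / (1 + \<epsilon>) > 0" using that assms by simp
    have "measure \<nu> (K + zonotope (map ((*\<^sub>R) (\<rho> / (1 + \<epsilon>))) us)) \<le> measure \<nu> (K + (V \<inter> cball 0 \<rho>))"
      using Z(2)[OF p] assms K
      by (intro haar_measure_mono[OF \<nu>] compact_set_plus set_plus_mono2 cVb compact_zonotope) auto
    then have "(measure \<nu> (K + zonotope (map ((*\<^sub>R) (\<rho> / (1 + \<epsilon>))) us)) - measure \<nu> K) / \<rho> \<le> outer_quotient V \<nu> K \<rho>"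
      unfolding outer_quotient_def using that by (intro divide_right_mono) auto
    then show ?thesis using assms that by (simp add: q_def)
  qed
  have "\<forall>\<^sub>F \<rho> in at_right 0. q \<rho> < \<sigma> + \<delta>" using order_tendstoD(2)[OF q] assms by simp
  then show ?U
    unfolding \<sigma>_def[symmetric] using eventually_at_right_less[of "0::real"]
  proof eventually_elim
    case (elim \<rho>) then show ?case using le1[of \<rho>] by linarith
  qed
  have "filterlim (\<lambda>\<rho>. inverse (1 + \<epsilon>) * \<rho>) (at_right 0) (at_right 0)"
    using assms by (intro filterlim_times_pos[OF filterlim_ident]) auto
  from filterlim_compose[OF q this]
  have "((\<lambda>\<rho>. q (\<rho> / (1 + \<epsilon>)) / (1 + \<epsilon>)) \<longlongrightarrow> \<sigma> / (1 + \<epsilon>)) (at_right 0)"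
    using assms by (intro tendsto_divide tendsto_const) (auto simp: field_simps)
  then have "\<forall>\<^sub>F \<rho> in at_right 0. \<sigma> / (1 + \<epsilon>) - \<delta> < q (\<rho> / (1 + \<epsilon>)) / (1 + \<epsilon>)"
    using assms by (intro order_tendstoD(1)) auto
  then show ?L
    unfolding \<sigma>_def[symmetric] using eventually_at_right_less[of "0::real"]
  proof eventually_elim
    case (elim \<rho>) then show ?case using le2[of \<rho>] by linarith
  qed
qed

text \<open>
  The upper bounds from all zonotopes dominate all lower bounds, and the gap for a single zonotope is
  at most \<open>\<epsilon>\<close> times a constant. The infimum of the upper bounds is therefore the limit. This yields
  the derivative of the volume of the parallel body without Steiner's formula.
\<close>

lemma outer_quotient_tendsto:
  assumes K: "compact K" "convex K"
  obtains S where "(outer_quotient V \<nu> K \<longlongrightarrow> S) (at_right 0)"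
    and "\<And>us \<epsilon>. ball_zonotope V \<epsilon> us \<Longrightarrow> \<epsilon> > 0 \<Longrightarrow> S \<le> 2 * (\<Sum>u\<leftarrow>us. sweep \<nu> K u)"
    and "\<And>us \<epsilon>. ball_zonotope V \<epsilon> us \<Longrightarrow> \<epsilon> > 0 \<Longrightarrow> 2 * (\<Sum>u\<leftarrow>us. sweep \<nu> K u) \<le> (1 + \<epsilon>) * S"
proof -
  define \<sigma> where "\<sigma> us = 2 * (\<Sum>u\<leftarrow>us. sweep \<nu> K u)" for us
  define X where "X = {\<sigma> us | us \<epsilon>. ball_zonotope V \<epsilon> us \<and> \<epsilon> > 0}"
  have cross: "\<sigma> us / (1 + \<epsilon>) \<le> \<sigma> us'"
    if "ball_zonotope V \<epsilon> us" "\<epsilon> > 0" "ball_zonotope V \<epsilon>' us'" "\<epsilon>' > 0" for us us' \<epsilon> \<epsilon>'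
  proof (rule field_le_epsilon)
    fix e :: real assume e: "e > 0"
    then have e2: "e / 2 > 0" by simp
    have "\<forall>\<^sub>F \<rho> in at_right (0::real). \<sigma> us / (1 + \<epsilon>) - e / 2 \<le> \<sigma> us' + e / 2"
      using outer_quotient_bounds(1)[OF K that(3,4) e2] outer_quotient_bounds(2)[OF K that(1,2) e2]
      unfolding \<sigma>_def[symmetric] by eventually_elim linarith
    then have "\<sigma> us / (1 + \<epsilon>) - e / 2 \<le> \<sigma> us' + e / 2" by simp
    then show "\<sigma> us / (1 + \<epsilon>) \<le> \<sigma> us' + e" by simp
  qed
  obtain us0 where us0: "ball_zonotope V 1 us0" using ball_zonotope_exists[OF V, of 1] by auto
  have ne: "X \<noteq> {}" using us0 unfolding X_def by (auto intro!: exI[of _ us0] exI[of _ 1])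
  have bdd: "bdd_below X"
    unfolding X_def using cross[OF us0 zero_less_one] by (intro bdd_belowI[of _ "\<sigma> us0 / 2"]) auto
  define S where "S = Inf X"
  have S1: "S \<le> \<sigma> us" if "ball_zonotope V \<epsilon> us" "\<epsilon> > 0" for us \<epsilon>
    unfolding S_def using that by (intro cInf_lower bdd) (auto simp: X_def)
  have S2: "\<sigma> us / (1 + \<epsilon>) \<le> S" if "ball_zonotope V \<epsilon> us" "\<epsilon> > 0" for us \<epsilon>
    unfolding S_def using cross[OF that] by (intro cInf_greatest ne) (auto simp: X_def)
  have "(outer_quotient V \<nu> K \<longlongrightarrow> S) (at_right 0)"
  proof (rule tendstoI)
    fix e :: real assume e: "e > 0"
    define \<epsilon> where "\<epsilon> = e / (4 * (\<bar>\<sigma> us0\<bar> + 1))"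
    have \<epsilon>: "\<epsilon> > 0" using e by (simp add: \<epsilon>_def)
    have \<epsilon>e: "\<epsilon> * \<bar>\<sigma> us0\<bar> \<le> e / 4"
    proof -
      have "\<epsilon> * \<bar>\<sigma> us0\<bar> \<le> \<epsilon> * (\<bar>\<sigma> us0\<bar> + 1)" using \<epsilon> by (intro mult_left_mono) auto
      also have "\<dots> = e / 4" by (simp add: \<epsilon>_def field_simps)
      finally show ?thesis .
    qed
    obtain us where us: "ball_zonotope V \<epsilon> us" using ball_zonotope_exists[OF V \<epsilon>] .
    have "\<sigma> us - \<sigma> us / (1 + \<epsilon>) = \<epsilon> * (\<sigma> us / (1 + \<epsilon>))" using \<epsilon> by (simp add: field_simps)
    also have "\<dots> \<le> \<epsilon> * \<bar>\<sigma> us0\<bar>"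
      using \<epsilon> cross[OF us \<epsilon> us0] by (intro mult_left_mono) auto
    finally have gap: "\<sigma> us - \<sigma> us / (1 + \<epsilon>) \<le> e / 4" using \<epsilon>e by linarith
    have e4: "e / 4 > 0" using e by simp
    show "\<forall>\<^sub>F \<rho> in at_right 0. dist (outer_quotient V \<nu> K \<rho>) S < e"
      using outer_quotient_bounds[OF K us \<epsilon> e4] unfolding \<sigma>_def[symmetric]
    proof eventually_elim
      case (elim \<rho>)
      then show ?case using gap S1[OF us \<epsilon>] S2[OF us \<epsilon>] e unfolding dist_real_def by linarith
    qed
  qed
  then show ?thesis
  proof (rule that)
    show "S \<le> 2 * (\<Sum>u\<leftarrow>us. sweep \<nu> K u)" if "ball_zonotope V \<epsilon> us" "\<epsilon> > 0" for us \<epsilon>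
      using S1[OF that] by (simp add: \<sigma>_def)
    show "2 * (\<Sum>u\<leftarrow>us. sweep \<nu> K u) \<le> (1 + \<epsilon>) * S" if "ball_zonotope V \<epsilon> us" "\<epsilon> > 0" for us \<epsilon>
      using S2[OF that] that(2) by (simp add: \<sigma>_def field_simps)
  qed
qed

end

section \<open>Surface area, and the test case of the ball\<close>

lemma infdist_le_iff_set_plus:
  fixes V K :: "'a::euclidean_space set"
  assumes V: "subspace V" and K: "compact K" "K \<noteq> {}" "K \<subseteq> V"
  shows "{x \<in> V. infdist x K \<le> \<rho>} = K + (V \<inter> cball 0 \<rho>)"
proof
  show "{x \<in> V. infdist x K \<le> \<rho>} \<subseteq> K + (V \<inter> cball 0 \<rho>)"
  proof
    fix x assume x: "x \<in> {x \<in> V. infdist x K \<le> \<rho>}"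
    obtain y where y: "y \<in> K" "infdist x K = dist x y"
      using infdist_attains_inf[OF compact_imp_closed[OF K(1)] K(2)] by blast
    have "y + (x - y) \<in> K + (V \<inter> cball 0 \<rho>)"
      using x y K V by (intro set_plus_intro) (auto intro: subspace_diff simp: dist_norm norm_minus_commute)
    then show "x \<in> K + (V \<inter> cball 0 \<rho>)" by simp
  qed
  show "K + (V \<inter> cball 0 \<rho>) \<subseteq> {x \<in> V. infdist x K \<le> \<rho>}"
  proof
    fix x assume "x \<in> K + (V \<inter> cball 0 \<rho>)"
    then obtain y z where yz: "x = y + z" "y \<in> K" "z \<in> V" "norm z \<le> \<rho>" by (auto simp: set_plus_def)
    then have "infdist x K \<le> norm z" using infdist_le[OF yz(2), of x] by (simp add: dist_norm)
    then show "x \<in> {x \<in> V. infdist x K \<le> \<rho>}" using yz K V by (auto intro: subspace_add)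
  qed
qed

text \<open>
  For the full sphere of directions there is no restriction on the foot points: the outer normal of a
  point of \<open>V\<close> at its nearest point of \<open>K\<close> always lies in \<open>V\<close>.
\<close>

lemma local_parallel_set_eq:
  fixes V K :: "(real ^ 'n) set"
  assumes V: "subspace V" and K: "compact K" "K \<noteq> {}" "K \<subseteq> V"
  shows "local_parallel_set V K (V \<inter> sphere 0 1) \<rho> = (K + (V \<inter> cball 0 \<rho>)) - K"
proof -
  have "(x - closest_point K x) /\<^sub>R infdist x K \<in> V \<inter> sphere 0 1" if "x \<in> V" "0 < infdist x K" for x
  proof -
    have cp: "closest_point K x \<in> K" using K compact_imp_closed closest_point_in_set by blast
    have "infdist x K = dist x (closest_point K x)"
    proof (rule antisym)
      show "infdist x K \<le> dist x (closest_point K x)" by (rule infdist_le[OF cp])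
      obtain y where "y \<in> K" "infdist x K = dist x y"
        using infdist_attains_inf[OF compact_imp_closed[OF K(1)] K(2)] by blast
      then show "dist x (closest_point K x) \<le> infdist x K"
        using closest_point_le[OF compact_imp_closed[OF K(1)]] by metis
    qed
    then show ?thesis
      using that cp K V by (auto intro!: subspace_scale subspace_diff simp: dist_norm)
  qed
  moreover have "0 < infdist x K \<longleftrightarrow> x \<notin> K" for x
    using in_closed_iff_infdist_zero[OF compact_imp_closed[OF K(1)] K(2), of x] infdist_nonneg[of x K]
    by (auto simp: less_le)
  ultimately show ?thesis
    unfolding local_parallel_set_def infdist_le_iff_set_plus[OF assms, symmetric] by auto
qed

lemma surface_area_eqI:
  fixes V K :: "(real ^ 'n) set"
  assumes V: "subspace V" and K: "compact K" "K \<noteq> {}" "K \<subseteq> V"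
    and lim: "(outer_quotient V (subspace_lborel V) K \<longlongrightarrow> S) (at_right 0)"
  shows "surface_area V K = ennreal S"
proof -
  let ?\<nu> = "subspace_lborel V"
  note \<nu> = haar_on_subspace_lborel[OF V]
  have cV: "compact (V \<inter> cball 0 r)" for r
    using closed_Int_compact[OF closed_subspace[OF V] compact_cball] by simp
  have "((\<lambda>\<rho>. emeasure ?\<nu> (local_parallel_set V K (V \<inter> sphere 0 1) \<rho>) / ennreal \<rho>) \<longlongrightarrow> ennreal S) (at_right 0)"
  proof (rule filterlim_cong[THEN iffD1, OF refl refl _ tendsto_ennrealI[OF lim]])
    show "\<forall>\<^sub>F \<rho> in at_right 0. ennreal (outer_quotient V ?\<nu> K \<rho>) =
        emeasure ?\<nu> (local_parallel_set V K (V \<inter> sphere 0 1) \<rho>) / ennreal \<rho>"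
      using eventually_at_right_less[of "0::real"]
    proof eventually_elim
      fix \<rho> :: real assume \<rho>: "0 < \<rho>"
      let ?A = "K + (V \<inter> cball 0 \<rho>)"
      have A: "compact ?A" by (intro compact_set_plus K cV)
      have sub: "K \<subseteq> ?A"
        using set_zero_plus2[of "V \<inter> cball 0 \<rho>" K] \<rho> subspace_0[OF V] by (simp add: add.commute)
      have "emeasure ?\<nu> (?A - K) = ennreal (measure ?\<nu> (?A - K))"
        using haar_fmeasurable[OF \<nu>] A K
        by (intro emeasure_eq_measure2 fmeasurable_Diff)
           (auto simp: haar_on_sets[OF \<nu>] intro: borel_closed compact_imp_closed)
      also have "measure ?\<nu> (?A - K) = measure ?\<nu> ?A - measure ?\<nu> K"
        using haar_fmeasurable[OF \<nu>] A K sub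
        by (intro measurable_measure_Diff) (auto simp: haar_on_sets[OF \<nu>] intro: borel_closed compact_imp_closed)
      finally have "emeasure ?\<nu> (local_parallel_set V K (V \<inter> sphere 0 1) \<rho>) / ennreal \<rho> =
          ennreal (measure ?\<nu> ?A - measure ?\<nu> K) / ennreal \<rho>"
        by (simp add: local_parallel_set_eq[OF V K])
      also have "\<dots> = ennreal (outer_quotient V ?\<nu> K \<rho>)"
        unfolding outer_quotient_def using \<rho> haar_measure_mono[OF \<nu> K(1) A sub]
        by (intro divide_ennreal) auto
      finally show "ennreal (outer_quotient V ?\<nu> K \<rho>) =
        emeasure ?\<nu> (local_parallel_set V K (V \<inter> sphere 0 1) \<rho>) / ennreal \<rho>" by simp
    qed
  qed
  then show ?thesis
    unfolding surface_area_def surface_area_measure_def by (intro tendsto_Lim) auto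
qed

context
  fixes V :: "(real ^ 'n) set" and m :: nat
  assumes V: "subspace V" and m: "dim V = m"
begin

lemma measure_subspace_ball:
  assumes "r > 0"
  shows "measure (subspace_lborel V) (V \<inter> cball 0 r) = unit_ball_vol (real m) * r ^ m"
proof -
  note \<nu> = haar_on_subspace_lborel[OF V]
  have "measure (subspace_lborel V) (V \<inter> cball 0 r) = measure (subspace_lborel V) (cball 0 r)"
    using \<nu> closed_subspace[OF V] unfolding haar_on_def
    by (intro measure_eq_AE) (auto intro: borel_closed elim!: AE_mp)
  also have "\<dots> = unit_ball_vol (real m) * r ^ m"
    using assms by (simp add: measure_def emeasure_subspace_lborel_cball[OF V] m)
  finally show ?thesis .
qed

lemma outer_quotient_subspace_ball:
  "(outer_quotient V (subspace_lborel V) (V \<inter> cball 0 1) \<longlongrightarrow> real m * unit_ball_vol (real m)) (at_right 0)"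
proof -
  note \<nu> = haar_on_subspace_lborel[OF V]
  have sum: "(V \<inter> cball 0 1) + (V \<inter> cball 0 \<rho>) = V \<inter> cball 0 (1 + \<rho>)" if "\<rho> > 0" for \<rho>
  proof
    show "(V \<inter> cball 0 1) + (V \<inter> cball 0 \<rho>) \<subseteq> V \<inter> cball 0 (1 + \<rho>)"
      using V by (auto simp: set_plus_def intro: subspace_add norm_triangle_mono)
    show "V \<inter> cball 0 (1 + \<rho>) \<subseteq> (V \<inter> cball 0 1) + (V \<inter> cball 0 \<rho>)"
    proof
      fix x assume x: "x \<in> V \<inter> cball 0 (1 + \<rho>)"
      have "x = (1 / (1 + \<rho>)) *\<^sub>R x + (\<rho> / (1 + \<rho>)) *\<^sub>R x"
        using that by (simp add: add_divide_distrib[symmetric] flip: scaleR_left_distrib)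
      moreover have "(1 / (1 + \<rho>)) *\<^sub>R x \<in> V \<inter> cball 0 1" "(\<rho> / (1 + \<rho>)) *\<^sub>R x \<in> V \<inter> cball 0 \<rho>"
        using x that V mult_left_mono[of "norm x" "1 + \<rho>" \<rho>]
        by (auto intro: subspace_scale simp: field_simps)
      ultimately show "x \<in> (V \<inter> cball 0 1) + (V \<inter> cball 0 \<rho>)" by (metis set_plus_intro)
    qed
  qed
  have "((\<lambda>x. x ^ m) has_real_derivative real m * 1 ^ (m - 1)) (at 1)"
    by (auto intro!: derivative_eq_intros)
  then have "((\<lambda>h. ((1 + h) ^ m - 1 ^ m) / h) \<longlongrightarrow> real m * 1 ^ (m - 1)) (at 0)"
    by (simp only: DERIV_def)
  then have "((\<lambda>h. unit_ball_vol (real m) * (((1 + h) ^ m - 1 ^ m) / h)) \<longlongrightarrow>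
      unit_ball_vol (real m) * (real m * 1 ^ (m - 1))) (at_right 0)"
    by (intro tendsto_mult_left) (rule tendsto_within_subset, auto)
  then have lim: "((\<lambda>h. unit_ball_vol (real m) * (((1 + h) ^ m - 1 ^ m) / h)) \<longlongrightarrow>
      real m * unit_ball_vol (real m)) (at_right 0)" by (simp add: mult.commute)
  show ?thesis
  proof (rule filterlim_cong[THEN iffD1, OF refl refl _ lim])
    show "\<forall>\<^sub>F h in at_right 0. unit_ball_vol (real m) * (((1 + h) ^ m - 1 ^ m) / h) =
        outer_quotient V (subspace_lborel V) (V \<inter> cball 0 1) h"
      using eventually_at_right_less[of "0::real"]
    proof eventually_elim
      fix h :: real assume h: "0 < h"
      then show "unit_ball_vol (real m) * (((1 + h) ^ m - 1 ^ m) / h) =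
        outer_quotient V (subspace_lborel V) (V \<inter> cball 0 1) h"
        unfolding outer_quotient_def sum[OF h]
        using measure_subspace_ball[of "1 + h"] measure_subspace_ball[of 1] by (simp add: field_simps)
    qed
  qed
qed

lemma onb_insert:
  assumes e: "e \<in> V" "norm e = 1"
  obtains B where "pairwise orthogonal (insert e B)" "\<And>b. b \<in> insert e B \<Longrightarrow> norm b = 1"
    "span (insert e B) = V" "e \<notin> B" "card B = m - 1"
proof -
  let ?W = "{x \<in> V. e \<bullet> x = 0}"
  have W: "subspace ?W" using V by (auto simp: subspace_def inner_add_right)
  obtain B where B: "B \<subseteq> ?W" "pairwise orthogonal B" "\<forall>x\<in>B. norm x = 1" "span B = ?W"
    by (rule orthonormal_basis_subspace[OF W]) blast
  have ee: "e \<bullet> e = 1" using e(2) by (simp add: norm_eq_1)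
  have eB: "e \<notin> B" using B(1) ee by auto
  have orth: "pairwise orthogonal (insert e B)"
    using B(1,2) by (auto simp: pairwise_insert orthogonal_def inner_commute)
  have unit: "\<And>b. b \<in> insert e B \<Longrightarrow> norm b = 1" using B(3) e(2) by auto
  have span: "span (insert e B) = V"
  proof
    show "span (insert e B) \<subseteq> V" using B(1) e(1) by (intro span_minimal V) auto
    show "V \<subseteq> span (insert e B)"
    proof
      fix v assume v: "v \<in> V"
      have "v - (e \<bullet> v) *\<^sub>R e \<in> ?W"
        using v e V ee by (auto intro: subspace_diff subspace_scale simp: inner_diff_right)
      then have "v - (e \<bullet> v) *\<^sub>R e \<in> span (insert e B)" using span_mono[of B "insert e B"] B(4) by blast
      then have "v - (e \<bullet> v) *\<^sub>R e + (e \<bullet> v) *\<^sub>R e \<in> span (insert e B)"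
        by (rule span_add, intro span_scale span_base) simp
      then show "v \<in> span (insert e B)" by simp
    qed
  qed
  have "card (insert e B) = m" using onb_card[OF orth unit] span m by simp
  then have "card B = m - 1" using onb_finite[OF orth unit] eB by simp
  then show ?thesis using that orth unit span eB by blast
qed

text \<open>
  The volumes are computed by slices parallel to \<open>e\<close>. A line that meets the ball meets it in an interval
  of length \<open>2 h\<close>, and meets the swept ball in an interval of length \<open>2 h + 1\<close>. The two volumes
  differ by the measure of the lines that meet the ball, which is the volume of the ball of one dimension
  less.
\<close>

lemma sweep_subspace_ball_unit:
  assumes e: "e \<in> V" "norm e = 1"
  shows "sweep (subspace_lborel V) (V \<inter> cball 0 1) e = unit_ball_vol (real (m - 1))"
proof -
  obtain B where orth: "pairwise orthogonal (insert e B)" and unit: "\<And>b. b \<in> insert e B \<Longrightarrow> norm b = 1"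
    and span: "span (insert e B) = V" and eB: "e \<notin> B" and card: "card B = m - 1"
    using onb_insert[OF e] by metis
  note \<nu> = haar_on_subspace_lborel[OF V]
  have \<nu>_eq: "subspace_lborel V = span_lborel (insert e B)"
    by (rule subspace_lborel_onb[OF V orth unit span])
  have fin: "finite B" using onb_finite[OF orth unit] by simp
  have orthB: "pairwise orthogonal B" using orth by (rule pairwise_subset) auto
  have unitB: "\<And>b. b \<in> B \<Longrightarrow> norm b = 1" using unit by auto
  have spanB: "span B \<subseteq> V" using span span_mono[of B "insert e B"] by auto
  interpret product_sigma_finite "\<lambda>_::real^'n. lborel :: real measure" by standard
  define y where "y g = (\<Sum>b\<in>B. g b *\<^sub>R b)" for g
  have yV: "y g \<in> V" for g
  proof -
    have "y g \<in> span B" unfolding y_def by (intro span_sum span_scale span_base)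
    then show ?thesis using spanB by blast
  qed
  have ye: "y g \<bullet> e = 0" for g
    unfolding y_def inner_sum_left using orth eB
    by (intro sum.neutral) (auto simp: pairwise_insert orthogonal_def inner_commute)
  have norm2: "(norm (t *\<^sub>R e + y g))\<^sup>2 = t\<^sup>2 + (norm (y g))\<^sup>2" for t g
    unfolding power2_norm_eq_inner
    using ye[of g] e(2) by (simp add: inner_add_left inner_add_right inner_commute[of e "y g"]
      power2_eq_square norm_eq_1)
  let ?P = "\<Pi>\<^sub>M b\<in>B. (lborel :: real measure)"
  let ?P' = "\<Pi>\<^sub>M b\<in>insert e B. (lborel :: real measure)"
  have slice: "emeasure (subspace_lborel V) X = (\<integral>\<^sup>+ g. emeasure lborel {t. t *\<^sub>R e + y g \<in> X} \<partial>?P)"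
    if X: "X \<in> sets borel" for X
  proof -
    have "emeasure (subspace_lborel V) X =
        (\<integral>\<^sup>+ f. indicator X (\<Sum>b\<in>insert e B. f b *\<^sub>R b) \<partial>?P')"
      using X nn_integral_distr[OF measurable_onb_sum, of "indicator X"]
      by (simp add: \<nu>_eq span_lborel_def)
    also have "\<dots> = (\<integral>\<^sup>+ g. \<integral>\<^sup>+ t. indicator X (\<Sum>b\<in>insert e B. (g(e := t)) b *\<^sub>R b) \<partial>lborel \<partial>?P)"
      using X measurable_onb_sum by (intro product_nn_integral_insert fin eB) auto
    also have "\<dots> = (\<integral>\<^sup>+ g. \<integral>\<^sup>+ t. indicator {t. t *\<^sub>R e + y g \<in> X} t \<partial>lborel \<partial>?P)"
    proof (intro nn_integral_cong)
      fix g t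
      have "(\<Sum>b\<in>insert e B. (g(e := t)) b *\<^sub>R b) = t *\<^sub>R e + y g"
        unfolding y_def using fin eB by (simp, intro sum.cong refl) auto
      then show "indicator X (\<Sum>b\<in>insert e B. (g(e := t)) b *\<^sub>R b) = indicator {t. t *\<^sub>R e + y g \<in> X} t"
        by (simp add: indicator_def)
    qed
    also have "\<dots> = (\<integral>\<^sup>+ g. emeasure lborel {t. t *\<^sub>R e + y g \<in> X} \<partial>?P)"
    proof (intro nn_integral_cong nn_integral_indicator)
      fix g
      have "(\<lambda>t. t *\<^sub>R e + y g) -` X \<in> sets borel"
        by (rule measurable_sets_borel[OF _ X]) simp
      then show "{t. t *\<^sub>R e + y g \<in> X} \<in> sets lborel" by (simp add: vimage_def)
    qed
    finally show ?thesis .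
  qed
  let ?C = "V \<inter> cball 0 1"
  let ?D = "?C + closed_segment 0 e"
  have C: "compact ?C" using closed_Int_compact[OF closed_subspace[OF V] compact_cball] by simp
  have D: "compact ?D" by (intro compact_set_plus C) simp
  define h where "h g = sqrt (1 - (norm (y g))\<^sup>2)" for g
  have te: "t *\<^sub>R e + y g \<in> V" for t g using V e yV by (intro subspace_add subspace_scale) auto
  have memC: "t *\<^sub>R e + y g \<in> ?C \<longleftrightarrow> t\<^sup>2 \<le> 1 - (norm (y g))\<^sup>2" for t g
  proof -
    have "norm (t *\<^sub>R e + y g) \<le> 1 \<longleftrightarrow> (norm (t *\<^sub>R e + y g))\<^sup>2 \<le> 1" by (simp add: power_le_one_iff abs_square_le_1)
    then show ?thesis using te[of t g] norm2[of t g] by auto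
  qed
  have memD: "t *\<^sub>R e + y g \<in> ?D \<longleftrightarrow> (\<exists>s\<in>{0..1}. (t - s)\<^sup>2 \<le> 1 - (norm (y g))\<^sup>2)" for t g
  proof -
    have "t *\<^sub>R e + y g \<in> ?D \<longleftrightarrow> (\<exists>z\<in>?C. \<exists>s\<in>{0..1}. t *\<^sub>R e + y g = z + s *\<^sub>R e)"
      using set_plus_closed_segment_0[of 1 "t *\<^sub>R e + y g" ?C e] by simp
    also have "\<dots> \<longleftrightarrow> (\<exists>s\<in>{0..1}. (t - s) *\<^sub>R e + y g \<in> ?C)"
    proof safe
      fix z s assume *: "z \<in> V" "z \<in> cball 0 1" "s \<in> {0..1::real}" "t *\<^sub>R e + y g = z + s *\<^sub>R e"
      then have "(t - s) *\<^sub>R e + y g = z" by (simp add: algebra_simps)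
      then show "\<exists>s\<in>{0..1}. (t - s) *\<^sub>R e + y g \<in> ?C" using * by (intro bexI[of _ s]) auto
    next
      fix s assume *: "s \<in> {0..1::real}" "(t - s) *\<^sub>R e + y g \<in> V" "(t - s) *\<^sub>R e + y g \<in> cball 0 1"
      then show "\<exists>z\<in>?C. \<exists>s\<in>{0..1}. t *\<^sub>R e + y g = z + s *\<^sub>R e"
        by (intro bexI[of _ "(t - s) *\<^sub>R e + y g"] bexI[of _ s]) (auto simp: algebra_simps)
    qed
    finally show ?thesis by (simp only: memC)
  qed
  have len: "emeasure lborel {t. t *\<^sub>R e + y g \<in> ?C} = indicator {g. norm (y g) \<le> 1} g * ennreal (2 * h g)"
      "emeasure lborel {t. t *\<^sub>R e + y g \<in> ?D} =
        indicator {g. norm (y g) \<le> 1} g * ennreal (2 * h g) + indicator {g. norm (y g) \<le> 1} g" for g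
  proof -
    consider "norm (y g) \<le> 1" | "norm (y g) > 1" by linarith
    then have "emeasure lborel {t. t *\<^sub>R e + y g \<in> ?C} = indicator {g. norm (y g) \<le> 1} g * ennreal (2 * h g) \<and>
      emeasure lborel {t. t *\<^sub>R e + y g \<in> ?D} =
        indicator {g. norm (y g) \<le> 1} g * ennreal (2 * h g) + indicator {g. norm (y g) \<le> 1} g"
    proof cases
      case 1
      have nn: "0 \<le> 1 - (norm (y g))\<^sup>2" using 1 by (simp add: power_le_one)
      have h0: "h g \<ge> 0" using nn by (simp add: h_def)
      have sq: "x\<^sup>2 \<le> 1 - (norm (y g))\<^sup>2 \<longleftrightarrow> - h g \<le> x \<and> x \<le> h g" for x
        using real_sqrt_le_iff[of "x\<^sup>2" "1 - (norm (y g))\<^sup>2"] by (simp add: h_def abs_le_iff) linarith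
      have "{t. t *\<^sub>R e + y g \<in> ?C} = {- h g .. h g}" unfolding memC sq by auto
      moreover have "{t. t *\<^sub>R e + y g \<in> ?D} = {- h g .. h g + 1}"
      proof safe
        fix t assume "t *\<^sub>R e + y g \<in> ?D"
        then obtain s where "s \<in> {0..1}" "- h g \<le> t - s \<and> t - s \<le> h g" unfolding memD sq by blast
        then show "t \<in> {- h g .. h g + 1}" by auto
      next
        fix t assume t: "t \<in> {- h g .. h g + 1}"
        show "t *\<^sub>R e + y g \<in> ?D"
          \<comment> \<open>the parameter in \<open>[0, 1]\<close> nearest to \<open>t - h g\<close>\<close>
          unfolding memD sq using t h0 by (intro bexI[of _ "max 0 (min 1 (t - h g))"]) auto
      qed
      ultimately show ?thesis using 1 h0
        by (simp add: ennreal_plus[symmetric] del: ennreal_plus) (simp flip: ennreal_1 ennreal_plus)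
    next
      case 2
      then have "1 < (norm (y g))\<^sup>2" by (simp add: one_less_power)
      then have "\<not> x\<^sup>2 \<le> 1 - (norm (y g))\<^sup>2" for x :: real using zero_le_power2[of x] by linarith
      then have empty: "{t. t *\<^sub>R e + y g \<in> ?C} = {}" "{t. t *\<^sub>R e + y g \<in> ?D} = {}"
        unfolding memC memD by auto
      show ?thesis unfolding empty using 2 by simp
    qed
    then show "emeasure lborel {t. t *\<^sub>R e + y g \<in> ?C} = indicator {g. norm (y g) \<le> 1} g * ennreal (2 * h g)"
      "emeasure lborel {t. t *\<^sub>R e + y g \<in> ?D} =
        indicator {g. norm (y g) \<le> 1} g * ennreal (2 * h g) + indicator {g. norm (y g) \<le> 1} g" by auto
  qed
  have y_meas [measurable]: "y \<in> ?P \<rightarrow>\<^sub>M borel"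
    using measurable_onb_sum by (simp add: y_def[abs_def])
  have h_meas [measurable]: "h \<in> borel_measurable ?P" unfolding h_def[abs_def] by measurable
  have ind_meas: "{g. norm (y g) \<le> 1} \<inter> space ?P \<in> sets ?P"
  proof -
    have "{g \<in> space ?P. norm (y g) \<le> 1} \<in> sets ?P" by measurable
    then show ?thesis by (simp add: Int_def conj_commute)
  qed
  have ind_eq: "(\<integral>\<^sup>+ g. indicator {g. norm (y g) \<le> 1} g \<partial>?P) = ennreal (unit_ball_vol (real (m - 1)))"
  proof -
    have "(\<integral>\<^sup>+ g. indicator {g. norm (y g) \<le> 1} g \<partial>?P) = (\<integral>\<^sup>+ g. indicator ({g. norm (y g) \<le> 1} \<inter> space ?P) g \<partial>?P)"
      by (intro nn_integral_cong) (auto simp: indicator_def)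
    also have "\<dots> = emeasure ?P ({g. norm (y g) \<le> 1} \<inter> space ?P)"
      by (intro nn_integral_indicator ind_meas)
    also have "\<dots> = emeasure ?P ({f. sqrt (\<Sum>i\<in>B. (f i)\<^sup>2) \<le> 1} \<inter> space ?P)"
      unfolding y_def by (simp add: onb_norm_sum[OF orthB unitB, symmetric])
    also have "\<dots> = ennreal (unit_ball_vol (real (m - 1)))"
      by (simp only: emeasure_cball_aux[OF fin zero_less_one] card power_one mult_1_right)
    finally show ?thesis .
  qed
  have ind_borel: "(\<lambda>g. indicator {g. norm (y g) \<le> 1} g :: ennreal) \<in> borel_measurable ?P"
    using ind_meas by (subst borel_measurable_indicator_iff) auto
  have "emeasure (subspace_lborel V) ?D =
      (\<integral>\<^sup>+ g. indicator {g. norm (y g) \<le> 1} g * ennreal (2 * h g) + indicator {g. norm (y g) \<le> 1} g \<partial>?P)"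
    by (simp only: slice[OF borel_closed[OF compact_imp_closed[OF D]]] len)
  also have "\<dots> = (\<integral>\<^sup>+ g. indicator {g. norm (y g) \<le> 1} g * ennreal (2 * h g) \<partial>?P) +
      (\<integral>\<^sup>+ g. indicator {g. norm (y g) \<le> 1} g \<partial>?P)"
  proof (rule nn_integral_add[OF borel_measurable_times_ennreal[OF ind_borel] ind_borel])
    show "(\<lambda>g. ennreal (2 * h g)) \<in> borel_measurable ?P" by measurable
  qed
  also have "\<dots> = emeasure (subspace_lborel V) ?C + ennreal (unit_ball_vol (real (m - 1)))"
    by (simp only: slice[OF borel_closed[OF compact_imp_closed[OF C]]] len ind_eq)
  finally have "emeasure (subspace_lborel V) ?D =
      emeasure (subspace_lborel V) ?C + ennreal (unit_ball_vol (real (m - 1)))" .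
  then have "ennreal (measure (subspace_lborel V) ?D) =
      ennreal (measure (subspace_lborel V) ?C + unit_ball_vol (real (m - 1)))"
    by (simp add: haar_emeasure_eq[OF \<nu> C] haar_emeasure_eq[OF \<nu> D])
  then have "measure (subspace_lborel V) ?D = measure (subspace_lborel V) ?C + unit_ball_vol (real (m - 1))"
    by (subst (asm) ennreal_inj) auto
  then show ?thesis by (simp add: sweep_def)
qed

lemma sweep_subspace_ball:
  assumes u: "u \<in> V"
  shows "sweep (subspace_lborel V) (V \<inter> cball 0 1) u = norm u * unit_ball_vol (real (m - 1))"
proof (cases "u = 0")
  case False
  note \<nu> = haar_on_subspace_lborel[OF V]
  have C: "compact (V \<inter> cball 0 1)" "convex (V \<inter> cball 0 1)"
    using closed_Int_compact[OF closed_subspace[OF V] compact_cball] subspace_imp_convex[OF V]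
    by (auto intro: convex_Int)
  have e: "u /\<^sub>R norm u \<in> V" "norm (u /\<^sub>R norm u) = 1" using u V False by (auto intro: subspace_scale)
  have "sweep (subspace_lborel V) (V \<inter> cball 0 1) (norm u *\<^sub>R (u /\<^sub>R norm u)) =
      norm u * unit_ball_vol (real (m - 1))"
    using sweep_scaleR[OF \<nu> V C e(1), of "norm u"] sweep_subspace_ball_unit[OF e] by simp
  then show ?thesis using False by simp
next
  case True
  have "V \<inter> cball 0 1 + {0} = V \<inter> cball 0 (1::real)" by (auto simp: set_plus_def)
  then show ?thesis using True by (simp add: sweep_def)
qed

text \<open>
  The value of \<open>(\<Sum>u\<leftarrow>us. norm u)\<close>, up to the factor \<open>1 + \<epsilon>\<close>, read off from the surface area
  \<open>m * unit_ball_vol m\<close> and the swept volumes of the ball.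
\<close>

lemma ball_zonotope_mean_width:
  assumes us: "ball_zonotope V \<epsilon> us" and \<epsilon>: "\<epsilon> > 0"
  shows "real m * unit_ball_vol (real m) \<le> 2 * (\<Sum>u\<leftarrow>us. norm u) * unit_ball_vol (real (m - 1))"
    and "2 * (\<Sum>u\<leftarrow>us. norm u) * unit_ball_vol (real (m - 1)) \<le> (1 + \<epsilon>) * (real m * unit_ball_vol (real m))"
proof -
  note \<nu> = haar_on_subspace_lborel[OF V]
  have C: "compact (V \<inter> cball 0 1)" "convex (V \<inter> cball 0 1)"
    using closed_Int_compact[OF closed_subspace[OF V] compact_cball] subspace_imp_convex[OF V]
    by (auto intro: convex_Int)
  obtain S where S: "(outer_quotient V (subspace_lborel V) (V \<inter> cball 0 1) \<longlongrightarrow> S) (at_right 0)"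
    "S \<le> 2 * (\<Sum>u\<leftarrow>us. sweep (subspace_lborel V) (V \<inter> cball 0 1) u)"
    "2 * (\<Sum>u\<leftarrow>us. sweep (subspace_lborel V) (V \<inter> cball 0 1) u) \<le> (1 + \<epsilon>) * S"
    using outer_quotient_tendsto[OF V \<nu> C] us \<epsilon> by metis
  have "S = real m * unit_ball_vol (real m)"
    by (rule tendsto_unique[OF _ S(1) outer_quotient_subspace_ball]) simp
  moreover have "(\<Sum>u\<leftarrow>us. sweep (subspace_lborel V) (V \<inter> cball 0 1) u) =
      (\<Sum>u\<leftarrow>us. norm u) * unit_ball_vol (real (m - 1))"
    using us unfolding sum_list_mult_const[symmetric]
    by (intro arg_cong[where f=sum_list] map_cong refl sweep_subspace_ball) (auto simp: ball_zonotope_def)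
  ultimately show "real m * unit_ball_vol (real m) \<le> 2 * (\<Sum>u\<leftarrow>us. norm u) * unit_ball_vol (real (m - 1))"
    "2 * (\<Sum>u\<leftarrow>us. norm u) * unit_ball_vol (real (m - 1)) \<le> (1 + \<epsilon>) * (real m * unit_ball_vol (real m))"
    using S by simp_all
qed

end

section \<open>Measurability of set-valued maps\<close>

text \<open>
  Effros measurability. For closed values, separability makes it the right notion of a random closed
  set, and it can be checked directly from the Hausdorff and the gap metric.
\<close>

definition hit_measurable :: "'w measure \<Rightarrow> ('w \<Rightarrow> 'a::topological_space set) \<Rightarrow> bool" where
  "hit_measurable M F \<longleftrightarrow> (\<forall>U. open U \<longrightarrow> {w \<in> space M. F w \<inter> U \<noteq> {}} \<in> sets M)"

lemma hit_measurable_const: "hit_measurable M (\<lambda>_. A)"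
  by (simp add: hit_measurable_def)

lemma hit_measurable_singleton:
  assumes "f \<in> M \<rightarrow>\<^sub>M borel" shows "hit_measurable M (\<lambda>w. {f w})"
  unfolding hit_measurable_def
proof (intro allI impI)
  fix U :: "'b set" assume "open U"
  then have "f -` U \<inter> space M \<in> sets M" using assms by (intro measurable_sets) auto
  moreover have "{w \<in> space M. {f w} \<inter> U \<noteq> {}} = f -` U \<inter> space M" by auto
  ultimately show "{w \<in> space M. {f w} \<inter> U \<noteq> {}} \<in> sets M" by simp
qed

lemma hit_measurable_compose:
  assumes "hit_measurable M F" "g \<in> N \<rightarrow>\<^sub>M M"
  shows "hit_measurable N (\<lambda>w. F (g w))"
  unfolding hit_measurable_def
proof (intro allI impI)
  fix U :: "'b set" assume "open U"
  then have "{w \<in> space M. F w \<inter> U \<noteq> {}} \<in> sets M" using assms by (simp add: hit_measurable_def)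
  then have "g -` {w \<in> space M. F w \<inter> U \<noteq> {}} \<inter> space N \<in> sets N" by (rule measurable_sets[OF assms(2)])
  moreover have "g -` {w \<in> space M. F w \<inter> U \<noteq> {}} \<inter> space N = {w \<in> space N. F (g w) \<inter> U \<noteq> {}}"
    using measurable_space[OF assms(2)] by auto
  ultimately show "{w \<in> space N. F (g w) \<inter> U \<noteq> {}} \<in> sets N" by simp
qed

lemma hit_measurable_image:
  assumes "hit_measurable M F" "continuous_on UNIV f"
  shows "hit_measurable M (\<lambda>w. f ` F w)"
  unfolding hit_measurable_def
proof (intro allI impI)
  fix U :: "'c set" assume "open U"
  then have "open (f -` U)" using assms(2) by (simp add: open_vimage)
  then have "{w \<in> space M. F w \<inter> f -` U \<noteq> {}} \<in> sets M" using assms(1) by (simp add: hit_measurable_def)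
  moreover have "{w \<in> space M. F w \<inter> f -` U \<noteq> {}} = {w \<in> space M. f ` F w \<inter> U \<noteq> {}}" by auto
  ultimately show "{w \<in> space M. f ` F w \<inter> U \<noteq> {}} \<in> sets M" by simp
qed

text \<open>
  If \<open>x + y\<close> lies in the open set \<open>U\<close>, then \<open>x\<close> and \<open>y\<close> have basic neighbourhoods \<open>A\<close> and \<open>B\<close> with
  \<open>A + B \<subseteq> U\<close>; there are countably many such pairs.
\<close>

lemma hit_measurable_plus:
  fixes F G :: "'w \<Rightarrow> 'a::euclidean_space set"
  assumes F: "hit_measurable M F" and G: "hit_measurable M G"
  shows "hit_measurable M (\<lambda>w. F w + G w)"
  unfolding hit_measurable_def
proof (intro allI impI)
  fix U :: "'a set" assume U: "open U"
  obtain \<B> :: "'a set set" where \<B>: "countable \<B>" "topological_basis \<B>"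
    using ex_countable_basis by blast
  let ?I = "{(A, B). A \<in> \<B> \<and> B \<in> \<B> \<and> A + B \<subseteq> U}"
  have "{w \<in> space M. (F w + G w) \<inter> U \<noteq> {}} =
      (\<Union>(A, B)\<in>?I. {w \<in> space M. F w \<inter> A \<noteq> {}} \<inter> {w \<in> space M. G w \<inter> B \<noteq> {}})"
  proof
    show "{w \<in> space M. (F w + G w) \<inter> U \<noteq> {}} \<subseteq>
      (\<Union>(A, B)\<in>?I. {w \<in> space M. F w \<inter> A \<noteq> {}} \<inter> {w \<in> space M. G w \<inter> B \<noteq> {}})"
    proof
      fix w assume "w \<in> {w \<in> space M. (F w + G w) \<inter> U \<noteq> {}}"
      then obtain x y where w: "w \<in> space M" and xy: "x \<in> F w" "y \<in> G w" "x + y \<in> U"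
        by (auto simp: set_plus_def)
      have "open ((\<lambda>p::'a \<times> 'a. fst p + snd p) -` U)"
        using U by (intro open_vimage continuous_intros)
      moreover have "(x, y) \<in> (\<lambda>p::'a \<times> 'a. fst p + snd p) -` U" using xy by simp
      ultimately obtain A0 B0 where 0: "open A0" "open B0" "(x, y) \<in> A0 \<times> B0"
        "A0 \<times> B0 \<subseteq> (\<lambda>p::'a \<times> 'a. fst p + snd p) -` U"
        by (rule open_prod_elim)
      obtain A where A: "A \<in> \<B>" "x \<in> A" "A \<subseteq> A0"
        using topological_basisE[OF \<B>(2) 0(1), of x] 0(3) by auto
      obtain B where B: "B \<in> \<B>" "y \<in> B" "B \<subseteq> B0"
        using topological_basisE[OF \<B>(2) 0(2), of y] 0(3) by auto
      have "A + B \<subseteq> U"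
      proof
        fix z assume "z \<in> A + B"
        then obtain a b where "z = a + b" "a \<in> A" "b \<in> B" by (auto simp: set_plus_def)
        moreover have "(a, b) \<in> A0 \<times> B0" using calculation A B by auto
        ultimately show "z \<in> U" using 0(4) by auto
      qed
      then show "w \<in> (\<Union>(A, B)\<in>?I. {w \<in> space M. F w \<inter> A \<noteq> {}} \<inter> {w \<in> space M. G w \<inter> B \<noteq> {}})"
        using A B w xy by (intro UN_I[of "(A, B)"]) auto
    qed
  next
    show "(\<Union>(A, B)\<in>?I. {w \<in> space M. F w \<inter> A \<noteq> {}} \<inter> {w \<in> space M. G w \<inter> B \<noteq> {}}) \<subseteq>
        {w \<in> space M. (F w + G w) \<inter> U \<noteq> {}}"
    proof
      fix w assume "w \<in> (\<Union>(A, B)\<in>?I. {w \<in> space M. F w \<inter> A \<noteq> {}} \<inter> {w \<in> space M. G w \<inter> B \<noteq> {}})"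
      then obtain A B x y where "A + B \<subseteq> U" "w \<in> space M" "x \<in> F w" "x \<in> A" "y \<in> G w" "y \<in> B" by auto
      then have "x + y \<in> (F w + G w) \<inter> U" by auto
      then show "w \<in> {w \<in> space M. (F w + G w) \<inter> U \<noteq> {}}" using \<open>w \<in> space M\<close> by blast
    qed
  qed
  also have "\<dots> \<in> sets M"
  proof (rule sets.countable_UN'')
    show "countable ?I"
      by (rule countable_subset[of _ "\<B> \<times> \<B>"]) (use \<B>(1) in auto)
    show "(case x of (A, B) \<Rightarrow> {w \<in> space M. F w \<inter> A \<noteq> {}} \<inter> {w \<in> space M. G w \<inter> B \<noteq> {}}) \<in> sets M"
      if "x \<in> ?I" for x
      using that F G topological_basis_open[OF \<B>(2)] by (auto simp: hit_measurable_def)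
  qed
  finally show "{w \<in> space M. (F w + G w) \<inter> U \<noteq> {}} \<in> sets M" .
qed

lemma hit_measurable_infdist:
  fixes F :: "'w \<Rightarrow> 'a::euclidean_space set"
  assumes F: "hit_measurable M F" and ne: "\<And>w. w \<in> space M \<Longrightarrow> F w \<noteq> {}"
    and f: "f \<in> M \<rightarrow>\<^sub>M borel"
  shows "(\<lambda>w. infdist (f w) (F w)) \<in> borel_measurable M"
proof (rule borel_measurable_iff_less[THEN iffD2, rule_format])
  fix c :: real
  have "hit_measurable M (\<lambda>w. F w + {- f w})"
    using f by (intro hit_measurable_plus F hit_measurable_singleton) simp
  then have "{w \<in> space M. (F w + {- f w}) \<inter> ball 0 c \<noteq> {}} \<in> sets M" by (simp add: hit_measurable_def)
  moreover have "{w \<in> space M. (F w + {- f w}) \<inter> ball 0 c \<noteq> {}} = {w \<in> space M. infdist (f w) (F w) < c}"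
  proof (intro Collect_cong conj_cong refl)
    fix w assume w: "w \<in> space M"
    have "(F w + {- f w}) \<inter> ball 0 c \<noteq> {} \<longleftrightarrow> (\<exists>y\<in>F w. dist (f w) y < c)"
      by (force simp: set_plus_def dist_norm norm_minus_commute)
    also have "\<dots> \<longleftrightarrow> infdist (f w) (F w) < c"
    proof
      assume "\<exists>y\<in>F w. dist (f w) y < c" then show "infdist (f w) (F w) < c"
        using infdist_le le_less_trans by metis
    next
      assume "infdist (f w) (F w) < c" then show "\<exists>y\<in>F w. dist (f w) y < c"
        using ne[OF w] cInf_lessD[of "(\<lambda>a. dist (f w) a) ` F w" c] by (auto simp: infdist_def)
    qed
    finally show "(F w + {- f w}) \<inter> ball 0 c \<noteq> {} \<longleftrightarrow> infdist (f w) (F w) < c" .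
  qed
  ultimately show "{w \<in> space M. infdist (f w) (F w) < c} \<in> sets M" by simp
qed

lemma hit_measurable_mem:
  fixes F :: "'w \<Rightarrow> 'a::euclidean_space set"
  assumes F: "hit_measurable M F" and ne: "\<And>w. w \<in> space M \<Longrightarrow> F w \<noteq> {}"
    and cl: "\<And>w. w \<in> space M \<Longrightarrow> closed (F w)" and f: "f \<in> M \<rightarrow>\<^sub>M borel"
  shows "{w \<in> space M. f w \<in> F w} \<in> sets M"
proof -
  have "{w \<in> space M. infdist (f w) (F w) = 0} \<in> sets M"
    using hit_measurable_infdist[OF F ne f] by measurable
  moreover have "{w \<in> space M. infdist (f w) (F w) = 0} = {w \<in> space M. f w \<in> F w}"
    using in_closed_iff_infdist_zero[OF cl ne] by auto
  ultimately show ?thesis by simp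
qed

lemma space_borel_of: "space (borel_of X) = topspace X"
  unfolding borel_of_def by (rule space_measure_of) (auto dest: openin_subset)

lemma sets_borel_of_open: "openin X U \<Longrightarrow> U \<in> sets (borel_of X)"
  unfolding borel_of_def by (subst sets_measure_of) (auto dest: openin_subset)

lemma measurable_borel_of:
  assumes "continuous_map X Y f" shows "f \<in> borel_of X \<rightarrow>\<^sub>M borel_of Y"
  unfolding borel_of_def[of Y]
proof (rule measurable_measure_of)
  show "f \<in> space (borel_of X) \<rightarrow> topspace Y"
    using assms by (auto simp: space_borel_of dest: continuous_map_image_subset_topspace)
  show "f -` U \<inter> space (borel_of X) \<in> sets (borel_of X)" if "U \<in> {U. openin Y U}" for U
    using openin_continuous_map_preimage[OF assms, of U] that
    by (intro sets_borel_of_open) (simp add: space_borel_of vimage_def Int_def conj_commute)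
qed (auto dest: openin_subset)

lemma space_convex_ring_borel: "space convex_ring_borel = convex_ring"
  by (simp add: convex_ring_borel_def space_borel_of Metric_space.topspace_mtopology[OF Metric_space_convex_ring])

lemma space_grassmannian_borel: "space (grassmannian_borel k) = grassmannian k"
  by (simp add: grassmannian_borel_def space_borel_of Metric_space.topspace_mtopology[OF Metric_space_grassmannian])

lemma convex_ring_compact: "K \<in> convex_ring \<Longrightarrow> compact K" and convex_ring_nonempty: "K \<in> convex_ring \<Longrightarrow> K \<noteq> {}"
  by (auto simp: convex_ring_def convex_bodies_def intro!: compact_Union)

lemma infdist_less_obtain:
  assumes "infdist x A < e" "A \<noteq> {}" obtains y where "y \<in> A" "dist x y < e"
  using assms cInf_lessD[of "(\<lambda>a. dist x a) ` A" e] by (auto simp: infdist_def)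

lemma hit_measurable_convex_ring: "hit_measurable convex_ring_borel (\<lambda>K :: (real ^ 'n) set. K)"
  unfolding hit_measurable_def
proof (intro allI impI)
  interpret Metric_space "convex_ring :: (real ^ 'n) set set" hausdorff_dist by (rule Metric_space_convex_ring)
  fix U :: "(real ^ 'n) set" assume U: "open U"
  have "openin mtopology {K \<in> convex_ring. K \<inter> U \<noteq> {}}"
    unfolding openin_mtopology
  proof (intro conjI allI impI)
    fix K :: "(real ^ 'n) set" assume "K \<in> {K \<in> convex_ring. K \<inter> U \<noteq> {}}"
    then obtain x where x: "K \<in> convex_ring" "x \<in> K" "x \<in> U" by blast
    then obtain e where e: "e > 0" "ball x e \<subseteq> U" using U by (auto simp: open_contains_ball)
    have "mball K e \<subseteq> {K \<in> convex_ring. K \<inter> U \<noteq> {}}"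
    proof
      fix L assume "L \<in> mball K e"
      then have L: "L \<in> convex_ring" "hausdorff_dist K L < e" by (auto simp: in_mball)
      have "infdist x L \<le> hausdorff_dist K L"
        using x L convex_ring_compact convex_ring_nonempty compact_imp_bounded
        by (intro infdist_le_hausdorff_dist) auto
      then have "infdist x L < e" using L by simp
      then obtain y where "y \<in> L" "dist x y < e"
        using convex_ring_nonempty[OF L(1)] by (rule infdist_less_obtain)
      then have "y \<in> L \<inter> U" using e by auto
      then show "L \<in> {K \<in> convex_ring. K \<inter> U \<noteq> {}}" using L by blast
    qed
    then show "\<exists>r>0. mball K r \<subseteq> {K \<in> convex_ring. K \<inter> U \<noteq> {}}" using e by blast
  qed auto
  then show "{K \<in> space convex_ring_borel. K \<inter> U \<noteq> {}} \<in> sets convex_ring_borel"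
    unfolding space_convex_ring_borel by (simp add: convex_ring_borel_def sets_borel_of_open)
qed

text \<open>
  The gap metric sees a subspace through its intersection with the unit ball, so a point \<open>x\<close> of the
  subspace is scaled by \<open>1 / (norm x + 1)\<close> into the ball and back.
\<close>

lemma hit_measurable_grassmannian: "hit_measurable (grassmannian_borel k) (\<lambda>\<xi> :: (real ^ 'n) set. \<xi>)"
  unfolding hit_measurable_def
proof (intro allI impI)
  interpret Metric_space "grassmannian k :: (real ^ 'n) set set" gap_dist by (rule Metric_space_grassmannian)
  fix U :: "(real ^ 'n) set" assume U: "open U"
  have ball: "\<xi> \<inter> cball 0 1 \<noteq> {}" if "\<xi> \<in> grassmannian k" for \<xi> :: "(real ^ 'n) set"
  proof -
    have "0 \<in> \<xi> \<inter> cball 0 1" using that by (simp add: grassmannian_def subspace_0)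
    then show ?thesis by blast
  qed
  have "openin mtopology {\<xi> \<in> grassmannian k. \<xi> \<inter> U \<noteq> {}}"
    unfolding openin_mtopology
  proof (intro conjI allI impI)
    fix \<xi> :: "(real ^ 'n) set" assume "\<xi> \<in> {\<xi> \<in> grassmannian k. \<xi> \<inter> U \<noteq> {}}"
    then obtain x where x: "\<xi> \<in> grassmannian k" "x \<in> \<xi>" "x \<in> U" by blast
    then obtain e where e: "e > 0" "ball x e \<subseteq> U" using U by (auto simp: open_contains_ball)
    define c where "c = norm x + 1"
    have c: "c > 0" by (simp add: c_def add_nonneg_pos)
    have \<xi>: "subspace \<xi>" using x by (simp add: grassmannian_def)
    have xc: "x /\<^sub>R c \<in> \<xi> \<inter> cball 0 1"
      using x c subspace_scale[OF \<xi>] by (simp add: c_def field_simps)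
    have "mball \<xi> (e / c) \<subseteq> {\<xi> \<in> grassmannian k. \<xi> \<inter> U \<noteq> {}}"
    proof
      fix \<zeta> assume "\<zeta> \<in> mball \<xi> (e / c)"
      then have \<zeta>: "\<zeta> \<in> grassmannian k" "hausdorff_dist (\<xi> \<inter> cball 0 1) (\<zeta> \<inter> cball 0 1) < e / c"
        by (auto simp: in_mball gap_dist_def)
      have "infdist (x /\<^sub>R c) (\<zeta> \<inter> cball 0 1) \<le> hausdorff_dist (\<xi> \<inter> cball 0 1) (\<zeta> \<inter> cball 0 1)"
        using ball[OF \<zeta>(1)] xc by (intro infdist_le_hausdorff_dist bounded_Int) auto
      then have "infdist (x /\<^sub>R c) (\<zeta> \<inter> cball 0 1) < e / c" using \<zeta> by simp
      then obtain y where y: "y \<in> \<zeta>" "dist (x /\<^sub>R c) y < e / c"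
        using ball[OF \<zeta>(1)] by (rule infdist_less_obtain) auto
      have "x - c *\<^sub>R y = c *\<^sub>R (x /\<^sub>R c - y)" using c by (simp add: scaleR_right_diff_distrib)
      then have "dist x (c *\<^sub>R y) = c * dist (x /\<^sub>R c) y" using c by (simp add: dist_norm)
      also have "\<dots> < e" using y(2) c by (simp add: field_simps)
      finally have "c *\<^sub>R y \<in> \<zeta> \<inter> U"
        using e y \<zeta> by (auto intro: subspace_scale simp: grassmannian_def)
      then show "\<zeta> \<in> {\<xi> \<in> grassmannian k. \<xi> \<inter> U \<noteq> {}}" using \<zeta> by blast
    qed
    then show "\<exists>r>0. mball \<xi> r \<subseteq> {\<xi> \<in> grassmannian k. \<xi> \<inter> U \<noteq> {}}" using e c by (intro exI[of _ "e / c"]) auto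
  qed auto
  then show "{\<xi> \<in> space (grassmannian_borel k). \<xi> \<inter> U \<noteq> {}} \<in> sets (grassmannian_borel k)"
    unfolding space_grassmannian_borel by (simp add: grassmannian_borel_def sets_borel_of_open)
qed

lemma infdist_image_isometry:
  assumes "\<And>x y. dist (f x) (f y) = dist x y"
  shows "infdist (f x) (f ` A) = infdist x A"
  by (simp add: infdist_def image_image assms)

lemma hausdorff_dist_image_isometry:
  fixes f :: "'a::real_normed_vector \<Rightarrow> 'a"
  assumes f: "linear f" "\<And>x. norm (f x) = norm x"
  shows "hausdorff_dist (f ` A) (f ` B) = hausdorff_dist A B"
proof -
  have iso: "dist (f x) (f y) = dist x y" for x y
    using f by (simp add: dist_norm linear_diff[symmetric])
  have "bounded (f ` C) \<longleftrightarrow> bounded C" for C by (simp add: bounded_iff f(2))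
  then show ?thesis unfolding hausdorff_dist_def by (simp add: infdist_image_isometry[OF iso] image_image)
qed

lemma convex_ring_linear_image:
  assumes "K \<in> convex_ring" "linear f"
  shows "f ` K \<in> convex_ring"
proof -
  obtain F where F: "K = \<Union>F" "finite F" "F \<noteq> {}" "F \<subseteq> convex_bodies" using assms(1) by (auto simp: convex_ring_def)
  have "f ` K = \<Union>((`) f ` F)" using F(1) by auto
  moreover have "(`) f ` F \<subseteq> convex_bodies"
    using F(4) assms(2) by (auto simp: convex_bodies_def intro!: compact_continuous_image convex_linear_image linear_continuous_on
        linear_conv_bounded_linear[THEN iffD1])
  ultimately show ?thesis using F by (auto simp: convex_ring_def intro!: exI[of _ "(`) f ` F"])
qed

lemma measurable_isometry_image:
  fixes f :: "real ^ 'n \<Rightarrow> real ^ 'n"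
  assumes f: "orthogonal_transformation f"
  shows "(`) f \<in> convex_ring_borel \<rightarrow>\<^sub>M convex_ring_borel"
  unfolding convex_ring_borel_def
proof (rule measurable_borel_of)
  interpret Metric_space "convex_ring :: (real ^ 'n) set set" hausdorff_dist by (rule Metric_space_convex_ring)
  have lin: "linear f" by (rule orthogonal_transformation_linear[OF f])
  note iso = hausdorff_dist_image_isometry[OF lin orthogonal_transformation_norm[OF f]]
  show "continuous_map mtopology mtopology ((`) f)"
    unfolding continuous_map_to_metric
  proof (intro ballI allI impI)
    fix K and e :: real assume K: "K \<in> topspace mtopology" and e: "e > 0"
    have KM: "K \<in> convex_ring" using K by simp
    have "f ` L \<in> mball (f ` K) e" if "L \<in> mball K e" for L
      using that convex_ring_linear_image[OF _ lin] by (auto simp: in_mball iso)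
    then show "\<exists>U. openin mtopology U \<and> K \<in> U \<and> (\<forall>y\<in>U. f ` y \<in> mball (f ` K) e)"
      using e KM by (intro exI[of _ "mball K e"]) auto
  qed
qed

section \<open>The mean surface area of isotropic random bodies\<close>

text \<open>
  The set of all pairs \<open>(K, x)\<close> with \<open>x \<in> K + T\<close> is measurable in the product, so this is the
  measurability part of Fubini's theorem.
\<close>

lemma measurable_emeasure_plus:
  fixes T :: "(real ^ 'n) set"
  assumes \<nu>: "sigma_finite_measure \<nu>" "sets \<nu> = sets borel" and T: "compact T" "T \<noteq> {}"
  shows "(\<lambda>K. emeasure \<nu> (K + T)) \<in> borel_measurable convex_ring_borel"
proof -
  let ?N = "convex_ring_borel \<Otimes>\<^sub>M \<nu>"
  have K: "compact (K + T)" "K + T \<noteq> {}" if "K \<in> convex_ring" for K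
  proof -
    show "compact (K + T)" by (rule compact_set_plus[OF convex_ring_compact[OF that] T(1)])
    show "K + T \<noteq> {}" using T convex_ring_nonempty[OF that] by (auto simp: set_plus_def)
  qed
  have sp: "fst p \<in> convex_ring" if "p \<in> space ?N" for p
    using that by (auto simp: space_pair_measure space_convex_ring_borel)
  have Q: "{p \<in> space ?N. snd p \<in> fst p + T} \<in> sets ?N"
  proof (rule hit_measurable_mem)
    show "hit_measurable ?N (\<lambda>p. fst p + T)"
      by (intro hit_measurable_plus hit_measurable_const hit_measurable_compose[OF hit_measurable_convex_ring]) simp
    have "snd \<in> ?N \<rightarrow>\<^sub>M \<nu>" by simp
    then show "snd \<in> ?N \<rightarrow>\<^sub>M borel" using measurable_cong_sets[OF refl \<nu>(2)] by blast
  next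
    fix p :: "(real ^ 'n) set \<times> (real ^ 'n)" assume "p \<in> space ?N"
    from sp[OF this] show "fst p + T \<noteq> {}" "closed (fst p + T)"
      using K compact_imp_closed by blast+
  qed
  have "(\<lambda>K. emeasure \<nu> (Pair K -` {p \<in> space ?N. snd p \<in> fst p + T})) \<in> borel_measurable convex_ring_borel"
    by (rule sigma_finite_measure.measurable_emeasure_Pair[OF \<nu>(1) Q])
  moreover have "Pair K -` {p \<in> space ?N. snd p \<in> fst p + T} = K + T" if "K \<in> space convex_ring_borel" for K
    using that sets_eq_imp_space_eq[OF \<nu>(2)] by (auto simp: space_pair_measure)
  ultimately show ?thesis by (subst measurable_cong[where g="\<lambda>K. emeasure \<nu> (Pair K -` {p \<in> space ?N. snd p \<in> fst p + T})"]) auto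
qed

lemma measurable_sweep:
  fixes V :: "(real ^ 'n) set"
  assumes V: "subspace V"
  shows "(\<lambda>K. ennreal (sweep (subspace_lborel V) K u)) \<in> borel_measurable convex_ring_borel"
proof -
  note \<nu> = haar_on_subspace_lborel[OF V]
  have "(\<lambda>K. measure (subspace_lborel V) (K + T)) \<in> borel_measurable convex_ring_borel"
    if "compact T" "T \<noteq> {}" for T
    unfolding measure_def using measurable_emeasure_plus[OF haar_on_sigma_finite[OF \<nu>] haar_on_sets[OF \<nu>] that] by simp
  from this[of "closed_segment 0 u"] this[of "{0}"]
  show ?thesis unfolding sweep_def by simp
qed

lemma reflection_involution: "reflection w (reflection w x) = x"
  by (simp add: reflection_def inner_diff_left algebra_simps)

lemma reflection_conjugate:
  fixes T :: "'a::euclidean_space \<Rightarrow> 'a"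
  assumes T: "orthogonal_transformation T" and inv: "\<And>x. T (T x) = x"
  shows "reflection (T b) = T \<circ> reflection b \<circ> T"
proof
  fix x
  have in1: "T x \<bullet> b = x \<bullet> T b" using T inv by (metis orthogonal_transformation_def)
  have in2: "T b \<bullet> T b = b \<bullet> b" using T by (simp add: orthogonal_transformation_def)
  have lin: "linear T" using T by (rule orthogonal_transformation_linear)
  show "reflection (T b) x = (T \<circ> reflection b \<circ> T) x"
    by (simp add: reflection_def in1 in2 inv linear_diff[OF lin] linear_cmul[OF lin])
qed

lemma reflection_scaleR: "c \<noteq> 0 \<Longrightarrow> reflection (c *\<^sub>R w) = reflection w"
  by (rule ext) (simp add: reflection_def)

text \<open>
  Reflections are conjugate to each other by reflections. Hence the product of any two of them has
  determinant \<open>1\<close>, as a square of \<open>1\<close> or \<open>- 1\<close>.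
\<close>

lemma det_reflection_eq:
  fixes a b :: "real ^ 'n"
  assumes "a \<noteq> 0" "b \<noteq> 0"
  shows "det (matrix (reflection a)) = det (matrix (reflection b))"
proof -
  define a' where "a' = (norm b / norm a) *\<^sub>R a"
  have a': "norm a' = norm b" "reflection a' = reflection a"
    using assms by (auto simp: a'_def reflection_scaleR)
  let ?T = "reflection (b - a')"
  have "?T b = a'" using reflection_swap[of b a'] a' by simp
  then have "reflection a = ?T \<circ> reflection b \<circ> ?T"
    using reflection_conjugate[OF orthogonal_transformation_reflection reflection_involution, of "b - a'" b] a'(2) by simp
  then have "matrix (reflection a) = matrix ?T ** matrix (reflection b) ** matrix ?T"
    by (simp add: matrix_compose linear_reflection linear_compose)
  then have "det (matrix (reflection a)) = (det (matrix ?T))\<^sup>2 * det (matrix (reflection b))"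
    by (simp add: det_mul power2_eq_square mult.assoc mult.left_commute)
  moreover have "\<bar>det (matrix ?T)\<bar> = 1"
    by (rule orthogonal_transformation_det[OF orthogonal_transformation_reflection])
  then have "(det (matrix ?T))\<^sup>2 = 1" by (simp add: abs_square_eq_1)
  ultimately show ?thesis by simp
qed

text \<open>
  The product of the reflections along \<open>v - w\<close> and along \<open>w\<close> takes \<open>v\<close> to \<open>w\<close> and then to \<open>- w\<close>. Aiming at
  \<open>- w\<close> rather than at \<open>w\<close> covers the case that \<open>V\<close> is a line, which has no nontrivial rotation.
\<close>

lemma rotation_to_minus:
  fixes V :: "(real ^ 'n) set"
  assumes V: "subspace V" and vw: "v \<in> V" "w \<in> V" "norm v = norm w" "v \<noteq> w"
  obtains Q where "Q \<in> rotations_of_comp (V\<^sup>\<bottom>)" "orthogonal_transformation ((*v) Q)" "Q *v v = - w" "(*v) Q ` V = V"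
proof -
  define T where "T = reflection w \<circ> reflection (v - w)"
  have w0: "w \<noteq> 0" using vw by auto
  have orth: "orthogonal_transformation T"
    unfolding T_def comp_def
    by (rule orthogonal_transformation_compose[unfolded comp_def]) (rule orthogonal_transformation_reflection)+
  have lin: "linear T" by (rule orthogonal_transformation_linear[OF orth])
  define Q where "Q = matrix T"
  have Q: "(*v) Q = T" unfolding Q_def by (rule matrix_vector_mul(2)[OF lin])
  have "det Q = (det (matrix (reflection w)))\<^sup>2"
    unfolding Q_def T_def using vw w0
    by (simp add: matrix_compose linear_reflection det_mul det_reflection_eq[of "v - w" w] power2_eq_square)
  moreover have "\<bar>det (matrix (reflection w))\<bar> = 1"
    by (rule orthogonal_transformation_det[OF orthogonal_transformation_reflection])
  ultimately have "det Q = 1" by (simp add: abs_square_eq_1)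
  then have rot: "rotation_matrix Q"
    using orth unfolding rotation_matrix_def Q_def by (simp add: orthogonal_transformation_matrix)
  have fix_: "T x = x" if "x \<in> V\<^sup>\<bottom>" for x
  proof -
    have "x \<bullet> w = 0" "x \<bullet> (v - w) = 0"
      using that vw subspace_diff[OF V vw(1,2)] by (auto simp: orthogonal_comp_def orthogonal_def inner_commute)
    then show ?thesis by (simp add: T_def reflection_orthogonal)
  qed
  have refl_V: "reflection a x \<in> V" if "a \<in> V" "x \<in> V" for a x
    unfolding reflection_def using that by (intro subspace_diff subspace_scale V)
  have TV: "T ` V = V"
  proof
    show "T ` V \<subseteq> V" using vw V by (auto simp: T_def intro!: refl_V subspace_diff)
    show "V \<subseteq> T ` V"
    proof
      fix x assume x: "x \<in> V"
      have "x = T (reflection (v - w) (reflection w x))" by (simp add: T_def reflection_involution)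
      moreover have "reflection (v - w) (reflection w x) \<in> V"
        using x vw V by (auto intro!: refl_V subspace_diff)
      ultimately show "x \<in> T ` V" by blast
    qed
  qed
  have "T v = - w" by (simp add: T_def reflection_swap[OF vw(3)] reflection_self)
  then show ?thesis
    using that[of Q] rot fix_ orth TV by (simp add: Q rotations_of_comp_def)
qed

lemma sweep_orthogonal_image:
  fixes V :: "(real ^ 'n) set"
  assumes V: "subspace V" and T: "orthogonal_transformation T" "T ` V = V" and K: "compact K"
  shows "sweep (subspace_lborel V) (T ` K) (T u) = sweep (subspace_lborel V) K u"
proof -
  let ?\<nu> = "subspace_lborel V"
  note \<nu> = haar_on_subspace_lborel[OF V]
  have lin: "linear T" using T by (simp add: orthogonal_transformation_linear)
  have cont: "continuous_on UNIV T" using lin by (simp add: linear_continuous_on linear_conv_bounded_linear)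
  have inv: "measure ?\<nu> (T ` A) = measure ?\<nu> A" if "compact A" for A
  proof -
    have TA: "T ` A \<in> sets borel"
      using that continuous_on_subset[OF cont] by (auto intro!: borel_closed compact_imp_closed compact_continuous_image)
    have Tm: "T \<in> ?\<nu> \<rightarrow>\<^sub>M borel"
      using borel_measurable_continuous_onI[OF cont] measurable_cong_sets[OF haar_on_sets[OF \<nu>] refl] by blast
    have "measure ?\<nu> (T ` A) = measure (distr ?\<nu> borel T) (T ` A)"
      by (simp add: subspace_lborel_orthogonal[OF V T])
    also have "\<dots> = measure ?\<nu> (T -` (T ` A) \<inter> space ?\<nu>)" by (rule measure_distr[OF Tm TA])
    also have "T -` (T ` A) \<inter> space ?\<nu> = A"
      using orthogonal_transformation_inj[OF T(1)] by (auto simp: haar_on_space[OF \<nu>] inj_def)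
    finally show ?thesis .
  qed
  have "T ` K + closed_segment 0 (T u) = T ` (K + closed_segment 0 u)"
    using closed_segment_linear_image[OF lin, of 0 u] by (simp add: linear_image_set_plus[OF lin] linear_0[OF lin])
  then show ?thesis unfolding sweep_def using K by (simp add: inv compact_set_plus)
qed

lemma ennreal_le_mult_epsilon:
  fixes x y :: ennreal
  assumes "\<And>\<epsilon>::real. \<epsilon> > 0 \<Longrightarrow> x \<le> ennreal (1 + \<epsilon>) * y"
  shows "x \<le> y"
proof (cases y)
  case (real b)
  show ?thesis
  proof (rule ennreal_le_epsilon)
    fix e :: real assume e: "0 < e"
    define \<epsilon> where "\<epsilon> = e / (b + 1)"
    have \<epsilon>: "\<epsilon> > 0" using e real by (simp add: \<epsilon>_def)
    have "\<epsilon> * b \<le> e" using e real by (simp add: \<epsilon>_def field_simps)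
    have "x \<le> ennreal ((1 + \<epsilon>) * b)" using assms[OF \<epsilon>] real \<epsilon> by (simp add: ennreal_mult)
    also have "\<dots> \<le> ennreal (b + e)" using \<open>\<epsilon> * b \<le> e\<close> by (intro ennreal_leI) (simp add: algebra_simps)
    finally show "x \<le> y + ennreal e" using real e by simp
  qed
qed simp

context
  fixes V :: "(real ^ 'n) set" and \<beta> :: "(real ^ 'n) set measure"
  assumes V: "subspace V"
    and sets_\<beta>: "sets \<beta> = sets convex_ring_borel"
    and conv: "AE K in \<beta>. K \<in> convex_bodies"
    and iso: "isotropic_on_comp (V\<^sup>\<bottom>) \<beta>"
begin

lemma mean_sweep_measurable: "(\<lambda>K. ennreal (sweep (subspace_lborel V) K u)) \<in> borel_measurable \<beta>"
  using measurable_sweep[OF V] measurable_cong_sets[OF sets_\<beta> refl] by blast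

text \<open>
  Rotate \<open>v\<close> to \<open>- w\<close>, and use that the swept volume is even in the direction.
\<close>

lemma mean_sweep_eq_of_norm_eq:
  assumes vw: "v \<in> V" "w \<in> V" "norm v = norm w"
  shows "(\<integral>\<^sup>+K. ennreal (sweep (subspace_lborel V) K v) \<partial>\<beta>) = (\<integral>\<^sup>+K. ennreal (sweep (subspace_lborel V) K w) \<partial>\<beta>)"
proof (cases "v = w")
  case False
  let ?W = "\<lambda>K u. ennreal (sweep (subspace_lborel V) K u)"
  note \<nu> = haar_on_subspace_lborel[OF V]
  obtain Q where Q: "Q \<in> rotations_of_comp (V\<^sup>\<bottom>)" "orthogonal_transformation ((*v) Q)" "Q *v v = - w" "(*v) Q ` V = V"
    using rotation_to_minus[OF V vw False] by metis
  have "(\<integral>\<^sup>+K. ?W K w \<partial>\<beta>) = (\<integral>\<^sup>+K. ?W K (- w) \<partial>\<beta>)"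
    using conv by (intro nn_integral_cong_AE) (auto simp: convex_bodies_def sweep_uminus[OF \<nu> V _ vw(2)])
  also have "\<dots> = (\<integral>\<^sup>+K. ?W K (- w) \<partial>distr \<beta> convex_ring_borel ((`) ((*v) Q)))"
    using iso Q(1) by (simp add: isotropic_on_comp_def)
  also have "\<dots> = (\<integral>\<^sup>+K. ?W ((*v) Q ` K) (- w) \<partial>\<beta>)"
  proof (rule nn_integral_distr)
    show "(`) ((*v) Q) \<in> \<beta> \<rightarrow>\<^sub>M convex_ring_borel"
      using measurable_isometry_image[OF Q(2)] measurable_cong_sets[OF sets_\<beta> refl] by blast
  qed (simp add: measurable_sweep[OF V])
  also have "\<dots> = (\<integral>\<^sup>+K. ?W K v \<partial>\<beta>)"
  proof (intro nn_integral_cong_AE, use conv in eventually_elim)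
    fix K :: "(real ^ 'n) set" assume "K \<in> convex_bodies"
    then have K: "compact K" by (simp add: convex_bodies_def)
    show "?W ((*v) Q ` K) (- w) = ?W K v"
      using sweep_orthogonal_image[OF V Q(2,4) K, of v] by (simp add: Q(3))
  qed
  finally show ?thesis by simp
qed simp

lemma mean_sweep_scale:
  assumes u: "u \<in> V" "norm u = 1" and v: "v \<in> V"
  shows "(\<integral>\<^sup>+K. ennreal (sweep (subspace_lborel V) K v) \<partial>\<beta>) =
    ennreal (norm v) * (\<integral>\<^sup>+K. ennreal (sweep (subspace_lborel V) K u) \<partial>\<beta>)"
proof -
  note \<nu> = haar_on_subspace_lborel[OF V]
  have "(\<integral>\<^sup>+K. ennreal (sweep (subspace_lborel V) K v) \<partial>\<beta>) =
      (\<integral>\<^sup>+K. ennreal (sweep (subspace_lborel V) K (norm v *\<^sub>R u)) \<partial>\<beta>)"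
    using u v V by (intro mean_sweep_eq_of_norm_eq) (auto intro: subspace_scale)
  also have "\<dots> = (\<integral>\<^sup>+K. ennreal (norm v) * ennreal (sweep (subspace_lborel V) K u) \<partial>\<beta>)"
    using conv
    by (intro nn_integral_cong_AE)
       (auto simp: convex_bodies_def sweep_scaleR[OF \<nu> V _ _ u(1)] ennreal_mult sweep_nonneg[OF \<nu>])
  also have "\<dots> = ennreal (norm v) * (\<integral>\<^sup>+K. ennreal (sweep (subspace_lborel V) K u) \<partial>\<beta>)"
    by (rule nn_integral_cmult[OF mean_sweep_measurable])
  finally show ?thesis .
qed

lemma mean_sweep_sum_list:
  assumes u: "u \<in> V" "norm u = 1" and us: "set us \<subseteq> V"
  shows "(\<integral>\<^sup>+K. (\<Sum>v\<leftarrow>us. ennreal (sweep (subspace_lborel V) K v)) \<partial>\<beta>) =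
    ennreal (\<Sum>v\<leftarrow>us. norm v) * (\<integral>\<^sup>+K. ennreal (sweep (subspace_lborel V) K u) \<partial>\<beta>)"
  using us
proof (induction us)
  case (Cons v us)
  have meas: "(\<lambda>K. \<Sum>v\<leftarrow>us. ennreal (sweep (subspace_lborel V) K v)) \<in> borel_measurable \<beta>"
    by (induction us) (auto intro: borel_measurable_add mean_sweep_measurable)
  have nn: "0 \<le> (\<Sum>v\<leftarrow>us. norm v)" by (rule sum_list_nonneg) auto
  show ?case
    using Cons nn by (simp add: nn_integral_add[OF mean_sweep_measurable meas] mean_sweep_scale[OF u] ennreal_plus distrib_right)
qed simp

text \<open>
  Cauchy's surface area formula in the mean. With the zonotope sum \<open>N\<close>, the mean \<open>I\<close> of the surface
  area and the mean \<open>g\<close> of the swept volume in a unit direction, the general bounds and those for the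
  ball read \<open>I \<le> N g \<le> (1 + \<epsilon>) I\<close> and \<open>A \<le> N b \<le> (1 + \<epsilon>) A\<close>. Eliminating \<open>N\<close> and letting \<open>\<epsilon>\<close> tend
  to \<open>0\<close> gives \<open>I b = g A\<close>.
\<close>

theorem mean_surface_area_eq_mean_sweep:
  assumes m: "dim V = m" and sub: "AE K in \<beta>. K \<subseteq> V" and u: "u \<in> V" "norm u = 1"
  shows "(\<integral>\<^sup>+K\<in>{K. K \<in> convex_bodies \<and> K \<subseteq> V}. surface_area V K \<partial>\<beta>) * ennreal (unit_ball_vol (real (m - 1))) =
    (\<integral>\<^sup>+K. ennreal (sweep (subspace_lborel V) K u) \<partial>\<beta>) * ennreal (real m * unit_ball_vol (real m))"
    (is "?I * ennreal ?b = ?g * ennreal ?A")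
proof -
  note \<nu> = haar_on_subspace_lborel[OF V]
  let ?W = "\<lambda>K u. ennreal (sweep (subspace_lborel V) K u)"
  let ?f = "\<lambda>K. surface_area V K * indicator {K. K \<in> convex_bodies \<and> K \<subseteq> V} K"
  have b: "?b \<ge> 0" and A: "?A \<ge> 0" by simp_all
  have bounds: "?I \<le> ennreal N * ?g \<and> ennreal N * ?g \<le> ennreal (1 + \<epsilon>) * ?I \<and> ?A \<le> N * ?b \<and> N * ?b \<le> (1 + \<epsilon>) * ?A \<and> 0 \<le> N"
    if \<epsilon>: "\<epsilon> > 0" and us: "ball_zonotope V \<epsilon> us" and N: "N = 2 * (\<Sum>v\<leftarrow>us. norm v)" for \<epsilon> us N
  proof -
    have usV: "set us \<subseteq> V" using us by (simp add: ball_zonotope_def)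
    have N0: "0 \<le> (\<Sum>v\<leftarrow>us. norm v)" by (rule sum_list_nonneg) auto
    let ?\<sigma> = "\<lambda>K. 2 * (\<Sum>v\<leftarrow>us. ?W K v)"
    have \<sigma>_meas: "(\<lambda>K. \<Sum>v\<leftarrow>us. ?W K v) \<in> borel_measurable \<beta>"
      by (induction us) (auto intro: borel_measurable_add mean_sweep_measurable)
    have int_\<sigma>: "(\<integral>\<^sup>+K. ?\<sigma> K \<partial>\<beta>) = ennreal N * ?g"
      by (simp add: nn_integral_cmult[OF \<sigma>_meas] mean_sweep_sum_list[OF u usV] N ennreal_mult N0 mult.assoc)
    have pw: "?f K \<le> ?\<sigma> K \<and> ?\<sigma> K / ennreal (1 + \<epsilon>) \<le> ?f K" if "K \<in> convex_bodies" "K \<subseteq> V" for K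
    proof -
      have K: "compact K" "convex K" "K \<noteq> {}" using that by (auto simp: convex_bodies_def)
      obtain S where S: "(outer_quotient V (subspace_lborel V) K \<longlongrightarrow> S) (at_right 0)"
        "S \<le> 2 * (\<Sum>u\<leftarrow>us. sweep (subspace_lborel V) K u)"
        "2 * (\<Sum>u\<leftarrow>us. sweep (subspace_lborel V) K u) \<le> (1 + \<epsilon>) * S"
        using outer_quotient_tendsto[OF V \<nu> K(1,2)] us \<epsilon> by metis
      have f: "?f K = ennreal S" using surface_area_eqI[OF V K(1,3) that(2) S(1)] that by simp
      have \<sigma>: "?\<sigma> K = ennreal (2 * (\<Sum>u\<leftarrow>us. sweep (subspace_lborel V) K u))"
      proof -
        have "(\<Sum>v\<leftarrow>us. ?W K v) = ennreal (\<Sum>u\<leftarrow>us. sweep (subspace_lborel V) K u)"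
          by (rule sum_list_ennreal) (simp add: sweep_nonneg[OF \<nu> K(1)])
        moreover have "0 \<le> (\<Sum>u\<leftarrow>us. sweep (subspace_lborel V) K u)"
          by (rule sum_list_nonneg) (auto simp: sweep_nonneg[OF \<nu> K(1)])
        ultimately show ?thesis by (simp add: ennreal_mult)
      qed
      have "0 \<le> 2 * (\<Sum>u\<leftarrow>us. sweep (subspace_lborel V) K u)"
        using sum_list_nonneg[of "map (sweep (subspace_lborel V) K) us"] sweep_nonneg[OF \<nu> K(1)] by auto
      then have "?\<sigma> K / ennreal (1 + \<epsilon>) = ennreal (2 * (\<Sum>u\<leftarrow>us. sweep (subspace_lborel V) K u) / (1 + \<epsilon>))"
        unfolding \<sigma> using \<epsilon> by (intro divide_ennreal) auto
      then show ?thesis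
        unfolding f using S \<epsilon> by (auto simp only: \<sigma> intro!: ennreal_leI) (simp add: field_simps)
    qed
    have "AE K in \<beta>. ?f K \<le> ?\<sigma> K" and AE2: "AE K in \<beta>. ?\<sigma> K / ennreal (1 + \<epsilon>) \<le> ?f K"
      using conv sub by (eventually_elim, use pw in blast)+
    then have "?I \<le> (\<integral>\<^sup>+K. ?\<sigma> K \<partial>\<beta>)" by (intro nn_integral_mono_AE)
    then have 1: "?I \<le> ennreal N * ?g" by (simp only: int_\<sigma>)
    have "(\<integral>\<^sup>+K. ?\<sigma> K / ennreal (1 + \<epsilon>) \<partial>\<beta>) \<le> ?I"
      using AE2 by (rule nn_integral_mono_AE)
    moreover have "(\<integral>\<^sup>+K. ?\<sigma> K / ennreal (1 + \<epsilon>) \<partial>\<beta>) = ennreal N * ?g / ennreal (1 + \<epsilon>)"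
      using \<sigma>_meas by (subst nn_integral_divide) (auto simp: int_\<sigma>)
    ultimately have "ennreal N * ?g / ennreal (1 + \<epsilon>) \<le> ?I" by simp
    then have "ennreal (1 + \<epsilon>) * (ennreal N * ?g / ennreal (1 + \<epsilon>)) \<le> ennreal (1 + \<epsilon>) * ?I"
      by (rule mult_left_mono) simp
    moreover have "c * (x / c) = x" if "c \<noteq> 0" "c \<noteq> top" for c x :: ennreal
      using ennreal_mult_divide_eq[OF that, of x] by (simp add: ennreal_times_divide mult.commute[of c])
    from this[of "ennreal (1 + \<epsilon>)" "ennreal N * ?g"]
    have "ennreal (1 + \<epsilon>) * (ennreal N * ?g / ennreal (1 + \<epsilon>)) = ennreal N * ?g"
      using \<epsilon> by (simp add: ennreal_eq_0_iff del: ennreal_plus)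
    ultimately have 2: "ennreal N * ?g \<le> ennreal (1 + \<epsilon>) * ?I" by simp
    show ?thesis
      using 1 2 N0 ball_zonotope_mean_width[OF V m us \<epsilon>] by (simp add: N)
  qed
  show ?thesis
  proof (rule antisym; rule ennreal_le_mult_epsilon)
    fix \<epsilon> :: real assume \<epsilon>: "\<epsilon> > 0"
    obtain us where us: "ball_zonotope V \<epsilon> us" by (rule ball_zonotope_exists[OF V \<epsilon>])
    define N where "N = 2 * (\<Sum>v\<leftarrow>us. norm v)"
    note B = bounds[OF \<epsilon> us N_def]
    have "?I * ennreal ?b \<le> ennreal N * ?g * ennreal ?b" using B by (intro mult_right_mono) auto
    also have "\<dots> = ennreal (N * ?b) * ?g" using B by (simp add: ennreal_mult ac_simps)
    also have "\<dots> \<le> ennreal ((1 + \<epsilon>) * ?A) * ?g" using B by (intro mult_right_mono ennreal_leI) auto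
    also have "\<dots> = ennreal (1 + \<epsilon>) * (?g * ennreal ?A)"
      using \<epsilon> by (subst ennreal_mult[of "1 + \<epsilon>"]) (auto simp: ac_simps)
    finally show "?I * ennreal ?b \<le> ennreal (1 + \<epsilon>) * (?g * ennreal ?A)" .
    have "?g * ennreal ?A \<le> ?g * ennreal (N * ?b)" using B by (intro mult_left_mono ennreal_leI) auto
    also have "\<dots> = ennreal N * ?g * ennreal ?b" using B by (simp add: ennreal_mult ac_simps)
    also have "\<dots> \<le> ennreal (1 + \<epsilon>) * ?I * ennreal ?b" using B by (intro mult_right_mono) auto
    finally show "?g * ennreal ?A \<le> ennreal (1 + \<epsilon>) * (?I * ennreal ?b)" by (simp add: ac_simps)
  qed
qed

end

section \<open>The translates of a cylinder that hit a compact set\<close>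

text \<open>
  The points whose projection to \<open>V\<close> lies in \<open>X\<close> and whose distance from \<open>V\<close> is at most one.
\<close>

definition tube :: "'a::euclidean_space set \<Rightarrow> 'a set \<Rightarrow> 'a set" where
  "tube V X = {y. closest_point V y \<in> X \<and> norm (y - closest_point V y) \<le> 1}"

lemma closed_set_plus:
  fixes A B :: "'a::real_normed_vector set"
  assumes "compact A" "closed B" shows "closed (A + B)"
proof -
  have "A + B = (\<Union>x\<in>A. \<Union>y\<in>B. {x + y})" by (auto simp: set_plus_def)
  then show ?thesis using compact_closed_sums[OF assms] by simp
qed

context
  fixes V :: "(real ^ 'n) set"
  assumes V: "subspace V"
begin

lemma measurable_closest_point [measurable]: "closest_point V \<in> borel_measurable borel"
  using linear_continuous_on[OF linear_conv_bounded_linear[THEN iffD1, OF linear_closest_point[OF V]]]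
  by (rule borel_measurable_continuous_onI)

lemma tube_borel [measurable]: "X \<in> sets borel \<Longrightarrow> tube V X \<in> sets borel"
proof -
  assume [measurable]: "X \<in> sets borel"
  have "{y \<in> space borel. closest_point V y \<in> X \<and> norm (y - closest_point V y) \<le> 1} \<in> sets borel"
    by measurable
  then show ?thesis by (simp add: tube_def)
qed

lemma closest_point_add_mem: "v \<in> V \<Longrightarrow> closest_point V (v + y) = v + closest_point V y"
  using linear_add[OF linear_closest_point[OF V], of v y] closest_point_self[of v V] by simp

lemma tube_measure:
  obtains \<mu> where "haar_on V \<mu>" "\<And>X. X \<in> sets borel \<Longrightarrow> emeasure \<mu> X = emeasure lborel (tube V X)"
proof
  let ?A = "tube V UNIV"
  have [measurable]: "?A \<in> sets borel" by (rule tube_borel) simp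
  let ?\<mu> = "distr (density lborel (indicator ?A)) borel (closest_point V)"
  show em: "emeasure ?\<mu> X = emeasure lborel (tube V X)" if [measurable]: "X \<in> sets borel" for X
  proof -
    have vX: "closest_point V -` X \<in> sets borel" by (rule measurable_sets_borel) measurable
    have "emeasure ?\<mu> X = emeasure (density lborel (indicator ?A)) (closest_point V -` X)"
      by (subst emeasure_distr) (auto simp: that)
    also have "\<dots> = (\<integral>\<^sup>+y. indicator ?A y * indicator (closest_point V -` X) y \<partial>lborel)"
      using vX by (intro emeasure_density) auto
    also have "\<dots> = (\<integral>\<^sup>+y. indicator (tube V X) y \<partial>lborel)"
      by (intro nn_integral_cong) (auto simp: tube_def indicator_def)
    also have "\<dots> = emeasure lborel (tube V X)" by (intro nn_integral_indicator) (simp add: tube_borel that)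
    finally show ?thesis .
  qed
  show "haar_on V ?\<mu>"
    unfolding haar_on_def
  proof (intro conjI ballI allI)
    fix v assume v: "v \<in> V"
    show "distr ?\<mu> borel ((+) v) = ?\<mu>"
    proof (rule measure_eqI)
      fix X assume "X \<in> sets (distr ?\<mu> borel ((+) v))"
      then have [measurable]: "X \<in> sets borel" by simp
      have vX: "(+) v -` X \<in> sets borel" by (rule measurable_sets_borel) measurable
      have "emeasure (distr ?\<mu> borel ((+) v)) X = emeasure ?\<mu> ((+) v -` X)"
        by (subst emeasure_distr) auto
      also have "\<dots> = emeasure lborel (tube V ((+) v -` X))" by (rule em[OF vX])
      also have "tube V ((+) v -` X) = (+) v -` tube V X"
        using v by (auto simp: tube_def closest_point_add_mem)
      also have "emeasure lborel ((+) v -` tube V X) = emeasure (distr lborel borel ((+) v)) (tube V X)"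
        by (subst emeasure_distr) auto
      also have "\<dots> = emeasure ?\<mu> X" by (simp add: lborel_distr_plus em)
      finally show "emeasure (distr ?\<mu> borel ((+) v)) X = emeasure ?\<mu> X" .
    qed simp
  next
    show "AE x in ?\<mu>. x \<in> V"
      using closest_point_subspace_mem[OF V] borel_closed[OF closed_subspace[OF V]]
      by (subst AE_distr_iff) auto
  next
    fix r
    have "tube V (cball 0 r) \<subseteq> cball 0 (r + 1)"
    proof
      fix y assume "y \<in> tube V (cball 0 r)"
      then have "norm (closest_point V y) \<le> r" "norm (y - closest_point V y) \<le> 1" by (auto simp: tube_def)
      then show "y \<in> cball 0 (r + 1)"
        using norm_triangle_ineq[of "closest_point V y" "y - closest_point V y"] by simp
    qed
    then have "emeasure ?\<mu> (cball 0 r) \<le> emeasure lborel (cball 0 (r + 1) :: (real ^ 'n) set)"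
      by (subst em) (auto intro: emeasure_mono)
    also have "\<dots> < \<infinity>" by (rule emeasure_lborel_cball_finite)
    finally show "emeasure ?\<mu> (cball 0 r) < \<infinity>" .
  qed simp
qed

text \<open>
  The volume in \<open>V\<close> is expressed by the Lebesgue measure of the whole space, which does not vary with
  \<open>V\<close>: taking the volume of the tube over \<open>X\<close> is another translation-invariant measure on \<open>V\<close>, hence
  proportional. This is what makes the volume measurable in \<open>V\<close>.
\<close>

lemma emeasure_subspace_lborel_tube:
  assumes X: "X \<in> sets borel"
  shows "emeasure (subspace_lborel V) X =
    emeasure lborel (tube V X) * emeasure (subspace_lborel V) (cball 0 1) / emeasure lborel (tube V (cball 0 1))"
proof -
  obtain \<mu> where \<mu>: "haar_on V \<mu>" "\<And>X. X \<in> sets borel \<Longrightarrow> emeasure \<mu> X = emeasure lborel (tube V X)"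
    using tube_measure by blast
  let ?c = "emeasure lborel (tube V (cball 0 1))"
  have eq: "emeasure (subspace_lborel V) X * ?c = emeasure lborel (tube V X) * emeasure (subspace_lborel V) (cball 0 1)"
    using haar_on_unique[OF \<mu>(1) haar_on_subspace_lborel[OF V] subspace_lborel_uminus[OF V] X, of "cball 0 1"]
      \<mu>(2) X by simp
  have "?c = emeasure \<mu> (cball 0 1)" using \<mu>(2)[of "cball 0 1"] by simp
  also have "\<dots> < \<infinity>" using \<mu>(1) by (simp only: haar_on_def)
  finally have top: "?c \<noteq> top" by simp
  have "cball 0 (1/2) \<subseteq> tube V (cball 0 1)"
  proof
    fix y :: "real ^ 'n" assume y: "y \<in> cball 0 (1/2)"
    have "norm (closest_point V y) \<le> norm y" by (rule norm_closest_point_subspace_le[OF V])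
    then show "y \<in> tube V (cball 0 1)"
      using y norm_triangle_ineq4[of y "closest_point V y"] by (simp add: tube_def)
  qed
  then have "emeasure lborel (cball 0 (1/2) :: (real ^ 'n) set) \<le> ?c"
    by (intro emeasure_mono) (simp_all add: tube_borel)
  moreover have "emeasure lborel (cball 0 (1/2) :: (real ^ 'n) set) \<noteq> 0"
  proof -
    have "measure lborel (cball 0 (1/2) :: (real ^ 'n) set) > 0" by (simp add: content_cball_pos)
    then show ?thesis by (auto simp: measure_def)
  qed
  ultimately have "?c \<noteq> 0" by auto
  then show ?thesis using eq top ennreal_mult_divide_eq[of ?c "emeasure (subspace_lborel V) X"] by simp
qed

end

text \<open>
  For a base \<open>K\<close> and a direction space \<open>\<xi>\<close>, the set of \<open>x\<close> such that \<open>x + K + \<xi>\<close> meets \<open>C\<close>; see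
  \<open>translate_hits_iff\<close> below.
\<close>

definition hitting_positions :: "(real ^ 'n) set \<Rightarrow> (real ^ 'n) set \<Rightarrow> (real ^ 'n) set \<Rightarrow> (real ^ 'n) set" where
  "hitting_positions C \<xi> K = (C + uminus ` K) + \<xi>"

definition hitting_measure :: "(real ^ 'n) set \<Rightarrow> (real ^ 'n) set \<Rightarrow> (real ^ 'n) set \<Rightarrow> ennreal" where
  "hitting_measure C \<xi> K = emeasure (subspace_lborel (\<xi>\<^sup>\<bottom>)) (hitting_positions C \<xi> K)"

lemma infdist_subspace:
  assumes "subspace \<xi>" shows "infdist y \<xi> = norm (y - closest_point \<xi> (y :: 'a::euclidean_space))"
proof (rule antisym)
  show "infdist y \<xi> \<le> norm (y - closest_point \<xi> y)"
    using infdist_le[OF closest_point_subspace_mem[OF assms], of y y] by (simp add: dist_norm)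
  obtain z where "z \<in> \<xi>" "infdist y \<xi> = dist y z"
    using infdist_attains_inf[OF closed_subspace[OF assms]] subspace_0[OF assms] by (metis empty_iff)
  then show "norm (y - closest_point \<xi> y) \<le> infdist y \<xi>"
    using closest_point_le[OF closed_subspace[OF assms], of z y] by (simp add: dist_norm)
qed

lemma norm_closest_point_Pythagoras:
  assumes "subspace \<xi>" shows "(norm (closest_point \<xi> (y :: 'a::euclidean_space)))\<^sup>2 = (norm y)\<^sup>2 - (infdist y \<xi>)\<^sup>2"
proof -
  let ?p = "closest_point \<xi> y"
  have "y \<bullet> ?p = ?p \<bullet> ?p"
    using closest_point_subspace_inner[OF assms closest_point_subspace_mem[OF assms], of y y] by (simp add: inner_diff_left)
  then show ?thesis
    by (simp add: infdist_subspace[OF assms] power2_norm_eq_inner inner_diff_left inner_diff_right inner_commute)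
qed

lemma hitting_positions_closed: "compact C \<Longrightarrow> \<xi> \<in> grassmannian k \<Longrightarrow> K \<in> convex_ring \<Longrightarrow> closed (hitting_positions C \<xi> K)"
  unfolding hitting_positions_def
  by (rule closed_set_plus[OF compact_set_plus[OF _ compact_negations[OF convex_ring_compact]]])
     (auto simp: grassmannian_def closed_subspace)

lemma tube_hitting_positions:
  assumes \<xi>: "subspace \<xi>"
  shows "tube (\<xi>\<^sup>\<bottom>) (hitting_positions C \<xi> K) = {y. y \<in> hitting_positions C \<xi> K \<and> norm (closest_point \<xi> y) \<le> 1}"
proof -
  have "closest_point (\<xi>\<^sup>\<bottom>) y \<in> hitting_positions C \<xi> K \<longleftrightarrow> y \<in> hitting_positions C \<xi> K" for y
  proof -
    have inv: "a + v \<in> hitting_positions C \<xi> K" if "a \<in> hitting_positions C \<xi> K" "v \<in> \<xi>" for a v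
    proof -
      have "a \<in> (C + uminus ` K) + \<xi>" using that(1) by (simp add: hitting_positions_def)
      then obtain b w where bw: "a = b + w" "b \<in> C + uminus ` K" "w \<in> \<xi>" by (rule set_plus_elim)
      have "b + (w + v) \<in> (C + uminus ` K) + \<xi>"
        using bw that(2) by (intro set_plus_intro subspace_add[OF \<xi>])
      then show ?thesis by (simp add: hitting_positions_def bw(1) add.assoc)
    qed
    have p: "closest_point \<xi> y \<in> \<xi>" "- closest_point \<xi> y \<in> \<xi>"
      using closest_point_subspace_mem[OF \<xi>] subspace_neg[OF \<xi>] by auto
    show ?thesis
      unfolding closest_point_orthogonal_comp[OF \<xi>]
      using inv[of y "- closest_point \<xi> y"] inv[of "y - closest_point \<xi> y" "closest_point \<xi> y"] p by auto
  qed
  then show ?thesis unfolding tube_def by (simp add: closest_point_orthogonal_comp[OF \<xi>])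
qed

text \<open>
  The tube over the hitting positions is cut out by membership in a random closed set and by a
  distance, both of which are measurable in \<open>\<xi>\<close>, \<open>K\<close> and the point; the volume of its section is
  then measurable by Fubini's theorem.
\<close>

lemma hitting_measure_measurable:
  fixes C :: "(real ^ 'n) set"
  assumes C: "compact C" "C \<noteq> {}"
  shows
  "(\<lambda>(\<xi>, K). hitting_measure C \<xi> K) \<in> borel_measurable (grassmannian_borel k \<Otimes>\<^sub>M convex_ring_borel)"
proof -
  let ?G = "grassmannian_borel k \<Otimes>\<^sub>M convex_ring_borel :: ((real ^ 'n) set \<times> (real ^ 'n) set) measure"
  let ?H = "?G \<Otimes>\<^sub>M (lborel :: (real ^ 'n) measure)"
  have sp: "fst (fst p) \<in> grassmannian k \<and> snd (fst p) \<in> convex_ring" if "p \<in> space ?H" for p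
    using that by (auto simp: space_pair_measure space_grassmannian_borel space_convex_ring_borel)
  have ne: "\<xi> \<noteq> {}" "subspace \<xi>" if "\<xi> \<in> grassmannian k" for \<xi> :: "(real ^ 'n) set"
    using that subspace_0 by (auto simp: grassmannian_def)
  have Hxi: "hit_measurable ?H (\<lambda>p. fst (fst p))"
    by (rule hit_measurable_compose[OF hit_measurable_grassmannian[of k]]) simp
  have HK: "hit_measurable ?H (\<lambda>p. snd (fst p))"
    by (rule hit_measurable_compose[OF hit_measurable_convex_ring]) simp
  have HW: "hit_measurable ?H (\<lambda>p. hitting_positions C (fst (fst p)) (snd (fst p)))"
    unfolding hitting_positions_def
    by (intro hit_measurable_plus hit_measurable_const hit_measurable_image HK Hxi continuous_intros)
  have [measurable]: "(\<lambda>p. infdist (snd p) (fst (fst p))) \<in> borel_measurable ?H"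
    by (rule hit_measurable_infdist[OF Hxi]) (use sp ne in auto)
  have mem: "{p \<in> space ?H. snd p \<in> hitting_positions C (fst (fst p)) (snd (fst p))} \<in> sets ?H"
  proof (rule hit_measurable_mem[OF HW])
    fix p assume p: "p \<in> space ?H"
    obtain c x y where "c \<in> C" "x \<in> snd (fst p)" "y \<in> fst (fst p)"
      using sp[OF p] ne(1) C convex_ring_nonempty[of "snd (fst p)"] by blast
    then have "(c + - x) + y \<in> hitting_positions C (fst (fst p)) (snd (fst p))"
      unfolding hitting_positions_def by (intro set_plus_intro imageI)
    then show "hitting_positions C (fst (fst p)) (snd (fst p)) \<noteq> {}" by blast
    show "closed (hitting_positions C (fst (fst p)) (snd (fst p)))"
      using sp[OF p] by (auto intro: hitting_positions_closed[OF C(1)])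
  qed simp
  have pred: "norm (closest_point \<xi> y) \<le> 1 \<longleftrightarrow> (norm y)\<^sup>2 - (infdist y \<xi>)\<^sup>2 \<le> 1" if "\<xi> \<in> grassmannian k" for \<xi> and y :: "real ^ 'n"
    unfolding norm_closest_point_Pythagoras[OF ne(2)[OF that], symmetric] by (simp add: abs_square_le_1)
  have "{p \<in> space ?H. (norm (snd p))\<^sup>2 - (infdist (snd p) (fst (fst p)))\<^sup>2 \<le> 1} \<in> sets ?H"
    by measurable
  then have Q1: "{p \<in> space ?H. snd p \<in> hitting_positions C (fst (fst p)) (snd (fst p))} \<inter>
      {p \<in> space ?H. (norm (snd p))\<^sup>2 - (infdist (snd p) (fst (fst p)))\<^sup>2 \<le> 1} \<in> sets ?H" (is "?Q1 \<in> _")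
    using mem by blast
  have Q2: "{p \<in> space ?H. infdist (snd p) (fst (fst p)) \<le> 1 \<and>
      (norm (snd p))\<^sup>2 - (infdist (snd p) (fst (fst p)))\<^sup>2 \<le> 1} \<in> sets ?H" (is "?Q2 \<in> _")
    by measurable
  note m1 = sigma_finite_measure.measurable_emeasure_Pair[OF sigma_finite_lborel Q1]
  note m2 = sigma_finite_measure.measurable_emeasure_Pair[OF sigma_finite_lborel Q2]
  let ?c = "ennreal (unit_ball_vol (real (CARD('n) - k)))"
  have "(\<lambda>p. emeasure lborel (Pair p -` ?Q1) * ?c / emeasure lborel (Pair p -` ?Q2)) \<in> borel_measurable ?G"
    using m1 m2 by (intro borel_measurable_divide_ennreal borel_measurable_times_ennreal) auto
  moreover have "(case p of (\<xi>, K) \<Rightarrow> hitting_measure C \<xi> K) =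
      emeasure lborel (Pair p -` ?Q1) * ?c / emeasure lborel (Pair p -` ?Q2)" if p: "p \<in> space ?G" for p
  proof -
    obtain \<xi> K where pe: "p = (\<xi>, K)" by (cases p)
    have \<xi>: "\<xi> \<in> grassmannian k" and K: "K \<in> convex_ring"
      using p by (auto simp: pe space_pair_measure space_grassmannian_borel space_convex_ring_borel)
    have s: "subspace \<xi>" "dim \<xi> = k" using \<xi> by (auto simp: grassmannian_def)
    have V: "subspace (\<xi>\<^sup>\<bottom>)" by (rule subspace_orthogonal_comp)
    have dimV: "dim (\<xi>\<^sup>\<bottom>) = CARD('n) - k"
      using dim_subspace_orthogonal_to_vectors[OF s(1) subspace_UNIV subset_UNIV] s(2)
      by (simp add: orthogonal_comp_def)
    have X: "hitting_positions C \<xi> K \<in> sets borel" by (intro borel_closed hitting_positions_closed[OF C(1) \<xi> K])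
    have t1: "tube (\<xi>\<^sup>\<bottom>) (hitting_positions C \<xi> K) = Pair p -` ?Q1"
      unfolding tube_hitting_positions[OF s(1)] pred[OF \<xi>] using \<xi> K
      by (auto simp: pe space_pair_measure space_grassmannian_borel space_convex_ring_borel)
    have "tube (\<xi>\<^sup>\<bottom>) (cball 0 1) = {y. infdist y \<xi> \<le> 1 \<and> norm (closest_point \<xi> y) \<le> 1}"
      by (auto simp: tube_def closest_point_orthogonal_comp[OF s(1)] infdist_subspace[OF s(1)])
    then have t2: "tube (\<xi>\<^sup>\<bottom>) (cball 0 1) = Pair p -` ?Q2"
      unfolding pred[OF \<xi>] using \<xi> K
      by (auto simp: pe space_pair_measure space_grassmannian_borel space_convex_ring_borel)
    show ?thesis
      using emeasure_subspace_lborel_tube[OF V X] emeasure_subspace_lborel_cball[OF V, of 1]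
      by (simp add: pe hitting_measure_def dimV t1[unfolded pe] t2[unfolded pe])
  qed
  ultimately show ?thesis by (subst measurable_cong) auto
qed

text \<open>
  Intersecting \<open>A + \<xi>\<close> with \<open>\<xi>\<^sup>\<bottom>\<close> is projecting \<open>A\<close> to \<open>\<xi>\<^sup>\<bottom>\<close>.
\<close>

lemma orthogonal_comp_Int_plus:
  assumes \<xi>: "subspace \<xi>" and A: "\<And>a. a \<in> A \<Longrightarrow> closest_point (\<xi>\<^sup>\<bottom>) a \<in> B" and B: "B \<subseteq> A + \<xi>" "B \<subseteq> \<xi>\<^sup>\<bottom>"
  shows "(A + \<xi>) \<inter> \<xi>\<^sup>\<bottom> = (B :: 'a::euclidean_space set)"
proof
  show "(A + \<xi>) \<inter> \<xi>\<^sup>\<bottom> \<subseteq> B"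
  proof
    fix x assume x: "x \<in> (A + \<xi>) \<inter> \<xi>\<^sup>\<bottom>"
    then obtain a w where aw: "x = a + w" "a \<in> A" "w \<in> \<xi>" by (auto simp: set_plus_def)
    have V: "subspace (\<xi>\<^sup>\<bottom>)" by (rule subspace_orthogonal_comp)
    have "closest_point (\<xi>\<^sup>\<bottom>) a = x"
      using x aw by (intro closest_point_subspace_unique[OF V]) (auto simp: orthogonal_comp_def orthogonal_def inner_commute)
    then show "x \<in> B" using A aw by metis
  qed
qed (use B in auto)

text \<open>
  Within \<open>\<xi>\<^sup>\<bottom>\<close> the hitting positions of the segment are \<open>P [0, v] - K\<close>, which is the reflection of \<open>K\<close> swept
  along \<open>- P v\<close>.
\<close>

lemma hitting_measure_point_segment:
  fixes \<xi> K :: "(real ^ 'n) set"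
  assumes \<xi>: "subspace \<xi>" and K: "compact K" "K \<subseteq> \<xi>\<^sup>\<bottom>"
  shows "hitting_measure {0} \<xi> K = emeasure (subspace_lborel (\<xi>\<^sup>\<bottom>)) K"
    and "hitting_measure (closed_segment 0 v) \<xi> K =
      emeasure (subspace_lborel (\<xi>\<^sup>\<bottom>)) K + ennreal (sweep (subspace_lborel (\<xi>\<^sup>\<bottom>)) K (closest_point (\<xi>\<^sup>\<bottom>) v))"
proof -
  let ?V = "\<xi>\<^sup>\<bottom>" let ?\<nu> = "subspace_lborel (\<xi>\<^sup>\<bottom>)" let ?P = "closest_point (\<xi>\<^sup>\<bottom>)"
  have V: "subspace ?V" by (rule subspace_orthogonal_comp)
  note \<nu> = haar_on_subspace_lborel[OF V]
  have seg: "hitting_measure (closed_segment 0 v) \<xi> K = emeasure ?\<nu> (K + closed_segment 0 (- ?P v))" for v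
  proof -
    let ?B = "uminus ` (K + closed_segment 0 (- ?P v))"
    have Beq: "?B = closed_segment 0 (?P v) + uminus ` K"
    proof -
      have "uminus ` closed_segment 0 (- ?P v) = closed_segment 0 (?P v)"
        using closed_segment_linear_image[OF linear_uminus, of 0 "- ?P v"] by simp
      then show ?thesis by (simp add: linear_image_set_plus[OF linear_uminus] add.commute)
    qed
    have Pseg: "?P ` closed_segment 0 v = closed_segment 0 (?P v)"
      using closed_segment_linear_image[OF linear_closest_point[OF V], of 0 v] linear_0[OF linear_closest_point[OF V]] by simp
    have segV: "closed_segment 0 (?P v) \<subseteq> ?V"
      using closest_point_subspace_mem[OF V] subspace_0[OF V]
      by (intro closed_segment_subset subspace_imp_convex V) auto
    have int: "hitting_positions (closed_segment 0 v) \<xi> K \<inter> ?V = ?B"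
      unfolding hitting_positions_def
    proof (rule orthogonal_comp_Int_plus[OF \<xi>])
      fix a assume "a \<in> closed_segment 0 v + uminus ` K"
      then obtain s y where a: "a = s - y" "s \<in> closed_segment 0 v" "y \<in> K" by (auto simp: set_plus_def)
      have "?P a = ?P s - y"
        using linear_diff[OF linear_closest_point[OF V], of s y] a K closest_point_self[of y ?V] by auto
      moreover have "?P s \<in> closed_segment 0 (?P v)" using Pseg a by auto
      ultimately show "?P a \<in> ?B" unfolding Beq using a set_plus_intro[of "?P s" _ "- y"] by force
    next
      show "?B \<subseteq> ?V"
        unfolding Beq using segV K by (auto simp: set_plus_def intro!: subspace_diff[OF V])
      show "?B \<subseteq> closed_segment 0 v + uminus ` K + \<xi>"
      proof
        fix b assume "b \<in> ?B"
        then obtain s y where b: "b = ?P s - y" "s \<in> closed_segment 0 v" "y \<in> K"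
          unfolding Beq Pseg[symmetric] by (auto simp: set_plus_def)
        have "s - ?P s \<in> \<xi>"
          using closest_point_orthogonal_comp[OF \<xi>, of s] closest_point_subspace_mem[OF \<xi>, of s] by simp
        then have "- (s - ?P s) \<in> \<xi>" by (rule subspace_neg[OF \<xi>])
        then have "(s + - y) + - (s - ?P s) \<in> closed_segment 0 v + uminus ` K + \<xi>"
          by (intro set_plus_intro imageI b)
        then show "b \<in> closed_segment 0 v + uminus ` K + \<xi>" by (simp add: b)
      qed
    qed
    have cB: "compact (K + closed_segment 0 (- ?P v))" by (intro compact_set_plus K) simp
    have Xb: "hitting_positions (closed_segment 0 v) \<xi> K \<in> sets borel"
      unfolding hitting_positions_def
      by (intro borel_closed closed_set_plus compact_set_plus compact_negations closed_subspace \<xi> K) simp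
    have "hitting_measure (closed_segment 0 v) \<xi> K = emeasure ?\<nu> ?B"
      unfolding hitting_measure_def
    proof (rule emeasure_eq_AE)
      have "AE x in ?\<nu>. x \<in> ?V" using \<nu> by (simp add: haar_on_def)
      then show "AE x in ?\<nu>. x \<in> hitting_positions (closed_segment 0 v) \<xi> K \<longleftrightarrow> x \<in> ?B"
        unfolding int[symmetric] by eventually_elim auto
      show "?B \<in> sets ?\<nu>"
        unfolding haar_on_sets[OF \<nu>] by (intro borel_closed compact_imp_closed compact_negations cB)
    qed (simp add: haar_on_sets[OF \<nu>] Xb)
    also have "\<dots> = emeasure (distr ?\<nu> borel uminus) ?B" by (simp add: subspace_lborel_uminus[OF V])
    also have "\<dots> = emeasure ?\<nu> (uminus -` ?B \<inter> space ?\<nu>)"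
    proof (rule emeasure_distr)
      show "uminus \<in> ?\<nu> \<rightarrow>\<^sub>M borel"
        unfolding measurable_cong_sets[OF haar_on_sets[OF \<nu>] refl] by simp
    qed (intro borel_closed compact_imp_closed compact_negations cB)
    also have "uminus -` ?B \<inter> space ?\<nu> = K + closed_segment 0 (- ?P v)"
      unfolding haar_on_space[OF \<nu>] Int_UNIV_right by (rule inj_vimage_image_eq) (simp add: inj_def)
    finally show ?thesis .
  qed
  show "hitting_measure {0} \<xi> K = emeasure ?\<nu> K"
  proof -
    have "K + {0} = K" by (auto simp: set_plus_def)
    then show ?thesis using seg[of 0] linear_0[OF linear_closest_point[OF V]] by simp
  qed
  let ?u = "?P v"
  have "emeasure ?\<nu> (K + closed_segment 0 (- ?u)) = ennreal (measure ?\<nu> K + sweep ?\<nu> K (- ?u))"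
    using haar_emeasure_eq[OF \<nu>, of "K + closed_segment 0 (- ?u)"] compact_set_plus[OF K(1)]
    by (simp add: sweep_def)
  also have "\<dots> = emeasure ?\<nu> K + ennreal (sweep ?\<nu> K ?u)"
    using sweep_uminus[OF \<nu> V K(1) closest_point_subspace_mem[OF V]] sweep_nonneg[OF \<nu> K(1)]
    by (simp add: haar_emeasure_eq[OF \<nu> K(1)] ennreal_plus)
  finally show "hitting_measure (closed_segment 0 v) \<xi> K = emeasure ?\<nu> K + ennreal (sweep ?\<nu> K ?u)"
    by (simp add: seg)
qed

section \<open>Void probabilities of the Poisson cylinder process\<close>

lemma cylinder_decompose:
  fixes Z :: "(real ^ 'n) set"
  assumes "Z \<in> cylinders k"
  shows "cylinder_direction Z \<in> grassmannian k" "cylinder_base Z \<in> convex_ring"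
    "cylinder_base Z \<subseteq> (cylinder_direction Z)\<^sup>\<bottom>" "Z = cylinder_base Z + cylinder_direction Z"
proof -
  obtain K \<xi> where Z: "Z = K + \<xi>" "\<xi> \<in> grassmannian k" "K \<in> convex_ring" "K \<subseteq> \<xi>\<^sup>\<bottom>"
    using assms unfolding cylinders_def by blast
  have s: "subspace \<xi>" using Z(2) by (simp add: grassmannian_def)
  have "cylinder_direction Z = \<xi>" "cylinder_base Z = K"
    unfolding Z(1) by (rule cylinder_direction_eq[OF s Z(3,4)], rule cylinder_base_eq[OF s Z(3,4)])
  then show "cylinder_direction Z \<in> grassmannian k" "cylinder_base Z \<in> convex_ring"
    "cylinder_base Z \<subseteq> (cylinder_direction Z)\<^sup>\<bottom>" "Z = cylinder_base Z + cylinder_direction Z"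
    using Z by simp_all
qed

lemma space_cylinder_borel: "space (cylinder_borel k) = cylinders k"
  by (simp add: cylinder_borel_def)

lemma measurable_cylinder_pair:
  "(\<lambda>Z. (cylinder_direction Z, cylinder_base Z)) \<in> cylinder_borel k \<rightarrow>\<^sub>M grassmannian_borel k \<Otimes>\<^sub>M convex_ring_borel"
  unfolding cylinder_borel_def
  by (rule measurable_vimage_algebra1)
     (auto simp: space_pair_measure space_grassmannian_borel space_convex_ring_borel cylinder_decompose)

lemma cylinder_closed: "Z \<in> cylinders k \<Longrightarrow> closed (Z :: (real ^ 'n) set)"
  using cylinder_decompose[of Z k] closed_set_plus[of "cylinder_base Z" "cylinder_direction Z"]
    convex_ring_compact[of "cylinder_base Z"] closed_subspace[of "cylinder_direction Z"]
  by (simp add: grassmannian_def)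

lemma cylinder_nonempty: "Z \<in> cylinders k \<Longrightarrow> Z \<noteq> {}"
proof -
  assume Z: "Z \<in> cylinders k"
  obtain y where "y \<in> cylinder_base Z" using convex_ring_nonempty[OF cylinder_decompose(2)[OF Z]] by blast
  moreover have "0 \<in> cylinder_direction Z"
    using cylinder_decompose(1)[OF Z] by (simp add: grassmannian_def subspace_0)
  ultimately have "y + 0 \<in> Z" by (subst cylinder_decompose(4)[OF Z]) (rule set_plus_intro)
  then show ?thesis by blast
qed

lemma hit_measurable_cylinder: "hit_measurable (cylinder_borel k) (\<lambda>Z :: (real ^ 'n) set. Z)"
proof -
  have "hit_measurable (cylinder_borel k :: (real ^ 'n) set measure) (\<lambda>Z. cylinder_base Z + cylinder_direction Z)"
    using measurable_compose[OF measurable_cylinder_pair measurable_snd]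
      measurable_compose[OF measurable_cylinder_pair measurable_fst]
    by (intro hit_measurable_plus hit_measurable_compose[OF hit_measurable_convex_ring]
        hit_measurable_compose[OF hit_measurable_grassmannian]) simp_all
  moreover have "{Z \<in> cylinders k. (cylinder_base Z + cylinder_direction Z) \<inter> U \<noteq> {}} =
      {Z \<in> cylinders k. Z \<inter> U \<noteq> {}}" for U :: "(real ^ 'n) set"
    by (intro Collect_cong conj_cong refl) (simp add: cylinder_decompose(4)[of _ k, symmetric])
  ultimately show ?thesis by (simp add: hit_measurable_def space_cylinder_borel)
qed

lemma hitting_cylinders_sets:
  fixes C :: "(real ^ 'n) set"
  assumes C: "compact C" "C \<noteq> {}"
  shows "hitting_cylinders k C \<in> sets (cylinder_borel k)"
proof -
  have eq: "hitting_cylinders k C = {Z \<in> space (cylinder_borel k). 0 \<in> Z + uminus ` C}"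
  proof -
    have "Z \<inter> C \<noteq> {} \<longleftrightarrow> 0 \<in> Z + uminus ` C" for Z :: "(real ^ 'n) set"
      by (auto simp: set_plus_def)
    then show ?thesis by (simp add: hitting_cylinders_def space_cylinder_borel)
  qed
  show ?thesis
    unfolding eq
  proof (rule hit_measurable_mem)
    show "hit_measurable (cylinder_borel k) (\<lambda>Z. Z + uminus ` C)"
      by (intro hit_measurable_plus hit_measurable_cylinder hit_measurable_const)
    fix Z :: "(real ^ 'n) set" assume "Z \<in> space (cylinder_borel k)"
    then have Z: "Z \<in> cylinders k" by (simp add: space_cylinder_borel)
    show "Z + uminus ` C \<noteq> {}" using cylinder_nonempty[OF Z] C by (auto simp: set_plus_def)
    have "closed (uminus ` C + Z)" by (intro closed_set_plus compact_negations C cylinder_closed[OF Z])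
    then show "closed (Z + uminus ` C)" by (simp add: add.commute)
  qed simp
qed

text \<open>
  Cylinders are closed, so two of them are distinguished by hitting a basic open set or not.
\<close>

lemma countable_separating_cylinders:
  obtains \<G> :: "(real ^ 'n) set set set"
  where "countable \<G>" "\<G> \<subseteq> sets (cylinder_borel k)"
    "\<And>Z Z'. Z \<in> cylinders k \<Longrightarrow> Z' \<in> cylinders k \<Longrightarrow> (\<forall>G\<in>\<G>. Z \<in> G \<longleftrightarrow> Z' \<in> G) \<Longrightarrow> Z = Z'"
proof -
  obtain \<B> :: "(real ^ 'n) set set" where \<B>: "countable \<B>" "topological_basis \<B>"
    using ex_countable_basis by blast
  let ?H = "\<lambda>B. {Z \<in> cylinders k. Z \<inter> B \<noteq> {}}"
  have sub: "Z \<subseteq> Z'" if ZZ': "Z \<in> cylinders k" "Z' \<in> cylinders k" "\<forall>G\<in>?H ` \<B>. Z \<in> G \<longleftrightarrow> Z' \<in> G" for Z Z'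
  proof (rule ccontr)
    assume "\<not> Z \<subseteq> Z'"
    then obtain x where x: "x \<in> Z" "x \<in> - Z'" by blast
    obtain B where B: "B \<in> \<B>" "x \<in> B" "B \<subseteq> - Z'"
      using topological_basisE[OF \<B>(2) open_Compl[OF cylinder_closed[OF ZZ'(2)]] x(2)] by auto
    have "Z \<in> ?H B" using ZZ'(1) x(1) B(2) by auto
    moreover have "Z' \<notin> ?H B" using B(3) by auto
    ultimately show False using bspec[OF ZZ'(3) imageI[OF B(1), of ?H]] by simp
  qed
  show ?thesis
  proof
    show "countable (?H ` \<B>)" using \<B>(1) by simp
    show "?H ` \<B> \<subseteq> sets (cylinder_borel k)"
      using hit_measurable_cylinder[of k] topological_basis_open[OF \<B>(2)]
      by (auto simp: hit_measurable_def space_cylinder_borel)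
    show "Z = Z'" if "Z \<in> cylinders k" "Z' \<in> cylinders k" "\<forall>G\<in>?H ` \<B>. Z \<in> G \<longleftrightarrow> Z' \<in> G" for Z Z'
    proof (rule equalityI[OF sub[OF that] sub[OF that(2,1)]], rule ballI)
      fix G assume "G \<in> ?H ` \<B>"
      from bspec[OF that(3) this] show "Z' \<in> G \<longleftrightarrow> Z \<in> G" by (rule sym)
    qed
  qed
qed

text \<open>
  Among the measurable subsets of \<open>A\<close> of positive measure one, \<open>B\<close>, has the least value. Every set of
  \<open>\<G>\<close> meets \<open>B\<close> in a null set or contains \<open>B\<close> up to a null set, because both parts cannot have a smaller
  positive integer value. Removing these countably many null sets leaves points that \<open>\<G>\<close> does not
  separate, that is, a single point.
\<close>

lemma integer_valued_measure_atom:
  assumes int: "\<And>A. A \<in> sets \<mu> \<Longrightarrow> emeasure \<mu> A \<in> range ennreal_of_enat"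
    and A: "A \<in> sets \<mu>" "emeasure \<mu> A < \<infinity>" "emeasure \<mu> A \<noteq> 0"
    and \<G>: "countable \<G>" "\<G> \<subseteq> sets \<mu>"
    and sep: "\<And>z z'. z \<in> A \<Longrightarrow> z' \<in> A \<Longrightarrow> (\<forall>G\<in>\<G>. z \<in> G \<longleftrightarrow> z' \<in> G) \<Longrightarrow> z = z'"
  obtains z where "z \<in> A" "emeasure \<mu> {z} > 0"
proof -
  let ?P = "\<lambda>B. B \<in> sets \<mu> \<and> B \<subseteq> A \<and> emeasure \<mu> B \<noteq> 0"
  have nat: "\<exists>n::nat. emeasure \<mu> B = of_nat n" if PB: "?P B" for B
  proof -
    obtain e where e: "emeasure \<mu> B = ennreal_of_enat e" using int[of B] PB by blast
    have "emeasure \<mu> B \<le> emeasure \<mu> A" using that A(1) by (intro emeasure_mono) simp_all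
    then have "emeasure \<mu> B < \<infinity>" using A(2) by (rule le_less_trans)
    then show ?thesis using e by (cases e) auto
  qed
  define m where "m B = (SOME n::nat. emeasure \<mu> B = of_nat n)" for B
  have m: "emeasure \<mu> B = of_nat (m B)" if "?P B" for B
    unfolding m_def by (rule someI_ex[OF nat[OF that]])
  obtain B where B: "?P B" and min: "\<And>B'. ?P B' \<Longrightarrow> m B \<le> m B'"
    using ex_has_least_nat[of ?P A m] A by auto
  have null: "emeasure \<mu> (B \<inter> G) = 0 \<or> emeasure \<mu> (B - G) = 0" if G: "G \<in> sets \<mu>" for G
  proof (rule ccontr)
    assume *: "\<not> ?thesis"
    have 1: "?P (B \<inter> G)" "?P (B - G)" using * B G by auto
    have "emeasure \<mu> (B \<inter> G) + emeasure \<mu> (B - G) = emeasure \<mu> ((B \<inter> G) \<union> (B - G))"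
      using B G by (intro plus_emeasure) blast+
    also have "(B \<inter> G) \<union> (B - G) = B" by blast
    finally have "emeasure \<mu> B = emeasure \<mu> (B \<inter> G) + emeasure \<mu> (B - G)" by simp
    then have "(of_nat (m B) :: ennreal) = of_nat (m (B \<inter> G) + m (B - G))"
      using m[OF B] m[OF 1(1)] m[OF 1(2)] by simp
    then have "m B = m (B \<inter> G) + m (B - G)" by (simp only: of_nat_eq_iff)
    moreover have "m (B - G) \<noteq> 0" using m[OF 1(2)] 1(2) by (metis of_nat_0)
    ultimately show False using min[OF 1(1)] by simp
  qed
  define N where "N G = (if emeasure \<mu> (B \<inter> G) = 0 then B \<inter> G else B - G)" for G
  have N: "N G \<in> null_sets \<mu>" if "G \<in> \<G>" for G
    using null[of G] that \<G>(2) B by (auto simp: N_def null_sets_def)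
  have "(\<Union>G\<in>\<G>. N G) \<in> null_sets \<mu>" using N \<G>(1) by (intro null_sets_UN') auto
  then have B': "emeasure \<mu> (B - (\<Union>G\<in>\<G>. N G)) = emeasure \<mu> B"
    using B by (intro emeasure_Diff_null_set) auto
  then have "B - (\<Union>G\<in>\<G>. N G) \<noteq> {}" using B by (metis emeasure_empty)
  then obtain z where z: "z \<in> B - (\<Union>G\<in>\<G>. N G)" by blast
  have "B - (\<Union>G\<in>\<G>. N G) = {z}"
  proof -
    have "z' = z" if z': "z' \<in> B - (\<Union>G\<in>\<G>. N G)" for z'
    proof (rule sep)
      show "z' \<in> A" "z \<in> A" using z z' B by auto
      show "\<forall>G\<in>\<G>. z' \<in> G \<longleftrightarrow> z \<in> G"
      proof
        fix G assume G: "G \<in> \<G>"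
        have "z \<in> B - N G" "z' \<in> B - N G" using z z' G by auto
        then show "z' \<in> G \<longleftrightarrow> z \<in> G" by (cases "emeasure \<mu> (B \<inter> G) = 0") (auto simp: N_def)
      qed
    qed
    then show ?thesis using z by blast
  qed
  then have "emeasure \<mu> {z} \<noteq> 0" using B' B by simp
  moreover have "z \<in> A" using z B by auto
  ultimately show ?thesis using that zero_less_iff_neq_zero by blast
qed

lemma union_set_hits_iff:
  fixes C :: "(real ^ 'n) set"
  assumes \<mu>: "\<mu> \<in> counting_measures k" and C: "compact C" "C \<noteq> {}"
  shows "union_set \<mu> \<inter> C \<noteq> {} \<longleftrightarrow> emeasure \<mu> (hitting_cylinders k C) \<noteq> 0"
proof
  have sets: "sets \<mu> = sets (cylinder_borel k)"
    and fin: "emeasure \<mu> (hitting_cylinders k C) < \<infinity>"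
    and int: "\<And>A. A \<in> sets \<mu> \<Longrightarrow> emeasure \<mu> A \<in> range ennreal_of_enat"
    using \<mu> C by (auto simp: counting_measures_def locally_finite_on_cylinders_def)
  have hit: "hitting_cylinders k C \<in> sets \<mu>" using hitting_cylinders_sets[OF C] sets by simp
  show "emeasure \<mu> (hitting_cylinders k C) \<noteq> 0" if hits: "union_set \<mu> \<inter> C \<noteq> {}"
  proof -
    obtain Z where Z: "emeasure \<mu> {Z} > 0" "Z \<inter> C \<noteq> {}" using hits unfolding union_set_def by blast
    then have "{Z} \<in> sets \<mu>" using emeasure_notin_sets by fastforce
    then have "Z \<in> space \<mu>" using sets.sets_into_space by blast
    then have "Z \<in> cylinders k" using sets_eq_imp_space_eq[OF sets] by (simp add: space_cylinder_borel)
    then have "{Z} \<subseteq> hitting_cylinders k C" using Z by (simp add: hitting_cylinders_def)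
    then have "emeasure \<mu> {Z} \<le> emeasure \<mu> (hitting_cylinders k C)" by (rule emeasure_mono[OF _ hit])
    then show ?thesis using Z by auto
  qed
  show "union_set \<mu> \<inter> C \<noteq> {}" if nz: "emeasure \<mu> (hitting_cylinders k C) \<noteq> 0"
  proof -
    obtain \<G> :: "(real ^ 'n) set set set" where \<G>: "countable \<G>" "\<G> \<subseteq> sets (cylinder_borel k)"
      "\<And>Z Z'. Z \<in> cylinders k \<Longrightarrow> Z' \<in> cylinders k \<Longrightarrow> (\<forall>G\<in>\<G>. Z \<in> G \<longleftrightarrow> Z' \<in> G) \<Longrightarrow> Z = Z'"
      using countable_separating_cylinders by metis
    obtain Z where "Z \<in> hitting_cylinders k C" "emeasure \<mu> {Z} > 0"
    proof (rule integer_valued_measure_atom[OF int hit fin nz \<G>(1)])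
      show "\<G> \<subseteq> sets \<mu>" using \<G>(2) sets by simp
    qed (use \<G>(3) in \<open>auto simp: hitting_cylinders_def\<close>)
    then show ?thesis by (auto simp: union_set_def hitting_cylinders_def)
  qed
qed

lemma space_counting_measure_space: "space (counting_measure_space k) = counting_measures k"
  unfolding counting_measure_space_def by (auto simp: space_Sup_eq_UN)

lemma measurable_counting_evaluation:
  assumes "A \<in> sets (cylinder_borel k)"
  shows "(\<lambda>\<mu>. emeasure \<mu> A) \<in> borel_measurable (counting_measure_space k)"
  unfolding counting_measure_space_def
  by (rule measurable_Sup1[OF imageI[OF assms] measurable_vimage_algebra1]) auto

context
  fixes M :: "'w measure" and \<Lambda> :: "(real ^ 'n) set measure" and \<Xi> :: "'w \<Rightarrow> (real ^ 'n) set measure" and k :: nat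
  assumes poisson: "poisson_cylinder_process k M \<Lambda> \<Xi>"
begin

lemma void_event:
  fixes C :: "(real ^ 'n) set"
  assumes C: "compact C" "C \<noteq> {}"
  shows "{\<omega> \<in> space M. union_set (\<Xi> \<omega>) \<inter> C = {}} \<in> sets M"
    and "\<P>(\<omega> in M. union_set (\<Xi> \<omega>) \<inter> C = {}) = exp (- measure \<Lambda> (hitting_cylinders k C))"
proof -
  let ?H = "hitting_cylinders k C"
  have \<Xi>: "\<Xi> \<in> M \<rightarrow>\<^sub>M counting_measure_space k"
    and lf: "locally_finite_on_cylinders k \<Lambda>"
    and void: "\<And>A n. A \<in> sets \<Lambda> \<Longrightarrow> emeasure \<Lambda> A < \<infinity> \<Longrightarrow>
      \<P>(\<omega> in M. emeasure (\<Xi> \<omega>) A = of_nat n) = measure \<Lambda> A ^ n / fact n * exp (- measure \<Lambda> A)"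
    using poisson unfolding poisson_cylinder_process_def by blast+
  have H: "?H \<in> sets (cylinder_borel k)" by (rule hitting_cylinders_sets[OF C])
  have eq: "{\<omega> \<in> space M. union_set (\<Xi> \<omega>) \<inter> C = {}} = {\<omega> \<in> space M. emeasure (\<Xi> \<omega>) ?H = 0}"
  proof (intro Collect_cong conj_cong refl)
    fix \<omega> assume "\<omega> \<in> space M"
    then have "\<Xi> \<omega> \<in> counting_measures k"
      using measurable_space[OF \<Xi>] by (simp add: space_counting_measure_space)
    then show "union_set (\<Xi> \<omega>) \<inter> C = {} \<longleftrightarrow> emeasure (\<Xi> \<omega>) ?H = 0"
      using union_set_hits_iff[OF _ C] by blast
  qed
  have [measurable]: "(\<lambda>\<omega>. emeasure (\<Xi> \<omega>) ?H) \<in> borel_measurable M"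
    by (rule measurable_compose[OF \<Xi> measurable_counting_evaluation[OF H]])
  show "{\<omega> \<in> space M. union_set (\<Xi> \<omega>) \<inter> C = {}} \<in> sets M" unfolding eq by measurable
  have "?H \<in> sets \<Lambda>" "emeasure \<Lambda> ?H < \<infinity>"
    using lf H C by (auto simp: locally_finite_on_cylinders_def)
  from void[OF this, of 0]
  show "\<P>(\<omega> in M. union_set (\<Xi> \<omega>) \<inter> C = {}) = exp (- measure \<Lambda> ?H)" unfolding eq by simp
qed

text \<open>
  Missing the segment implies missing the origin, so the conditional probability of missing the
  segment is the quotient of the two void probabilities.
\<close>

lemma linear_contact_distribution_eqI:
  fixes \<eta> :: "real ^ 'n"
  assumes r: "r > 0"
    and incr: "measure \<Lambda> (hitting_cylinders k (closed_segment 0 (r *\<^sub>R \<eta>))) = measure \<Lambda> (hitting_cylinders k {0}) + b"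
  shows "linear_contact_distribution M \<Xi> \<eta> r = 1 - exp (- b)"
proof -
  interpret prob_space M using poisson by (simp add: poisson_cylinder_process_def)
  let ?S = "closed_segment 0 (r *\<^sub>R \<eta>)"
  define A where "A = {\<omega> \<in> space M. union_set (\<Xi> \<omega>) \<inter> {0} = {}}"
  define B where "B = {\<omega> \<in> space M. union_set (\<Xi> \<omega>) \<inter> ?S = {}}"
  have seg: "{t *\<^sub>R \<eta> | t. 0 \<le> t \<and> t \<le> r} = ?S"
    using closed_segment_0_scaleR[of r \<eta>] r by auto
  have A: "A \<in> sets M" "prob A = exp (- measure \<Lambda> (hitting_cylinders k {0}))"
    unfolding A_def by (rule void_event; simp)+
  have B: "B \<in> sets M" "prob B = exp (- measure \<Lambda> (hitting_cylinders k ?S))"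
    unfolding B_def by (rule void_event; simp)+
  have sub: "B \<subseteq> A" unfolding A_def B_def by auto
  have "linear_contact_distribution M \<Xi> \<eta> r = prob (A - B) / prob A"
    unfolding linear_contact_distribution_def cond_prob_def seg A_def B_def
    by (intro arg_cong2[where f="(/)"] arg_cong[where f=prob]) auto
  also have "prob (A - B) = prob A - prob B" using A B sub by (intro finite_measure_Diff)
  also have "(prob A - prob B) / prob A = 1 - prob B / prob A"
    using A(2) by (simp add: diff_divide_distrib)
  also have "prob B / prob A = exp (- b)" unfolding A B incr by (simp add: exp_diff[symmetric] exp_minus_inverse)
  finally show ?thesis .
qed

end

section \<open>The contact distribution function\<close>

lemma convex_ring_translate:
  assumes "K \<in> convex_ring" shows "(+) x ` K \<in> (convex_ring :: (real ^ 'n) set set)"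
proof -
  obtain F where F: "K = \<Union>F" "finite F" "F \<noteq> {}" "F \<subseteq> convex_bodies" using assms by (auto simp: convex_ring_def)
  have "(+) x ` K = \<Union>((`) ((+) x) ` F)" using F(1) by auto
  moreover have "(`) ((+) x) ` F \<subseteq> convex_bodies"
    using F(4) by (auto simp: convex_bodies_def intro!: compact_translation convex_translation)
  ultimately show ?thesis using F unfolding convex_ring_def
    by (intro CollectI exI[of _ "(`) ((+) x) ` F"]) auto
qed

lemma cylinder_translate:
  fixes Z :: "(real ^ 'n) set"
  assumes Z: "Z \<in> cylinders k" and x: "x \<in> (cylinder_direction Z)\<^sup>\<bottom>"
  shows "(+) x ` Z \<in> cylinders k"
proof -
  let ?\<xi> = "cylinder_direction Z" and ?K = "cylinder_base Z"
  note D = cylinder_decompose[OF Z]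
  have "(+) x ` Z = ?\<xi> + (+) x ` ?K"
    by (subst D(4)) (simp only: add.commute[of ?K] translate_set_plus)
  then have "(+) x ` Z = (+) x ` ?K + ?\<xi>" by (simp only: add.commute)
  moreover have "(+) x ` ?K \<subseteq> ?\<xi>\<^sup>\<bottom>"
    using D(3) x subspace_add[OF subspace_orthogonal_comp] by blast
  ultimately show ?thesis
    unfolding cylinders_def using D(1) convex_ring_translate[OF D(2), of x] by blast
qed

lemma translate_hits_iff:
  fixes Z C :: "(real ^ 'n) set"
  assumes Z: "Z \<in> cylinders k"
  shows "(+) x ` Z \<inter> C \<noteq> {} \<longleftrightarrow> x \<in> hitting_positions C (cylinder_direction Z) (cylinder_base Z)"
proof -
  let ?\<xi> = "cylinder_direction Z" and ?K = "cylinder_base Z"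
  note D = cylinder_decompose[OF Z]
  have neg: "- w \<in> ?\<xi>" if "w \<in> ?\<xi>" for w using D(1) that by (simp add: grassmannian_def subspace_neg)
  show ?thesis
  proof
    assume "(+) x ` Z \<inter> C \<noteq> {}"
    then obtain z where z: "z \<in> Z" "x + z \<in> C" by blast
    have "z \<in> ?K + ?\<xi>" using z(1) D(4) by simp
    then obtain y w where yw: "z = y + w" "y \<in> ?K" "w \<in> ?\<xi>" by (rule set_plus_elim)
    have "((x + z) + - y) + - w \<in> (C + uminus ` ?K) + ?\<xi>"
      by (intro set_plus_intro imageI z yw neg)
    moreover have eq: "((x + z) + - y) + - w = x" by (simp add: yw(1))
    ultimately show "x \<in> hitting_positions C ?\<xi> ?K" unfolding hitting_positions_def eq by simp
  next
    assume "x \<in> hitting_positions C ?\<xi> ?K"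
    then have "x \<in> (C + uminus ` ?K) + ?\<xi>" by (simp add: hitting_positions_def)
    then obtain a w where aw: "x = a + w" "a \<in> C + uminus ` ?K" "w \<in> ?\<xi>" by (rule set_plus_elim)
    obtain c y' where cy: "a = c + y'" "c \<in> C" "y' \<in> uminus ` ?K" using aw(2) by (rule set_plus_elim)
    then obtain y where y: "y \<in> ?K" "y' = - y" by blast
    have "y + - w \<in> ?K + ?\<xi>" using y neg[OF aw(3)] by (intro set_plus_intro)
    then have "y + - w \<in> Z" using D(4) by simp
    moreover have "x + (y + - w) = c" by (simp add: aw cy y)
    ultimately show "(+) x ` Z \<inter> C \<noteq> {}" using cy(2) by blast
  qed
qed

lemma hitting_positions_integral:
  fixes Z C :: "(real ^ 'n) set"
  assumes Z: "Z \<in> cylinders k" and C: "compact C" "C \<noteq> {}"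
  shows "(\<integral>\<^sup>+ x. indicator (hitting_cylinders k C) ((+) x ` Z) \<partial>subspace_lborel ((cylinder_direction Z)\<^sup>\<bottom>)) =
    hitting_measure C (cylinder_direction Z) (cylinder_base Z)"
proof -
  let ?\<xi> = "cylinder_direction Z" and ?K = "cylinder_base Z"
  let ?\<nu> = "subspace_lborel (?\<xi>\<^sup>\<bottom>)"
  note D = cylinder_decompose[OF Z]
  note \<nu> = haar_on_subspace_lborel[OF subspace_orthogonal_comp, of ?\<xi>]
  have ae: "AE x in ?\<nu>. x \<in> ?\<xi>\<^sup>\<bottom>" using \<nu> by (simp add: haar_on_def)
  have "(\<integral>\<^sup>+ x. indicator (hitting_cylinders k C) ((+) x ` Z) \<partial>?\<nu>) =
      (\<integral>\<^sup>+ x. indicator (hitting_positions C ?\<xi> ?K) x \<partial>?\<nu>)"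
  proof (intro nn_integral_cong_AE, use ae in eventually_elim)
    fix x assume x: "x \<in> ?\<xi>\<^sup>\<bottom>"
    show "indicator (hitting_cylinders k C) ((+) x ` Z) = (indicator (hitting_positions C ?\<xi> ?K) x :: ennreal)"
      using cylinder_translate[OF Z x] translate_hits_iff[OF Z, of x C]
      by (simp add: indicator_def hitting_cylinders_def)
  qed
  also have "\<dots> = hitting_measure C ?\<xi> ?K"
    unfolding hitting_measure_def
    by (intro nn_integral_indicator)
       (auto simp: haar_on_sets[OF \<nu>] intro!: borel_closed hitting_positions_closed[OF C(1) D(1,2)])
  finally show ?thesis .
qed

text \<open>
  The disintegration is given on rectangles only. These form a generator that is stable under
  intersections, so the law of (direction space, base) under \<open>\<theta>\<close> is the semidirect product of
  \<open>\<alpha>\<close> and \<open>\<beta>\<close>.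
\<close>

lemma shape_integral:
  fixes \<theta> \<alpha> :: "(real ^ 'n) set measure" and \<beta> :: "(real ^ 'n) set \<Rightarrow> (real ^ 'n) set measure"
  assumes shape: "prob_space \<theta>" "sets \<theta> = sets (centred_cylinder_borel k)"
    and direction: "prob_space \<alpha>" "sets \<alpha> = sets (grassmannian_borel k)"
    and kernel: "\<beta> \<in> grassmannian_borel k \<rightarrow>\<^sub>M prob_algebra convex_ring_borel"
    and disintegration: "\<And>R G. R \<in> sets convex_ring_borel \<Longrightarrow> G \<in> sets (grassmannian_borel k) \<Longrightarrow>
      emeasure \<theta> ({K + \<xi> | K \<xi>. K \<in> R \<and> \<xi> \<in> G \<and> K \<subseteq> \<xi>\<^sup>\<bottom>} \<inter> centred_cylinders k) =
      (\<integral>\<^sup>+ \<xi> \<in> G. emeasure (\<beta> \<xi>) R \<partial>\<alpha>)"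
    and F: "(\<lambda>(\<xi>, K). F \<xi> K) \<in> borel_measurable (grassmannian_borel k \<Otimes>\<^sub>M convex_ring_borel)"
  shows "(\<integral>\<^sup>+ Z. F (cylinder_direction Z) (cylinder_base Z) \<partial>\<theta>) = (\<integral>\<^sup>+ \<xi>. \<integral>\<^sup>+ K. F \<xi> K \<partial>\<beta> \<xi> \<partial>\<alpha>)"
proof -
  interpret T: prob_space \<theta> by fact
  interpret A: prob_space \<alpha> by fact
  let ?G = "grassmannian_borel k :: (real ^ 'n) set measure"
  let ?R = "convex_ring_borel :: (real ^ 'n) set measure"
  let ?\<Phi> = "\<lambda>Z :: (real ^ 'n) set. (cylinder_direction Z, cylinder_base Z)"
  let ?\<kappa> = "\<lambda>\<xi>. distr (\<beta> \<xi>) (?G \<Otimes>\<^sub>M ?R) (Pair \<xi>)"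
  have \<beta>: "\<beta> \<in> \<alpha> \<rightarrow>\<^sub>M subprob_algebra ?R"
    using measurable_prob_algebraD[OF kernel] measurable_cong_sets[OF direction(2) refl] by blast
  have sets_\<beta>: "sets (\<beta> \<xi>) = sets ?R" if "\<xi> \<in> space \<alpha>" for \<xi>
    using measurable_space[OF \<beta> that] by (simp add: space_subprob_algebra)
  have space_\<alpha>: "space \<alpha> = grassmannian k"
    using sets_eq_imp_space_eq[OF direction(2)] by (simp add: space_grassmannian_borel)
  have sp_\<theta>: "space \<theta> = cylinders k \<inter> centred_cylinders k"
    using sets_eq_imp_space_eq[OF shape(2)]
    by (auto simp: centred_cylinder_borel_def space_restrict_space space_cylinder_borel)
  have pair: "(\<lambda>(\<xi>, K). (\<xi>, K)) \<in> \<alpha> \<Otimes>\<^sub>M ?R \<rightarrow>\<^sub>M ?G \<Otimes>\<^sub>M ?R"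
    using measurable_ident_sets[OF sets_pair_measure_cong[OF direction(2) refl]] by (simp add: id_def)
  have \<kappa>: "?\<kappa> \<in> \<alpha> \<rightarrow>\<^sub>M subprob_algebra (?G \<Otimes>\<^sub>M ?R)"
    by (rule measurable_distr2[OF pair \<beta>])
  have \<Phi>: "?\<Phi> \<in> \<theta> \<rightarrow>\<^sub>M ?G \<Otimes>\<^sub>M ?R"
  proof -
    have "?\<Phi> \<in> centred_cylinder_borel k \<rightarrow>\<^sub>M ?G \<Otimes>\<^sub>M ?R"
      unfolding centred_cylinder_borel_def by (rule measurable_restrict_space1[OF measurable_cylinder_pair])
    then show ?thesis using measurable_cong_sets[OF shape(2) refl] by blast
  qed
  have Pair_meas: "Pair \<xi> \<in> \<beta> \<xi> \<rightarrow>\<^sub>M ?G \<Otimes>\<^sub>M ?R" if "\<xi> \<in> space \<alpha>" for \<xi>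
  proof -
    have "Pair \<xi> \<in> ?R \<rightarrow>\<^sub>M ?G \<Otimes>\<^sub>M ?R"
      using that by (intro measurable_Pair1') (simp add: space_\<alpha> space_grassmannian_borel)
    then show ?thesis using measurable_cong_sets[OF sets_\<beta>[OF that] refl] by blast
  qed
  have eq: "distr \<theta> (?G \<Otimes>\<^sub>M ?R) ?\<Phi> = \<alpha> \<bind> ?\<kappa>"
  proof (rule measure_eqI_generator_eq[OF Int_stable_pair_measure_generator, of ?G ?R "space ?G \<times> space ?R"])
    show "{a \<times> b | a b. a \<in> sets ?G \<and> b \<in> sets ?R} \<subseteq> Pow (space ?G \<times> space ?R)"
      by (rule pair_measure_closed)
    show "sets (distr \<theta> (?G \<Otimes>\<^sub>M ?R) ?\<Phi>) = sigma_sets (space ?G \<times> space ?R) {a \<times> b | a b. a \<in> sets ?G \<and> b \<in> sets ?R}"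
      by (simp add: sets_pair_measure)
    have "sets (\<alpha> \<bind> ?\<kappa>) = sets (?G \<Otimes>\<^sub>M ?R)"
      by (rule sets_bind) (use A.not_empty in auto)
    then show "sets (\<alpha> \<bind> ?\<kappa>) = sigma_sets (space ?G \<times> space ?R) {a \<times> b | a b. a \<in> sets ?G \<and> b \<in> sets ?R}"
      by (simp add: sets_pair_measure)
    show "range (\<lambda>i::nat. space ?G \<times> space ?R) \<subseteq> {a \<times> b | a b. a \<in> sets ?G \<and> b \<in> sets ?R}" by blast
    show "(\<Union>i::nat. space ?G \<times> space ?R) = space ?G \<times> space ?R" by simp
    show "emeasure (distr \<theta> (?G \<Otimes>\<^sub>M ?R) ?\<Phi>) (space ?G \<times> space ?R) \<noteq> \<infinity>"
      using finite_measure.emeasure_finite[OF prob_space.finite_measure[OF T.prob_space_distr[OF \<Phi>]]] by simp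
    fix X assume "X \<in> {a \<times> b | a b. a \<in> sets ?G \<and> b \<in> sets ?R}"
    then obtain G R where X: "X = G \<times> R" "G \<in> sets ?G" "R \<in> sets ?R" by blast
    have sub: "G \<subseteq> grassmannian k" "R \<subseteq> convex_ring"
      using sets.sets_into_space[OF X(2)] sets.sets_into_space[OF X(3)]
      by (auto simp: space_grassmannian_borel space_convex_ring_borel)
    have XS: "X \<in> sets (?G \<Otimes>\<^sub>M ?R)" unfolding X(1) by (intro pair_measureI X)
    have "emeasure (distr \<theta> (?G \<Otimes>\<^sub>M ?R) ?\<Phi>) X = emeasure \<theta> (?\<Phi> -` X \<inter> space \<theta>)"
      by (rule emeasure_distr[OF \<Phi> XS])
    also have "?\<Phi> -` X \<inter> space \<theta> = {K + \<xi> | K \<xi>. K \<in> R \<and> \<xi> \<in> G \<and> K \<subseteq> \<xi>\<^sup>\<bottom>} \<inter> centred_cylinders k"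
    proof
      show "?\<Phi> -` X \<inter> space \<theta> \<subseteq> {K + \<xi> | K \<xi>. K \<in> R \<and> \<xi> \<in> G \<and> K \<subseteq> \<xi>\<^sup>\<bottom>} \<inter> centred_cylinders k"
      proof
        fix Z assume Z: "Z \<in> ?\<Phi> -` X \<inter> space \<theta>"
        then have Zc: "Z \<in> cylinders k" "Z \<in> centred_cylinders k" by (auto simp: sp_\<theta>)
        have "cylinder_base Z \<in> R" "cylinder_direction Z \<in> G" using Z by (auto simp: X(1))
        then show "Z \<in> {K + \<xi> | K \<xi>. K \<in> R \<and> \<xi> \<in> G \<and> K \<subseteq> \<xi>\<^sup>\<bottom>} \<inter> centred_cylinders k"
          using cylinder_decompose(3,4)[OF Zc(1)] Zc(2) by blast
      qed
      show "{K + \<xi> | K \<xi>. K \<in> R \<and> \<xi> \<in> G \<and> K \<subseteq> \<xi>\<^sup>\<bottom>} \<inter> centred_cylinders k \<subseteq> ?\<Phi> -` X \<inter> space \<theta>"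
      proof
        fix Z assume Z: "Z \<in> {K + \<xi> | K \<xi>. K \<in> R \<and> \<xi> \<in> G \<and> K \<subseteq> \<xi>\<^sup>\<bottom>} \<inter> centred_cylinders k"
        then obtain K \<xi> where K: "Z = K + \<xi>" "K \<in> R" "\<xi> \<in> G" "K \<subseteq> \<xi>\<^sup>\<bottom>" by blast
        have s: "subspace \<xi>" using sub K(3) by (auto simp: grassmannian_def)
        have KR: "K \<in> convex_ring" using sub K(2) by blast
        have "cylinder_direction Z = \<xi>" "cylinder_base Z = K"
          unfolding K(1) by (rule cylinder_direction_eq[OF s KR K(4)], rule cylinder_base_eq[OF s KR K(4)])
        then show "Z \<in> ?\<Phi> -` X \<inter> space \<theta>"
          using Z K by (auto simp: X(1) sp_\<theta> centred_cylinders_def)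
      qed
    qed
    also have "emeasure \<theta> \<dots> = (\<integral>\<^sup>+ \<xi> \<in> G. emeasure (\<beta> \<xi>) R \<partial>\<alpha>)" by (rule disintegration[OF X(3,2)])
    also have "\<dots> = (\<integral>\<^sup>+ \<xi>. emeasure (?\<kappa> \<xi>) X \<partial>\<alpha>)"
    proof (rule nn_integral_cong)
      fix \<xi> assume \<xi>: "\<xi> \<in> space \<alpha>"
      have "emeasure (?\<kappa> \<xi>) X = emeasure (\<beta> \<xi>) (Pair \<xi> -` X \<inter> space (\<beta> \<xi>))"
        by (rule emeasure_distr[OF Pair_meas[OF \<xi>] XS])
      also have "Pair \<xi> -` X \<inter> space (\<beta> \<xi>) = (if \<xi> \<in> G then R else {})"
        using sets_eq_imp_space_eq[OF sets_\<beta>[OF \<xi>]] sub by (auto simp: X(1) space_convex_ring_borel)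
      finally show "emeasure (\<beta> \<xi>) R * indicator G \<xi> = emeasure (?\<kappa> \<xi>) X" by simp
    qed
    also have "\<dots> = emeasure (\<alpha> \<bind> ?\<kappa>) X"
      by (rule emeasure_bind[symmetric, OF A.not_empty \<kappa> XS])
    finally show "emeasure (distr \<theta> (?G \<Otimes>\<^sub>M ?R) ?\<Phi>) X = emeasure (\<alpha> \<bind> ?\<kappa>) X" .
  qed
  have "(\<integral>\<^sup>+ Z. F (cylinder_direction Z) (cylinder_base Z) \<partial>\<theta>) =
      (\<integral>\<^sup>+ p. (case p of (\<xi>, K) \<Rightarrow> F \<xi> K) \<partial>distr \<theta> (?G \<Otimes>\<^sub>M ?R) ?\<Phi>)"
    using F by (subst nn_integral_distr[OF \<Phi>]) auto
  also have "\<dots> = (\<integral>\<^sup>+ \<xi>. \<integral>\<^sup>+ p. (case p of (\<xi>, K) \<Rightarrow> F \<xi> K) \<partial>?\<kappa> \<xi> \<partial>\<alpha>)"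
    unfolding eq by (rule nn_integral_bind[OF F \<kappa>])
  also have "\<dots> = (\<integral>\<^sup>+ \<xi>. \<integral>\<^sup>+ K. F \<xi> K \<partial>\<beta> \<xi> \<partial>\<alpha>)"
    using F by (intro nn_integral_cong) (subst nn_integral_distr[OF Pair_meas], auto)
  finally show ?thesis .
qed

text \<open>
  The constant of Cauchy's formula, a quotient of the volume of the ball of dimension \<open>m - 1\<close> and of the
  surface area of the ball of dimension \<open>m\<close>, in the form of the theorem. It rests on
  \<open>omega (m + 1) = 2 * pi * unit_ball_vol (m - 1)\<close>, an instance of \<open>Gamma (x + 1) = x * Gamma x\<close>.
\<close>

lemma cauchy_constant:
  assumes "m \<ge> 1"
  shows "omega (m + 1) / (2 * pi * omega m) = unit_ball_vol (real (m - 1)) / (real m * unit_ball_vol (real m))"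
proof -
  have "omega (m + 1) = 2 * pi * unit_ball_vol (real (m - 1))"
  proof -
    define x where "x = (real m + 1) / 2"
    have x: "x > 0" by (simp add: x_def)
    have 1: "unit_ball_vol (real (m + 1)) = pi powr x / Gamma (x + 1)"
      unfolding unit_ball_vol_def by (simp add: x_def add_ac)
    have 2: "unit_ball_vol (real (m - 1)) = pi powr (x - 1) / Gamma x"
    proof -
      have h: "real (m - 1) / 2 = x - 1" using assms by (simp add: x_def of_nat_diff field_simps)
      show ?thesis unfolding unit_ball_vol_def h by simp
    qed
    have G: "Gamma (x + 1) = x * Gamma x" using x by (intro Gamma_plus1) (auto elim!: nonpos_Ints_cases)
    have G0: "Gamma x > 0" using x by (rule Gamma_real_pos)
    have P: "pi powr x = pi * pi powr (x - 1)" by (simp add: powr_diff)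
    have "real (m + 1) = 2 * x" by (simp add: x_def)
    then show ?thesis unfolding omega_def 1 2 G P using x G0 by simp
  qed
  then show ?thesis by (simp add: omega_def)
qed

lemma dim_orthogonal_comp:
  assumes "\<xi> \<in> grassmannian k" shows "dim (\<xi>\<^sup>\<bottom> :: (real ^ 'n) set) = CARD('n) - k"
  using dim_subspace_orthogonal_to_vectors[of \<xi> UNIV] assms
  by (simp add: orthogonal_comp_def grassmannian_def)

text \<open>
  The increment is taken inside the integral over \<open>K\<close>, where both hitting measures are finite; the mean
  volume of \<open>K\<close> may be infinite for some \<open>\<xi>\<close>.
\<close>

lemma mean_hitting_measure_segment:
  fixes \<xi> :: "(real ^ 'n) set" and \<eta> :: "real ^ 'n"
  assumes \<xi>: "\<xi> \<in> grassmannian k" and k: "k < CARD('n)" and r: "r > 0"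
    and sets_\<beta>: "sets \<beta> = sets convex_ring_borel"
    and conv: "AE K in \<beta>. K \<in> convex_bodies" and sub: "AE K in \<beta>. K \<subseteq> \<xi>\<^sup>\<bottom>"
    and iso: "isotropic_on_comp \<xi> \<beta>"
  shows "(\<integral>\<^sup>+ K. hitting_measure (closed_segment 0 (r *\<^sub>R \<eta>)) \<xi> K - hitting_measure {0} \<xi> K \<partial>\<beta>) =
    ennreal r * (ennreal (omega (CARD('n) - k + 1) / (2 * pi * omega (CARD('n) - k))) *
      ((\<integral>\<^sup>+ K \<in> {K. K \<in> convex_bodies \<and> K \<subseteq> \<xi>\<^sup>\<bottom>}. surface_area (\<xi>\<^sup>\<bottom>) K \<partial>\<beta>) * ennreal (bracket \<xi> \<eta>)))"
proof -
  let ?V = "\<xi>\<^sup>\<bottom>" let ?P = "closest_point (\<xi>\<^sup>\<bottom>)" let ?\<nu> = "subspace_lborel (\<xi>\<^sup>\<bottom>)"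
  let ?m = "CARD('n) - k"
  have s: "subspace \<xi>" using \<xi> by (simp add: grassmannian_def)
  have V: "subspace ?V" by (rule subspace_orthogonal_comp)
  note \<nu> = haar_on_subspace_lborel[OF V]
  have m: "dim ?V = ?m" by (rule dim_orthogonal_comp[OF \<xi>])
  have iso': "isotropic_on_comp (?V\<^sup>\<bottom>) \<beta>" using iso orthogonal_comp_self[OF s] by simp
  obtain u where u: "u \<in> ?V" "norm u = 1"
  proof -
    have "dim ?V \<noteq> 0" using m k by simp
    then have "\<not> ?V \<subseteq> {0}" by (simp add: dim_eq_0)
    then obtain v where "v \<in> ?V" "v \<noteq> 0" by blast
    then show ?thesis using V by (intro that[of "v /\<^sub>R norm v"]) (auto intro: subspace_scale)
  qed
  let ?I = "\<integral>\<^sup>+ K \<in> {K. K \<in> convex_bodies \<and> K \<subseteq> ?V}. surface_area ?V K \<partial>\<beta>"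
  let ?g = "\<integral>\<^sup>+ K. ennreal (sweep ?\<nu> K u) \<partial>\<beta>"
  let ?b = "unit_ball_vol (real (?m - 1))" and ?A = "real ?m * unit_ball_vol (real ?m)"
  have A: "?A > 0" and b: "?b > 0" using k by auto
  have gA: "?g * ennreal ?A = ?I * ennreal ?b"
    by (rule mean_surface_area_eq_mean_sweep[OF V sets_\<beta> conv iso' m sub u, symmetric])
  have "ennreal ?A \<noteq> 0" using A by (simp only: ennreal_eq_0_iff not_le)
  then have "?g * ennreal ?A / ennreal ?A = ?g" by (rule ennreal_mult_divide_eq) simp
  then have "?g = ?I * ennreal ?b / ennreal ?A" unfolding gA by (rule sym)
  also have "\<dots> = ?I * ennreal (?b / ?A)"
    using A b by (simp only: divide_ennreal[symmetric, OF less_imp_le] ennreal_times_divide)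
  also have "\<dots> = ennreal (?b / ?A) * ?I" by (rule mult.commute)
  also have "?b / ?A = omega (?m + 1) / (2 * pi * omega ?m)" using k by (intro cauchy_constant[symmetric]) simp
  finally have g: "?g = ennreal (omega (?m + 1) / (2 * pi * omega ?m)) * ?I" .
  have "(\<integral>\<^sup>+ K. hitting_measure (closed_segment 0 (r *\<^sub>R \<eta>)) \<xi> K - hitting_measure {0} \<xi> K \<partial>\<beta>) =
      (\<integral>\<^sup>+ K. ennreal (sweep ?\<nu> K (?P (r *\<^sub>R \<eta>))) \<partial>\<beta>)"
  proof (intro nn_integral_cong_AE, use conv sub in eventually_elim)
    fix K :: "(real ^ 'n) set" assume "K \<in> convex_bodies" "K \<subseteq> ?V"
    then have K: "compact K" "K \<subseteq> ?V" by (auto simp: convex_bodies_def)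
    show "hitting_measure (closed_segment 0 (r *\<^sub>R \<eta>)) \<xi> K - hitting_measure {0} \<xi> K =
        ennreal (sweep ?\<nu> K (?P (r *\<^sub>R \<eta>)))"
      unfolding hitting_measure_point_segment[OF s K] haar_emeasure_eq[OF \<nu> K(1)] by simp
  qed
  also have "\<dots> = ennreal (norm (?P (r *\<^sub>R \<eta>))) * ?g"
    by (rule mean_sweep_scale[OF V sets_\<beta> conv iso' u closest_point_subspace_mem[OF V]])
  also have "norm (?P (r *\<^sub>R \<eta>)) = r * bracket \<xi> \<eta>"
    using r linear_cmul[OF linear_closest_point[OF V], of r \<eta>] by (simp add: bracket_def)
  finally show ?thesis using r by (simp add: g ennreal_mult bracket_def ac_simps)
qed

theorem lemma3:
  fixes k :: nat
    and M :: "'w measure"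
    and \<Xi> :: "'w \<Rightarrow> (real ^ 'n) set measure"
    and \<Lambda> \<theta> \<alpha> :: "(real ^ 'n) set measure"
    and \<beta> :: "(real ^ 'n) set \<Rightarrow> (real ^ 'n) set measure"
    and lam :: real
    and \<eta> :: "real ^ 'n"
  defines "C\<^sub>o \<equiv>
      ennreal (omega (CARD('n) - k + 1) / (2 * pi * omega (CARD('n) - k))) *
        (\<integral>\<^sup>+ \<xi>. (\<integral>\<^sup>+ K \<in> {K. K \<in> convex_bodies \<and> K \<subseteq> \<xi>\<^sup>\<bottom>}. surface_area (\<xi>\<^sup>\<bottom>) K \<partial>\<beta> \<xi>)
               * ennreal (bracket \<xi> \<eta>) \<partial>\<alpha>)"
  assumes k: "k < CARD('n)"
    and poisson: "poisson_cylinder_process k M \<Lambda> \<Xi>"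
    and simple: "simple_process M \<Xi>"
    and stationary: "stationary_process k M \<Xi>"
    and volume_fraction: "\<P>(\<omega> in M. 0 \<in> union_set (\<Xi> \<omega>)) > 0"
    and intensity: "lam \<ge> 0"
    and shape: "prob_space \<theta>" "sets \<theta> = sets (centred_cylinder_borel k)"
    and decomposition: "\<And>f :: (real ^ 'n) set \<Rightarrow> ennreal. f \<in> borel_measurable (cylinder_borel k) \<Longrightarrow>
      (\<integral>\<^sup>+ Z. f Z \<partial>\<Lambda>) =
      ennreal lam * (\<integral>\<^sup>+ Z. (\<integral>\<^sup>+ x. f ((+) x ` Z) \<partial>subspace_lborel ((cylinder_direction Z)\<^sup>\<bottom>)) \<partial>\<theta>)"
    and direction: "prob_space \<alpha>" "sets \<alpha> = sets (grassmannian_borel k)"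
    and kernel: "\<beta> \<in> grassmannian_borel k \<rightarrow>\<^sub>M prob_algebra convex_ring_borel"
    and kernel_comp: "\<And>\<xi>. \<xi> \<in> grassmannian k \<Longrightarrow> AE K in \<beta> \<xi>. K \<subseteq> \<xi>\<^sup>\<bottom>"
    and disintegration: "\<And>R G. R \<in> sets convex_ring_borel \<Longrightarrow> G \<in> sets (grassmannian_borel k) \<Longrightarrow>
      emeasure \<theta> ({K + \<xi> | K \<xi>. K \<in> R \<and> \<xi> \<in> G \<and> K \<subseteq> \<xi>\<^sup>\<bottom>} \<inter> centred_cylinders k) =
      (\<integral>\<^sup>+ \<xi> \<in> G. emeasure (\<beta> \<xi>) R \<partial>\<alpha>)"
    and kernel_convex: "\<And>\<xi>. \<xi> \<in> grassmannian k \<Longrightarrow> AE K in \<beta> \<xi>. K \<in> convex_bodies"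
    and kernel_isotropic: "\<And>\<xi>. \<xi> \<in> grassmannian k \<Longrightarrow> isotropic_on_comp \<xi> (\<beta> \<xi>)"
    and unit: "norm \<eta> = 1"
  shows "C\<^sub>o < \<infinity> \<and>
    (\<forall>r>0. linear_contact_distribution M \<Xi> \<eta> r = 1 - exp (- lam * r * enn2real C\<^sub>o))"
proof -
  interpret M: prob_space M using poisson by (simp add: poisson_cylinder_process_def)
  let ?c = "omega (CARD('n) - k + 1) / (2 * pi * omega (CARD('n) - k))"
  let ?m = "CARD('n) - k"
  define X where "X \<xi> = (\<integral>\<^sup>+ K \<in> {K. K \<in> convex_bodies \<and> K \<subseteq> \<xi>\<^sup>\<bottom>}. surface_area (\<xi>\<^sup>\<bottom>) K \<partial>\<beta> \<xi>)
               * ennreal (bracket \<xi> \<eta>)" for \<xi>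
  have Co: "C\<^sub>o = ennreal ?c * (\<integral>\<^sup>+ \<xi>. X \<xi> \<partial>\<alpha>)" by (simp add: C\<^sub>o_def X_def)
  have c: "?c > 0" using cauchy_constant[of ?m] k by simp
  let ?seg = "\<lambda>r. closed_segment 0 (r *\<^sub>R \<eta>)"
  have space_\<alpha>: "space \<alpha> = grassmannian k"
    using sets_eq_imp_space_eq[OF direction(2)] by (simp add: space_grassmannian_borel)
  have \<beta>: "\<beta> \<in> grassmannian_borel k \<rightarrow>\<^sub>M subprob_algebra convex_ring_borel"
    by (rule measurable_prob_algebraD[OF kernel])
  have sets_\<beta>: "sets (\<beta> \<xi>) = sets convex_ring_borel" if "\<xi> \<in> grassmannian k" for \<xi>
    using measurable_space[OF \<beta>, of \<xi>] that by (simp add: space_subprob_algebra space_grassmannian_borel)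
  have lf: "locally_finite_on_cylinders k \<Lambda>" using poisson by (simp add: poisson_cylinder_process_def)
  have hm: "(\<lambda>(\<xi>, K). hitting_measure C \<xi> K) \<in> borel_measurable (grassmannian_borel k \<Otimes>\<^sub>M convex_ring_borel)"
    if "compact C" "C \<noteq> {}" for C :: "(real ^ 'n) set"
    by (rule hitting_measure_measurable[OF that])
  have hm0: "(\<lambda>(\<xi>, K). hitting_measure {0} \<xi> K) \<in>
      borel_measurable (grassmannian_borel k \<Otimes>\<^sub>M convex_ring_borel :: ((real ^ 'n) set \<times> (real ^ 'n) set) measure)"
    by (rule hm) auto
  have hms: "(\<lambda>(\<xi>, K). hitting_measure (?seg r) \<xi> K) \<in> borel_measurable (grassmannian_borel k \<Otimes>\<^sub>M convex_ring_borel)" for r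
    by (rule hm) auto
  have \<Lambda>_hit: "emeasure \<Lambda> (hitting_cylinders k C) = ennreal lam * (\<integral>\<^sup>+ \<xi>. \<integral>\<^sup>+ K. hitting_measure C \<xi> K \<partial>\<beta> \<xi> \<partial>\<alpha>)"
    if C: "compact C" "C \<noteq> {}" for C :: "(real ^ 'n) set"
  proof -
    have H: "hitting_cylinders k C \<in> sets (cylinder_borel k)" by (rule hitting_cylinders_sets[OF C])
    then have "emeasure \<Lambda> (hitting_cylinders k C) = (\<integral>\<^sup>+ Z. indicator (hitting_cylinders k C) Z \<partial>\<Lambda>)"
      using lf by (simp add: locally_finite_on_cylinders_def)
    also have "\<dots> = ennreal lam * (\<integral>\<^sup>+ Z. (\<integral>\<^sup>+ x. indicator (hitting_cylinders k C) ((+) x ` Z)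
        \<partial>subspace_lborel ((cylinder_direction Z)\<^sup>\<bottom>)) \<partial>\<theta>)"
      using H by (intro decomposition) simp
    also have "(\<integral>\<^sup>+ Z. (\<integral>\<^sup>+ x. indicator (hitting_cylinders k C) ((+) x ` Z)
        \<partial>subspace_lborel ((cylinder_direction Z)\<^sup>\<bottom>)) \<partial>\<theta>) =
        (\<integral>\<^sup>+ Z. hitting_measure C (cylinder_direction Z) (cylinder_base Z) \<partial>\<theta>)"
    proof (rule nn_integral_cong)
      fix Z assume "Z \<in> space \<theta>"
      then have "Z \<in> cylinders k"
        using sets_eq_imp_space_eq[OF shape(2)]
        by (simp add: centred_cylinder_borel_def space_restrict_space space_cylinder_borel)
      then show "(\<integral>\<^sup>+ x. indicator (hitting_cylinders k C) ((+) x ` Z)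
          \<partial>subspace_lborel ((cylinder_direction Z)\<^sup>\<bottom>)) =
          hitting_measure C (cylinder_direction Z) (cylinder_base Z)"
        by (rule hitting_positions_integral[OF _ C])
    qed
    also have "\<dots> = (\<integral>\<^sup>+ \<xi>. \<integral>\<^sup>+ K. hitting_measure C \<xi> K \<partial>\<beta> \<xi> \<partial>\<alpha>)"
      by (rule shape_integral[OF shape direction kernel disintegration hm[OF C]])
    finally show ?thesis .
  qed
  \<comment> \<open>D carries the dependence on r, and its joint measurability is what makes the integrand of the constant measurable in \<xi>\<close>
  define D where "D r \<xi> K = hitting_measure (?seg r) \<xi> K - hitting_measure {0} \<xi> K" for r \<xi> K
  have D_meas: "(\<lambda>(\<xi>, K). D r \<xi> K) \<in> borel_measurable (grassmannian_borel k \<Otimes>\<^sub>M convex_ring_borel)" for r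
    using borel_measurable_minus_ennreal[OF hms[of r] hm0] by (simp add: D_def case_prod_beta)
  have int_D: "(\<integral>\<^sup>+ K. D r \<xi> K \<partial>\<beta> \<xi>) = ennreal r * (ennreal ?c * X \<xi>)" if "\<xi> \<in> grassmannian k" "r > 0" for r \<xi>
    unfolding D_def X_def
    by (rule mean_hitting_measure_segment[OF that(1) k that(2) sets_\<beta>[OF that(1)] kernel_convex[OF that(1)]
        kernel_comp[OF that(1)] kernel_isotropic[OF that(1)]])
  have split: "(\<integral>\<^sup>+ K. hitting_measure (?seg r) \<xi> K \<partial>\<beta> \<xi>) =
      (\<integral>\<^sup>+ K. hitting_measure {0} \<xi> K \<partial>\<beta> \<xi>) + (\<integral>\<^sup>+ K. D r \<xi> K \<partial>\<beta> \<xi>)" if \<xi>: "\<xi> \<in> grassmannian k" for r \<xi>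
  proof -
    have s: "subspace \<xi>" using \<xi> by (simp add: grassmannian_def)
    have sec: "(\<lambda>K. F \<xi> K) \<in> borel_measurable (\<beta> \<xi>)"
      if "(\<lambda>(\<xi>, K). F \<xi> K) \<in> borel_measurable (grassmannian_borel k \<Otimes>\<^sub>M convex_ring_borel)"
      for F :: "(real ^ 'n) set \<Rightarrow> (real ^ 'n) set \<Rightarrow> ennreal"
    proof -
      have "(\<lambda>K. F \<xi> K) \<in> borel_measurable convex_ring_borel"
        using measurable_Pair2[OF that, of \<xi>] \<xi> by (simp add: space_grassmannian_borel)
      then show ?thesis using measurable_cong_sets[OF sets_\<beta>[OF \<xi>] refl] by blast
    qed
    have "(\<integral>\<^sup>+ K. hitting_measure (?seg r) \<xi> K \<partial>\<beta> \<xi>) = (\<integral>\<^sup>+ K. hitting_measure {0} \<xi> K + D r \<xi> K \<partial>\<beta> \<xi>)"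
    proof (intro nn_integral_cong_AE, use kernel_convex[OF \<xi>] kernel_comp[OF \<xi>] in eventually_elim)
      fix K :: "(real ^ 'n) set" assume "K \<in> convex_bodies" "K \<subseteq> \<xi>\<^sup>\<bottom>"
      then have K: "compact K" "K \<subseteq> \<xi>\<^sup>\<bottom>" by (auto simp: convex_bodies_def)
      show "hitting_measure (?seg r) \<xi> K = hitting_measure {0} \<xi> K + D r \<xi> K"
        unfolding D_def hitting_measure_point_segment[OF s K]
          haar_emeasure_eq[OF haar_on_subspace_lborel[OF subspace_orthogonal_comp] K(1)]
        by simp
    qed
    also have "\<dots> = (\<integral>\<^sup>+ K. hitting_measure {0} \<xi> K \<partial>\<beta> \<xi>) + (\<integral>\<^sup>+ K. D r \<xi> K \<partial>\<beta> \<xi>)"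
      by (rule nn_integral_add[OF sec[OF hm0] sec[OF D_meas]])
    finally show ?thesis .
  qed
  have kernel_int: "(\<lambda>\<xi>. \<integral>\<^sup>+ K. F \<xi> K \<partial>\<beta> \<xi>) \<in> borel_measurable \<alpha>"
    if "(\<lambda>(\<xi>, K). F \<xi> K) \<in> borel_measurable (grassmannian_borel k \<Otimes>\<^sub>M convex_ring_borel)"
    for F :: "(real ^ 'n) set \<Rightarrow> (real ^ 'n) set \<Rightarrow> ennreal"
    using nn_integral_measurable_subprob_algebra2[OF that \<beta>] measurable_cong_sets[OF direction(2) refl] by blast
  have X_meas: "(\<lambda>\<xi>. ennreal ?c * X \<xi>) \<in> borel_measurable \<alpha>"
    using kernel_int[OF D_meas[of 1]]
    by (rule measurable_cong[THEN iffD1, rotated]) (simp add: int_D space_\<alpha>)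
  have X_meas': "X \<in> borel_measurable \<alpha>"
  proof -
    have "(\<lambda>\<xi>. ennreal ?c * X \<xi> / ennreal ?c) \<in> borel_measurable \<alpha>"
      using X_meas by (intro borel_measurable_divide_ennreal) auto
    moreover have "ennreal ?c * X \<xi> / ennreal ?c = X \<xi>" for \<xi>
      using c ennreal_mult_divide_eq[of "ennreal ?c" "X \<xi>"] by (simp add: mult.commute ennreal_eq_0_iff)
    ultimately show ?thesis by simp
  qed
  have Co': "(\<integral>\<^sup>+ \<xi>. ennreal r * (ennreal ?c * X \<xi>) \<partial>\<alpha>) = ennreal r * C\<^sub>o" for r
    by (simp only: Co nn_integral_cmult[OF X_meas] nn_integral_cmult[OF X_meas'])
  have main: "emeasure \<Lambda> (hitting_cylinders k (?seg r)) =
      emeasure \<Lambda> (hitting_cylinders k {0}) + ennreal lam * (ennreal r * C\<^sub>o)" if r: "r > 0" for r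
  proof -
    have "emeasure \<Lambda> (hitting_cylinders k (?seg r)) =
        ennreal lam * (\<integral>\<^sup>+ \<xi>. \<integral>\<^sup>+ K. hitting_measure (?seg r) \<xi> K \<partial>\<beta> \<xi> \<partial>\<alpha>)"
      by (rule \<Lambda>_hit) auto
    also have "(\<integral>\<^sup>+ \<xi>. \<integral>\<^sup>+ K. hitting_measure (?seg r) \<xi> K \<partial>\<beta> \<xi> \<partial>\<alpha>) =
        (\<integral>\<^sup>+ \<xi>. (\<integral>\<^sup>+ K. hitting_measure {0} \<xi> K \<partial>\<beta> \<xi>) + (\<integral>\<^sup>+ K. D r \<xi> K \<partial>\<beta> \<xi>) \<partial>\<alpha>)"
      by (intro nn_integral_cong split) (simp add: space_\<alpha>)
    also have "\<dots> = (\<integral>\<^sup>+ \<xi>. \<integral>\<^sup>+ K. hitting_measure {0} \<xi> K \<partial>\<beta> \<xi> \<partial>\<alpha>) + (\<integral>\<^sup>+ \<xi>. \<integral>\<^sup>+ K. D r \<xi> K \<partial>\<beta> \<xi> \<partial>\<alpha>)"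
      by (rule nn_integral_add[OF kernel_int[OF hm0] kernel_int[OF D_meas]])
    also have "(\<integral>\<^sup>+ \<xi>. \<integral>\<^sup>+ K. D r \<xi> K \<partial>\<beta> \<xi> \<partial>\<alpha>) = (\<integral>\<^sup>+ \<xi>. ennreal r * (ennreal ?c * X \<xi>) \<partial>\<alpha>)"
      using r by (intro nn_integral_cong int_D) (simp_all add: space_\<alpha>)
    also have "\<dots> = ennreal r * C\<^sub>o" by (rule Co')
    finally show ?thesis by (simp add: \<Lambda>_hit[of "{0}"] distrib_left)
  qed
  have fin: "emeasure \<Lambda> (hitting_cylinders k C) < \<infinity>" if "compact C" for C
    using lf that by (simp add: locally_finite_on_cylinders_def)
  \<comment> \<open>with intensity 0 there would be no cylinders at all, against the positive volume fraction\<close>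
  have lam: "lam > 0"
  proof (rule ccontr)
    assume "\<not> lam > 0"
    then have "emeasure \<Lambda> (hitting_cylinders k {0}) = 0" using intensity by (simp add: \<Lambda>_hit[of "{0}"])
    then have "\<P>(\<omega> in M. union_set (\<Xi> \<omega>) \<inter> {0} = {}) = 1"
      using void_event(2)[OF poisson, of "{0}"] by (simp add: measure_def)
    moreover have "{\<omega> \<in> space M. 0 \<in> union_set (\<Xi> \<omega>)} =
        space M - {\<omega> \<in> space M. union_set (\<Xi> \<omega>) \<inter> {0} = {}}" by auto
    then have "\<P>(\<omega> in M. 0 \<in> union_set (\<Xi> \<omega>)) = 1 - \<P>(\<omega> in M. union_set (\<Xi> \<omega>) \<inter> {0} = {})"
      using M.prob_compl[OF void_event(1)[OF poisson, of "{0}"]] by simp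
    ultimately show False using volume_fraction by simp
  qed
  \<comment> \<open>the increment over the unit segment is part of the finite measure of the cylinders that hit this segment\<close>
  have Co_fin: "C\<^sub>o < \<infinity>"
  proof -
    have "ennreal lam * (ennreal 1 * C\<^sub>o) \<le> emeasure \<Lambda> (hitting_cylinders k (?seg 1))"
      unfolding main[OF zero_less_one] by simp
    also have "\<dots> < \<infinity>" by (rule fin) simp
    finally have "ennreal lam * C\<^sub>o < \<infinity>" by simp
    then show ?thesis using lam by (auto simp: ennreal_mult_less_top)
  qed
  have "linear_contact_distribution M \<Xi> \<eta> r = 1 - exp (- lam * r * enn2real C\<^sub>o)" if r: "r > 0" for r
  proof -
    have "measure \<Lambda> (hitting_cylinders k (?seg r)) =
        measure \<Lambda> (hitting_cylinders k {0}) + enn2real (ennreal lam * (ennreal r * C\<^sub>o))"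
      unfolding measure_def main[OF r] using fin[of "{0}"] Co_fin
      by (intro enn2real_plus) (auto simp: ennreal_mult_less_top)
    also have "enn2real (ennreal lam * (ennreal r * C\<^sub>o)) = lam * r * enn2real C\<^sub>o"
      using lam r by (simp add: enn2real_mult)
    finally show ?thesis using linear_contact_distribution_eqI[OF poisson r] by simp
  qed
  then show ?thesis using Co_fin by blast
qed

end
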